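(* For all $I\subset V$ such that $I^\star=I$, all $\theta\in(0,\infty)^V$ and $\eta\in[0,\infty)^V$, $$\int_{\mathcal S}\nu_{\mathcal S}^{W,\theta,\eta}(d\beta)=\int_{\mathcal S_I\times\mathcal A_{I^c}}\mathcal Q_I^{W,\theta,\eta}(d\beta_I,da_{I^c})=\int_{\mathcal A}\nu_{\mathcal A}^{W,\theta,\eta}(da)$$ (as elements of $[0,\infty]$).
   Context: $\mathcal G=(V,E)$ is a finite directed graph (not necessarily strongly connected) with an involution $\star:V\to V$, $i\mapsto i^\star$, such that $(i,j)\in E\Rightarrow(j^\star,i^\star)\in E$. $(W_{i,j})_{(i,j)\in E}$ are positive weights with $W_{i,j}=W_{j^\star,i^\star}$, extended to a $V\times V$ matrix $W$ by $W_{i,j}=0$ if $(i,j)\notin E$. General definition. Let $J$ be a finite set with an involution $\star$, $J_0$ its set of fixed points, $J_1$ a subset with $J=J_0\sqcup J_1\sqcup J_1^\star$. For $x\in\mathbb R^J$, $x^\star=(x_{i^\star})_i$; $\mathcal S_J=\{x\in\mathbb R^J:x^\star=x\}$, $\mathcal A_J=\{x\in\mathbb R^J:x^\star=-x\}$, $\langle x,y\rangle=\sum_{i\in J}x_{i^\star}y_i$. Let $M$ be a $J\times J$ matrix with nonnegative entries and $M_{i,j}=M_{j^\star,i^\star}$, $\theta\in(0,\infty)^J$, $\eta\in[0,\infty)^J$. For $\beta\in\mathcal S_J$ let $H_\beta=\beta-M$ ($\beta$ acting diagonally); $H_\beta>0$ means all eigenvalues have positive real part, and then $G_\beta=H_\beta^{-1}$.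 Define on $\mathcal S_J$ $$\nu_{\mathcal S_J}^{M,\theta,\eta}(d\beta)=\Big(\prod_{i\in J_0}\theta_i\Big)\frac{\mathbf 1_{H_\beta>0}}{\sqrt{2\pi}^{\dim\mathcal S_J}}e^{-\frac12\langle\theta,H_\beta\theta\rangle-\frac12\langle\eta,G_\beta\eta\rangle+\langle\theta,\eta\rangle}\frac{\prod_{i\in J_0\cup J_1}d\beta_i}{\sqrt{\det H_\beta}}$$ and on $\mathcal A_J$ $$\nu_{\mathcal A_J}^{M,\theta,\eta}(da)=\frac1{\sqrt{2\pi}^{\dim\mathcal A_J}}e^{-\frac12\langle e^{a^\star}\theta,Me^{a^\star}\theta\rangle+\frac12\langle\theta,M\theta\rangle-\langle\eta,e^{a^\star}\theta-\theta\rangle}\prod_{i\in J_1}da_i,\qquad e^{a^\star}\theta=(e^{a_{i^\star}}\theta_i)_i,$$ with unit mass if $J_1=\emptyset$. For $J=V$, $M=W$ write $\mathcal S,\mathcal A,\nu_{\mathcal S}^{W,\theta,\eta},\nu_{\mathcal A}^{W,\theta,\eta}$. The measure $\mathcal Q_I$. For $I=I^\star\subset V$, subscripts $I$, $I^c$ denote restrictions of vectors and blocks of matrices. For $\beta_I\in\mathcal S_I$ put $\hat H_\beta=\beta_I-W_{I,I}$, $\hat G_\beta=\hat H_\beta^{-1}$, $\hat\eta_I=\eta_I+W_{I,I^c}\theta_{I^c}$, $\check W_{I^c,I^c}=W_{I^c,I^c}+W_{I^c,I}\hat G_\beta W_{I,I^c}$, $\check\eta_{I^c}=\eta_{I^c}+W_{I^c,I}\hat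 G_\beta\eta_I$. For $\emptyset\ne I\subsetneq V$, $$\mathcal Q_I^{W,\theta,\eta}(d\beta_I,da_{I^c})=\nu_{\mathcal S_I}^{W_{I,I},\theta_I,\hat\eta_I}(d\beta_I)\,\nu_{\mathcal A_{I^c}}^{\check W_{I^c,I^c},\theta_{I^c},\check\eta_{I^c}}(da_{I^c})$$ on $\mathcal S_I\times\mathcal A_{I^c}$ (the second factor depends on $\beta_I$). By convention $\mathcal Q_V=\nu_{\mathcal S}$ and $\mathcal Q_\emptyset=\nu_{\mathcal A}$. *)

theory Defs
  imports "HOL-Analysis.Analysis"
begin

section \<open>Matrices indexed by a finite set\<close>

text \<open>
  A vector (matrix) indexed by a finite set \<open>J\<close> is a function of one (two) arguments of which only
  the values on \<open>J\<close> matter. Restricting a vector or taking a block of a matrix therefore amounts to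
  changing the index set; \<open>det_on\<close> and \<open>inv_on\<close> are the library notions relative to \<open>J\<close>.
\<close>

definition mult_vec_on :: "'v set \<Rightarrow> ('v \<Rightarrow> 'v \<Rightarrow> 'a::comm_semiring_1) \<Rightarrow> ('v \<Rightarrow> 'a) \<Rightarrow> 'v \<Rightarrow> 'a" where
  "mult_vec_on J A x = (\<lambda>i. \<Sum>j\<in>J. A i j * x j)"

definition det_on :: "'v set \<Rightarrow> ('v \<Rightarrow> 'v \<Rightarrow> real) \<Rightarrow> real" where
  "det_on J A = (\<Sum>p | p permutes J. of_int (sign p) * (\<Prod>i\<in>J. A i (p i)))"

text \<open>The entries of \<open>inv_on J A\<close> in \<open>J \<times> J\<close> are determined if \<open>A\<close> is invertible.\<close>

definition inv_on :: "'v set \<Rightarrow> ('v \<Rightarrow> 'v \<Rightarrow> real) \<Rightarrow> ('v \<Rightarrow> 'v \<Rightarrow> real)" where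
  "inv_on J A = (SOME B. \<forall>i\<in>J. \<forall>j\<in>J.
     (\<Sum>k\<in>J. A i k * B k j) = (if i = j then 1 else 0) \<and>
     (\<Sum>k\<in>J. B i k * A k j) = (if i = j then 1 else 0))"

definition eigenvalue_on :: "'v set \<Rightarrow> ('v \<Rightarrow> 'v \<Rightarrow> real) \<Rightarrow> complex \<Rightarrow> bool" where
  "eigenvalue_on J A z \<longleftrightarrow> (\<exists>x. (\<exists>i\<in>J. x i \<noteq> 0) \<and>
     (\<forall>i\<in>J. mult_vec_on J (\<lambda>i j. complex_of_real (A i j)) x i = z * x i))"

definition pos_on :: "'v set \<Rightarrow> ('v \<Rightarrow> 'v \<Rightarrow> real) \<Rightarrow> bool" where
  "pos_on J A \<longleftrightarrow> (\<forall>z. eigenvalue_on J A z \<longrightarrow> Re z > 0)"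

lemma det_on_UNIV: "det_on UNIV (\<lambda>i j. A $ i $ j) = det A"
  by (simp add: det_on_def det_def)

section \<open>Index sets with an involution\<close>

definition fixed_pts :: "('v \<Rightarrow> 'v) \<Rightarrow> 'v set \<Rightarrow> 'v set" where
  "fixed_pts star J = {i \<in> J. star i = i}"

text \<open>\<open>J1\<close> selects one point of each two-element orbit: \<open>J\<close> is the disjoint union of
  \<open>fixed_pts star J\<close>, \<open>J1\<close> and \<open>star ` J1\<close>.\<close>

definition half_of :: "('v \<Rightarrow> 'v) \<Rightarrow> 'v set \<Rightarrow> 'v set \<Rightarrow> bool" where
  "half_of star J J1 \<longleftrightarrow> J = fixed_pts star J \<union> J1 \<union> star ` J1 \<and>
     fixed_pts star J \<inter> J1 = {} \<and> fixed_pts star J \<inter> star ` J1 = {} \<and> J1 \<inter> star ` J1 = {}"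

definition pairing :: "('v \<Rightarrow> 'v) \<Rightarrow> 'v set \<Rightarrow> ('v \<Rightarrow> real) \<Rightarrow> ('v \<Rightarrow> real) \<Rightarrow> real" where
  "pairing star J x y = (\<Sum>i\<in>J. x (star i) * y i)"

definition sym_space :: "('v \<Rightarrow> 'v) \<Rightarrow> 'v set \<Rightarrow> ('v \<Rightarrow> real) set" where
  "sym_space star J = {x \<in> extensional J. \<forall>i\<in>J. x (star i) = x i}"

definition asym_space :: "('v \<Rightarrow> 'v) \<Rightarrow> 'v set \<Rightarrow> ('v \<Rightarrow> real) set" where
  "asym_space star J = {x \<in> extensional J. \<forall>i\<in>J. x (star i) = - x i}"

text \<open>The reference measures \<open>\<Prod>\<^sub>i d\<beta>\<^sub>i\<close> (\<open>i\<close> in \<open>fixed_pts star J \<union> J1\<close>) and \<open>\<Prod>\<^sub>i da\<^sub>i\<close>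
  (\<open>i\<close> in \<open>J1\<close>): Lebesgue measure in these free coordinates, carried to the (anti)symmetric
  vectors by the map that fills in the remaining coordinates. If \<open>J1 = {}\<close>, the second one is the
  unit mass at the zero vector.\<close>

definition sym_ext :: "('v \<Rightarrow> 'v) \<Rightarrow> 'v set \<Rightarrow> 'v set \<Rightarrow> ('v \<Rightarrow> real) \<Rightarrow> ('v \<Rightarrow> real)" where
  "sym_ext star J J1 x = (\<lambda>i\<in>J. if i \<in> fixed_pts star J \<union> J1 then x i else x (star i))"

definition asym_ext :: "('v \<Rightarrow> 'v) \<Rightarrow> 'v set \<Rightarrow> 'v set \<Rightarrow> ('v \<Rightarrow> real) \<Rightarrow> ('v \<Rightarrow> real)" where
  "asym_ext star J J1 x =
     (\<lambda>i\<in>J. if i \<in> J1 then x i else if i \<in> fixed_pts star J then 0 else - x (star i))"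

definition leb_S :: "('v \<Rightarrow> 'v) \<Rightarrow> 'v set \<Rightarrow> 'v set \<Rightarrow> ('v \<Rightarrow> real) measure" where
  "leb_S star J J1 = distr (\<Pi>\<^sub>M i\<in>fixed_pts star J \<union> J1. lborel)
     (restrict_space (\<Pi>\<^sub>M i\<in>J. borel) (sym_space star J)) (sym_ext star J J1)"

definition leb_A :: "('v \<Rightarrow> 'v) \<Rightarrow> 'v set \<Rightarrow> 'v set \<Rightarrow> ('v \<Rightarrow> real) measure" where
  "leb_A star J J1 = distr (\<Pi>\<^sub>M i\<in>J1. lborel)
     (restrict_space (\<Pi>\<^sub>M i\<in>J. borel) (asym_space star J)) (asym_ext star J J1)"

lemma sym_ext_measurable:
  assumes inv: "\<And>i. star (star i) = i" and half: "half_of star J J1"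
  shows "sym_ext star J J1 \<in> (\<Pi>\<^sub>M i\<in>fixed_pts star J \<union> J1. lborel) \<rightarrow>\<^sub>M
           restrict_space (\<Pi>\<^sub>M i\<in>J. borel) (sym_space star J)"
proof (rule measurable_restrict_space2)
  have J: "J = fixed_pts star J \<union> J1 \<union> star ` J1"
    and d: "fixed_pts star J \<inter> star ` J1 = {}" "J1 \<inter> star ` J1 = {}"
    using half unfolding half_of_def by blast+
  have st: "star i \<in> J" if i: "i \<in> J" for i
  proof -
    consider "star i = i" | "i \<in> J1" | j where "j \<in> J1" "i = star j"
      using i by (subst (asm) J) (auto simp: fixed_pts_def)
    then show ?thesis
    proof cases
      case 2
      then show ?thesis by (subst J) simp
    next
      case 3
      then show ?thesis using inv by (subst J) simp
    qed (use i in simp)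
  qed
  have *: "star i \<in> J1" if "i \<in> J" "i \<notin> fixed_pts star J \<union> J1" for i
  proof -
    have "i \<in> star ` J1" using that by (subst (asm) J) blast
    then show ?thesis using inv by auto
  qed
  have "sym_ext star J J1 x (star i) = sym_ext star J J1 x i" if i: "i \<in> J" for x i
  proof -
    consider "i \<in> fixed_pts star J" | "i \<in> J1" | "i \<notin> fixed_pts star J \<union> J1" by blast
    then show ?thesis
    proof cases
      case 1
      then have "star i = i" by (simp add: fixed_pts_def)
      then show ?thesis by simp
    next
      case 2
      then have "star i \<notin> J1" "star i \<notin> fixed_pts star J" using d by blast+
      then show ?thesis using 2 i st[OF i] inv by (simp add: sym_ext_def)
    next
      case 3
      then show ?thesis using *[OF i] i st[OF i] by (simp add: sym_ext_def)
    qed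
  qed
  then show "sym_ext star J J1 \<in> space (\<Pi>\<^sub>M i\<in>fixed_pts star J \<union> J1. lborel) \<rightarrow> sym_space star J"
    by (simp add: sym_space_def) (simp add: sym_ext_def)
  show "sym_ext star J J1 \<in> (\<Pi>\<^sub>M i\<in>fixed_pts star J \<union> J1. lborel) \<rightarrow>\<^sub>M (\<Pi>\<^sub>M i\<in>J. borel)"
    unfolding sym_ext_def
  proof (rule measurable_restrict)
    fix i assume i: "i \<in> J"
    have c: "(\<lambda>x. x j :: real) \<in> borel_measurable (\<Pi>\<^sub>M i\<in>fixed_pts star J \<union> J1. lborel)"
      if "j \<in> fixed_pts star J \<union> J1" for j
      using measurable_component_singleton[OF that, of "\<lambda>_. lborel :: real measure"] by simp
    show "(\<lambda>x. if i \<in> fixed_pts star J \<union> J1 then x i else x (star i))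
        \<in> borel_measurable (\<Pi>\<^sub>M i\<in>fixed_pts star J \<union> J1. lborel)"
      using *[OF i] c by (cases "i \<in> fixed_pts star J \<union> J1") simp_all
  qed
qed

lemma asym_ext_measurable:
  assumes inv: "\<And>i. star (star i) = i" and half: "half_of star J J1"
  shows "asym_ext star J J1 \<in> (\<Pi>\<^sub>M i\<in>J1. lborel) \<rightarrow>\<^sub>M
           restrict_space (\<Pi>\<^sub>M i\<in>J. borel) (asym_space star J)"
proof (rule measurable_restrict_space2)
  have J: "J = fixed_pts star J \<union> J1 \<union> star ` J1"
    and d: "fixed_pts star J \<inter> J1 = {}" "fixed_pts star J \<inter> star ` J1 = {}" "J1 \<inter> star ` J1 = {}"
    using half unfolding half_of_def by blast+
  have st: "star i \<in> J" if i: "i \<in> J" for i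
  proof -
    consider "star i = i" | "i \<in> J1" | j where "j \<in> J1" "i = star j"
      using i by (subst (asm) J) (auto simp: fixed_pts_def)
    then show ?thesis
    proof cases
      case 2
      then show ?thesis by (subst J) simp
    next
      case 3
      then show ?thesis using inv by (subst J) simp
    qed (use i in simp)
  qed
  have *: "star i \<in> J1" if "i \<in> J" "i \<notin> J1" "i \<notin> fixed_pts star J" for i
  proof -
    have "i \<in> star ` J1" using that by (subst (asm) J) blast
    then show ?thesis using inv by auto
  qed
  have "asym_ext star J J1 x (star i) = - asym_ext star J J1 x i" if i: "i \<in> J" for x i
  proof -
    consider "i \<in> fixed_pts star J" | "i \<in> J1" | "i \<notin> J1" "i \<notin> fixed_pts star J" by blast
    then show ?thesis
    proof cases
      case 1
      then have "star i = i" "i \<notin> J1" using d by (auto simp: fixed_pts_def)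
      then show ?thesis using 1 i by (simp add: asym_ext_def)
    next
      case 2
      then have "star i \<notin> J1" "star i \<notin> fixed_pts star J" using d by blast+
      then show ?thesis using 2 i st[OF i] inv by (simp add: asym_ext_def)
    next
      case 3
      then show ?thesis using *[OF i] i st[OF i] by (simp add: asym_ext_def)
    qed
  qed
  then show "asym_ext star J J1 \<in> space (\<Pi>\<^sub>M i\<in>J1. lborel) \<rightarrow> asym_space star J"
    by (simp add: asym_space_def) (simp add: asym_ext_def)
  show "asym_ext star J J1 \<in> (\<Pi>\<^sub>M i\<in>J1. lborel) \<rightarrow>\<^sub>M (\<Pi>\<^sub>M i\<in>J. borel)"
    unfolding asym_ext_def
  proof (rule measurable_restrict)
    fix i assume i: "i \<in> J"
    have c: "(\<lambda>x. x j :: real) \<in> borel_measurable (\<Pi>\<^sub>M i\<in>J1. lborel)" if "j \<in> J1" for j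
      using measurable_component_singleton[OF that, of "\<lambda>_. lborel :: real measure"] by simp
    show "(\<lambda>x. if i \<in> J1 then x i else if i \<in> fixed_pts star J then 0 else - x (star i))
        \<in> borel_measurable (\<Pi>\<^sub>M i\<in>J1. lborel)"
      using *[OF i] c by (cases "i \<in> J1"; cases "i \<in> fixed_pts star J") simp_all
  qed
qed

section \<open>The measures on symmetric and antisymmetric vectors\<close>

definition H_mat :: "('v \<Rightarrow> 'v \<Rightarrow> real) \<Rightarrow> ('v \<Rightarrow> real) \<Rightarrow> ('v \<Rightarrow> 'v \<Rightarrow> real)" where
  "H_mat M \<beta> = (\<lambda>i j. (if i = j then \<beta> i else 0) - M i j)"

definition G_mat :: "'v set \<Rightarrow> ('v \<Rightarrow> 'v \<Rightarrow> real) \<Rightarrow> ('v \<Rightarrow> real) \<Rightarrow> ('v \<Rightarrow> 'v \<Rightarrow> real)" where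
  "G_mat J M \<beta> = inv_on J (H_mat M \<beta>)"

text \<open>In the two densities, \<open>card (fixed_pts star J \<union> J1)\<close> and \<open>card J1\<close> are the dimensions of
  \<open>sym_space star J\<close> and \<open>asym_space star J\<close>.\<close>

definition nu_S_dens :: "('v \<Rightarrow> 'v) \<Rightarrow> 'v set \<Rightarrow> 'v set \<Rightarrow> ('v \<Rightarrow> 'v \<Rightarrow> real) \<Rightarrow>
    ('v \<Rightarrow> real) \<Rightarrow> ('v \<Rightarrow> real) \<Rightarrow> ('v \<Rightarrow> real) \<Rightarrow> real" where
  "nu_S_dens star J J1 M \<theta> \<eta> \<beta> =
     (\<Prod>i\<in>fixed_pts star J. \<theta> i) *
     ((if pos_on J (H_mat M \<beta>) then 1 else 0) / sqrt (2 * pi) ^ card (fixed_pts star J \<union> J1)) *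
     exp (- (1/2) * pairing star J \<theta> (mult_vec_on J (H_mat M \<beta>) \<theta>)
          - (1/2) * pairing star J \<eta> (mult_vec_on J (G_mat J M \<beta>) \<eta>)
          + pairing star J \<theta> \<eta>) *
     (1 / sqrt (det_on J (H_mat M \<beta>)))"

definition nu_S :: "('v \<Rightarrow> 'v) \<Rightarrow> 'v set \<Rightarrow> 'v set \<Rightarrow> ('v \<Rightarrow> 'v \<Rightarrow> real) \<Rightarrow>
    ('v \<Rightarrow> real) \<Rightarrow> ('v \<Rightarrow> real) \<Rightarrow> ('v \<Rightarrow> real) measure" where
  "nu_S star J J1 M \<theta> \<eta> =
     density (leb_S star J J1) (\<lambda>\<beta>. ennreal (nu_S_dens star J J1 M \<theta> \<eta> \<beta>))"

definition exp_star :: "('v \<Rightarrow> 'v) \<Rightarrow> ('v \<Rightarrow> real) \<Rightarrow> ('v \<Rightarrow> real) \<Rightarrow> ('v \<Rightarrow> real)" where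
  "exp_star star a \<theta> = (\<lambda>i. exp (a (star i)) * \<theta> i)"

definition nu_A_dens :: "('v \<Rightarrow> 'v) \<Rightarrow> 'v set \<Rightarrow> 'v set \<Rightarrow> ('v \<Rightarrow> 'v \<Rightarrow> real) \<Rightarrow>
    ('v \<Rightarrow> real) \<Rightarrow> ('v \<Rightarrow> real) \<Rightarrow> ('v \<Rightarrow> real) \<Rightarrow> real" where
  "nu_A_dens star J J1 M \<theta> \<eta> a =
     (1 / sqrt (2 * pi) ^ card J1) *
     exp (- (1/2) * pairing star J (exp_star star a \<theta>) (mult_vec_on J M (exp_star star a \<theta>))
          + (1/2) * pairing star J \<theta> (mult_vec_on J M \<theta>)
          - pairing star J \<eta> (\<lambda>i. exp_star star a \<theta> i - \<theta> i))"

definition nu_A :: "('v \<Rightarrow> 'v) \<Rightarrow> 'v set \<Rightarrow> 'v set \<Rightarrow> ('v \<Rightarrow> 'v \<Rightarrow> real) \<Rightarrow>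
    ('v \<Rightarrow> real) \<Rightarrow> ('v \<Rightarrow> real) \<Rightarrow> ('v \<Rightarrow> real) measure" where
  "nu_A star J J1 M \<theta> \<eta> =
     density (leb_A star J J1) (\<lambda>a. ennreal (nu_A_dens star J J1 M \<theta> \<eta> a))"

section \<open>The mixed measure\<close>

definition hat_eta :: "'v set \<Rightarrow> ('v \<Rightarrow> 'v \<Rightarrow> real) \<Rightarrow> ('v \<Rightarrow> real) \<Rightarrow> ('v \<Rightarrow> real) \<Rightarrow> ('v \<Rightarrow> real)" where
  "hat_eta I W \<theta> \<eta> = (\<lambda>i. \<eta> i + mult_vec_on (- I) W \<theta> i)"

definition check_W :: "'v set \<Rightarrow> ('v \<Rightarrow> 'v \<Rightarrow> real) \<Rightarrow> ('v \<Rightarrow> real) \<Rightarrow> ('v \<Rightarrow> 'v \<Rightarrow> real)" where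
  "check_W I W \<beta> = (\<lambda>i j. W i j + (\<Sum>k\<in>I. \<Sum>l\<in>I. W i k * G_mat I W \<beta> k l * W l j))"

definition check_eta :: "'v set \<Rightarrow> ('v \<Rightarrow> 'v \<Rightarrow> real) \<Rightarrow> ('v \<Rightarrow> real) \<Rightarrow> ('v \<Rightarrow> real) \<Rightarrow> ('v \<Rightarrow> real)" where
  "check_eta I W \<eta> \<beta> = (\<lambda>i. \<eta> i + mult_vec_on I W (mult_vec_on I (G_mat I W \<beta>) \<eta>) i)"

text \<open>
  The measure \<open>\<nu>\<^sub>S(d\<beta>) \<nu>\<^sub>A(da)\<close> on pairs \<open>(\<beta>, a)\<close>, where the second factor depends on \<open>\<beta>\<close>, is given
  by the product of the two densities with respect to the product of the reference measures.
  \<open>I1\<close> and \<open>K1\<close> are the chosen halves of \<open>I\<close> and of its complement.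
  For \<open>I = UNIV\<close> (\<open>I = {}\<close>) the second (first) factor is a unit mass at the only vector indexed by
  the empty set, by the lemmas below, so the same formula covers the convention that the mixed
  measure is then \<open>\<nu>\<^sub>S\<close> (\<open>\<nu>\<^sub>A\<close>).
\<close>

definition Q_meas :: "('v \<Rightarrow> 'v) \<Rightarrow> 'v set \<Rightarrow> 'v set \<Rightarrow> 'v set \<Rightarrow> ('v \<Rightarrow> 'v \<Rightarrow> real) \<Rightarrow>
    ('v \<Rightarrow> real) \<Rightarrow> ('v \<Rightarrow> real) \<Rightarrow> (('v \<Rightarrow> real) \<times> ('v \<Rightarrow> real)) measure" where
  "Q_meas star I I1 K1 W \<theta> \<eta> =
     density (leb_S star I I1 \<Otimes>\<^sub>M leb_A star (- I) K1)
       (\<lambda>(\<beta>, a). ennreal (nu_S_dens star I I1 W \<theta> (hat_eta I W \<theta> \<eta>) \<beta>) *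
         ennreal (nu_A_dens star (- I) K1 (check_W I W \<beta>) \<theta> (check_eta I W \<eta> \<beta>) a))"

lemma nu_dens_empty:
  "nu_S_dens star {} {} M \<theta> \<eta> \<beta> = 1" "nu_A_dens star {} {} M \<theta> \<eta> a = 1"
  by (simp_all add: nu_S_dens_def nu_A_dens_def fixed_pts_def pos_on_def eigenvalue_on_def
      pairing_def det_on_def)

lemma hat_check_trivial:
  "hat_eta UNIV W \<theta> \<eta> = \<eta>" "check_W {} W \<beta> = W" "check_eta {} W \<eta> \<beta> = \<eta>"
  by (simp_all add: hat_eta_def check_W_def check_eta_def mult_vec_on_def)

lemma leb_empty:
  "space (leb_S star {} {}) = {\<lambda>_. undefined}"
  "emeasure (leb_S star {} {}) (space (leb_S star {} {})) = 1"
  "space (leb_A star {} {}) = {\<lambda>_. undefined}"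
  "emeasure (leb_A star {} {}) (space (leb_A star {} {})) = 1"
proof -
  have ms: "sym_ext star {} {} \<in> (\<Pi>\<^sub>M i\<in>fixed_pts star {} \<union> {}. lborel) \<rightarrow>\<^sub>M
      restrict_space (\<Pi>\<^sub>M i\<in>{}. borel) (sym_space star {})"
    by (rule measurable_restrict_space2)
      (auto simp: fixed_pts_def sym_ext_def sym_space_def PiM_empty)
  have ma: "asym_ext star {} {} \<in> (\<Pi>\<^sub>M i\<in>{}. lborel) \<rightarrow>\<^sub>M
      restrict_space (\<Pi>\<^sub>M i\<in>{}. borel) (asym_space star {})"
    by (rule measurable_restrict_space2)
      (auto simp: fixed_pts_def asym_ext_def asym_space_def PiM_empty)
  have one: "emeasure (\<Pi>\<^sub>M i\<in>{}. lborel :: real measure) {\<lambda>_. undefined} = 1"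
    by simp
  show sS: "space (leb_S star {} {}) = {\<lambda>_. undefined}"
    by (auto simp: leb_S_def space_restrict_space sym_space_def space_PiM)
  show sA: "space (leb_A star {} {}) = {\<lambda>_. undefined}"
    by (auto simp: leb_A_def space_restrict_space asym_space_def space_PiM)
  have eS: "emeasure (distr M N f) (space (distr M N f)) = emeasure M (space M)"
    if "f \<in> M \<rightarrow>\<^sub>M N" for M :: "('v \<Rightarrow> real) measure" and N :: "('v \<Rightarrow> real) measure" and f
    using that by (subst emeasure_distr) (auto intro!: arg_cong[where f="emeasure M"] dest: measurable_space)
  show "emeasure (leb_S star {} {}) (space (leb_S star {} {})) = 1"
    unfolding leb_S_def using one by (subst eS[OF ms]) (simp add: fixed_pts_def space_PiM)
  show "emeasure (leb_A star {} {}) (space (leb_A star {} {})) = 1"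
    unfolding leb_A_def using one by (subst eS[OF ma]) (simp add: space_PiM)
qed

end

theory Submission
  imports Defs "HOL-Probability.Distributions"
begin

text \<open>
  Write \<open>S(J)\<close> and \<open>A(J)\<close> for the total masses of \<open>\<nu>\<^sub>S\<close> and \<open>\<nu>\<^sub>A\<close> on a star-invariant index set \<open>J\<close>, for an
  arbitrary nonnegative star-symmetric matrix and arbitrary \<open>\<theta> > 0\<close>, \<open>\<eta> \<ge> 0\<close>. Everything follows from
  three pointwise identities between densities, valid for disjoint star-invariant sets \<open>I\<close> and \<open>K\<close>.

  \<^item> Eliminating \<open>I\<close> from \<open>H\<^sub>\<beta>\<close> on \<open>I \<union> K\<close> leaves the Schur complement \<open>\<beta> - check_W\<close> on \<open>K\<close>. The sign
  condition, the determinant and the quadratic forms all split accordingly, so the density of \<open>\<nu>\<^sub>S\<close> on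
  \<open>I \<union> K\<close> is the product of a density on \<open>I\<close> (with \<open>\<eta> + W\<^sub>I\<^sub>K \<theta>\<close> for \<open>\<eta>\<close>) and one on \<open>K\<close> (with the
  parameters \<open>check_W\<close>, \<open>check_eta\<close>): \<open>nu_S_dens_union\<close>.

  \<^item> In the density of \<open>\<nu>\<^sub>A\<close> on \<open>I \<union> K\<close>, with the coordinates in \<open>K\<close> held fixed, what remains is a factor
  \<open>c(a)\<close> times the density of \<open>\<nu>\<^sub>A\<close> on \<open>I\<close> in which \<open>\<eta>\<close> is replaced by \<open>\<eta> + W\<^sub>I\<^sub>K y\<close>, where \<open>y\<close> is the
  vector \<open>e\<^bsup>a*\<^esup>\<theta>\<close> on \<open>K\<close>: \<open>nu_A_dens_union\<close>.

  \<^item> The mixed density with \<open>\<beta>\<close> on \<open>I\<close> and \<open>a\<close> on \<open>K\<close> is the same factor \<open>c(a)\<close> times the density of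
  \<open>\<nu>\<^sub>S\<close> on \<open>I\<close>, again with \<open>\<eta> + W\<^sub>I\<^sub>K y\<close> for \<open>\<eta>\<close>, because the terms with \<open>G\<close> in its two exponents
  add up to \<open>- \<langle>\<eta> + Wy, G(\<eta> + Wy)\<rangle> / 2\<close>: \<open>mixed_dens\<close>.

  Suppose that \<open>S = A\<close> is known on \<open>K\<close> and on \<open>I\<close>, for all parameters. Integrating the first identity
  over \<open>\<beta>\<^sub>K\<close> and using \<open>S(K) = A(K)\<close> turns \<open>S(I \<union> K)\<close> into the mixed integral. Tonelli and the third
  identity rewrite the mixed integral as an integral over \<open>a\<^sub>K\<close> of \<open>c(a) S(I)\<close>, which by \<open>S(I) = A(I)\<close>
  and the second identity is \<open>A(I \<union> K)\<close>. For \<open>K\<close> the complement of \<open>I\<close> this is the theorem, and it also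
  reduces \<open>S(J) = A(J)\<close> to the case of a single orbit of the involution (\<open>balanced_union\<close>,
  \<open>balanced_all\<close>).

  For a fixed point, \<open>S = 1\<close> is the normalization of a reciprocal inverse Gaussian density
  (\<open>nn_integral_exp_inverse_sqrt\<close>), and \<open>A = 1\<close> is trivial. For a two-point orbit both sides are
  one-dimensional integrals, possibly infinite (\<open>pair_integrals_eq\<close>). If both off-diagonal entries are
  positive, they can be made equal by scaling; then \<open>\<langle>\<eta>, G\<eta>\<rangle>\<close> splits into partial fractions, one of the
  two factors is a Gaussian integral over an auxiliary variable \<open>z\<close>, the integral over \<open>\<beta>\<close> is again of
  inverse Gaussian type, and the substitution of a multiple of \<open>sinh u\<close> for \<open>z\<close> produces the integral
  over \<open>a\<close>. If one of the entries vanishes, an exponential substitution suffices.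

  The choice of one point in each orbit only selects coordinates. It is carried along in the
  induction: the equality \<open>S = A\<close> is proved for independent choices on the two sides.
\<close>

section \<open>Inverses and determinants on a subset of the indices\<close>

definition is_inv_on :: "'v set \<Rightarrow> ('v \<Rightarrow> 'v \<Rightarrow> real) \<Rightarrow> ('v \<Rightarrow> 'v \<Rightarrow> real) \<Rightarrow> bool" where
  "is_inv_on J A B \<longleftrightarrow> (\<forall>i\<in>J. \<forall>j\<in>J.
     (\<Sum>k\<in>J. A i k * B k j) = (if i = j then 1 else 0) \<and>
     (\<Sum>k\<in>J. B i k * A k j) = (if i = j then 1 else 0))"

text \<open>
  Extending a matrix on \<open>J\<close> by the identity gives a matrix over the whole type with the same
  determinant and, on \<open>J\<close>, the same inverse. Products and Cramer's rule then come from the theory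
  of square matrices over a finite type.
\<close>

definition id_extension :: "'v set \<Rightarrow> ('v \<Rightarrow> 'v \<Rightarrow> real) \<Rightarrow> real^'v^'v" where
  "id_extension J A = (\<chi> i j. if i \<in> J \<and> j \<in> J then A i j else if i = j then 1 else 0)"

lemma det_on_id_extension:
  fixes A :: "'v::finite \<Rightarrow> 'v \<Rightarrow> real"
  shows "det_on J A = det (id_extension J A)"
proof -
  have "det (id_extension J A) = (\<Sum>p | p permutes J. of_int (sign p) * (\<Prod>i\<in>UNIV. id_extension J A $ i $ p i))"
    unfolding det_def
  proof (rule sum.mono_neutral_right)
    show "finite {p. p permutes (UNIV::'v set)}" by simp
    show "{p. p permutes J} \<subseteq> {p. p permutes UNIV}" by (auto intro: permutes_subset)
    show "\<forall>p\<in>{p. p permutes UNIV} - {p. p permutes J}. of_int (sign p) * (\<Prod>i\<in>UNIV. id_extension J A $ i $ p i) = 0"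
    proof
      fix p :: "'v \<Rightarrow> 'v" assume p: "p \<in> {p. p permutes UNIV} - {p. p permutes J}"
      then have "\<exists>i. i \<notin> J \<and> p i \<noteq> i" 
        by (auto simp: permutes_def)
      then obtain i where "i \<notin> J" "p i \<noteq> i" by blast
      then have "id_extension J A $ i $ p i = 0" by (simp add: id_extension_def)
      then have "(\<Prod>i\<in>UNIV. id_extension J A $ i $ p i) = 0" by (intro prod_zero) auto
      then show "of_int (sign p) * (\<Prod>i\<in>UNIV. id_extension J A $ i $ p i) = 0" by simp
    qed
  qed
  also have "\<dots> = det_on J A"
    unfolding det_on_def
  proof (rule sum.cong, rule refl)
    fix p assume "p \<in> {p. p permutes J}"
    then have p: "p permutes J" by simp
    have "(\<Prod>i\<in>UNIV. id_extension J A $ i $ p i) = (\<Prod>i\<in>J. id_extension J A $ i $ p i)"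
      using p by (intro prod.mono_neutral_right) (auto simp: id_extension_def permutes_not_in)
    also have "\<dots> = (\<Prod>i\<in>J. A i (p i))"
      using p by (intro prod.cong) (auto simp: id_extension_def permutes_in_image)
    finally show "of_int (sign p) * (\<Prod>i\<in>UNIV. id_extension J A $ i $ p i) = of_int (sign p) * (\<Prod>i\<in>J. A i (p i))"
      by simp
  qed
  finally show ?thesis by simp
qed

text \<open>
  Unlike \<open>inv_on\<close>, which is an arbitrary choice, this inverse is an explicit rational function of the
  entries, hence measurable and, where the determinant does not vanish, continuous.
\<close>

definition cramer_inv :: "'v set \<Rightarrow> ('v::finite \<Rightarrow> 'v \<Rightarrow> real) \<Rightarrow> 'v \<Rightarrow> 'v \<Rightarrow> real" where
  "cramer_inv J A k l =
     det ((\<chi> i j. if j = k then (if i = l then 1 else 0) else id_extension J A $ i $ j) :: real^'v^'v) / det_on J A"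

lemma is_inv_on_cramer:
  fixes A :: "'v::finite \<Rightarrow> 'v \<Rightarrow> real"
  assumes "det_on J A \<noteq> 0"
  shows "is_inv_on J A (cramer_inv J A)"
proof -
  define X where "X = ((\<chi> k l. cramer_inv J A k l) :: real^'v^'v)"
  have d: "det (id_extension J A) \<noteq> 0" using assms by (simp add: det_on_id_extension)
  have col: "id_extension J A *v (\<chi> k. cramer_inv J A k l) = axis l 1" for l
  proof -
    have "(\<chi> k. cramer_inv J A k l) =
        (\<chi> k. det (\<chi> i j. if j = k then (axis l 1 :: real^'v) $ i else id_extension J A $ i $ j) / det (id_extension J A))"
      by (simp add: cramer_inv_def det_on_id_extension axis_def eq_commute cong: if_cong)
    then show ?thesis using cramer[OF d] by blast
  qed
  have AX: "id_extension J A ** X = mat 1"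
  proof -
    have "(id_extension J A ** X) $ i $ l = (mat 1 :: real^'v^'v) $ i $ l" for i l
    proof -
      have "(id_extension J A ** X) $ i $ l = (id_extension J A *v (\<chi> k. cramer_inv J A k l)) $ i"
        by (simp add: matrix_matrix_mult_def matrix_vector_mult_def X_def)
      then show ?thesis by (simp add: col axis_def mat_def)
    qed
    then show ?thesis by (simp add: vec_eq_iff)
  qed
  then have XA: "X ** id_extension J A = mat 1" by (simp add: matrix_left_right_inverse)
  show ?thesis unfolding is_inv_on_def
  proof (intro ballI conjI)
    fix i j assume ij: "i \<in> J" "j \<in> J"
    have "(\<Sum>k\<in>J. A i k * cramer_inv J A k j) = (\<Sum>k\<in>UNIV. id_extension J A $ i $ k * cramer_inv J A k j)"
      using ij by (intro sum.mono_neutral_cong_left) (auto simp: id_extension_def)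
    also have "\<dots> = (id_extension J A ** X) $ i $ j" by (simp add: matrix_matrix_mult_def X_def)
    finally show "(\<Sum>k\<in>J. A i k * cramer_inv J A k j) = (if i = j then 1 else 0)" 
      by (simp add: AX mat_def)
    have "(\<Sum>k\<in>J. cramer_inv J A i k * A k j) = (\<Sum>k\<in>UNIV. cramer_inv J A i k * id_extension J A $ k $ j)"
      using ij by (intro sum.mono_neutral_cong_left) (auto simp: id_extension_def)
    also have "\<dots> = (X ** id_extension J A) $ i $ j" by (simp add: matrix_matrix_mult_def X_def)
    finally show "(\<Sum>k\<in>J. cramer_inv J A i k * A k j) = (if i = j then 1 else 0)" 
      by (simp add: XA mat_def)
  qed
qed

lemma is_inv_on_unique:
  assumes fin: "finite J" and B: "is_inv_on J A B" and C: "is_inv_on J A C" and ij: "i \<in> J" "j \<in> J"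
  shows "B i j = C i j"
proof -
  have "B i j = (\<Sum>k\<in>J. if k = j then B i k else 0)"
    using fin ij by simp
  also have "\<dots> = (\<Sum>k\<in>J. B i k * (if k = j then 1 else 0))"
    by (intro sum.cong) auto
  also have "\<dots> = (\<Sum>k\<in>J. B i k * (\<Sum>l\<in>J. A k l * C l j))"
    using C ij by (intro sum.cong) (auto simp: is_inv_on_def)
  also have "\<dots> = (\<Sum>l\<in>J. (\<Sum>k\<in>J. B i k * A k l) * C l j)"
    unfolding sum_distrib_left sum_distrib_right by (subst sum.swap) (simp add: mult.assoc)
  also have "\<dots> = (\<Sum>l\<in>J. (if i = l then 1 else 0) * C l j)"
    using B ij by (intro sum.cong) (auto simp: is_inv_on_def)
  also have "\<dots> = (\<Sum>l\<in>J. if i = l then C l j else 0)" by (intro sum.cong) auto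
  also have "\<dots> = C i j" using fin ij by simp
  finally show ?thesis .
qed

lemma is_inv_on_inv_on:
  assumes "is_inv_on J A B"
  shows "is_inv_on J A (inv_on J A)"
  unfolding is_inv_on_def inv_on_def
  by (rule someI[where x = B]) (use assms in \<open>simp add: is_inv_on_def\<close>)

lemma inv_on_eq:
  assumes "finite J" "is_inv_on J A B" "i \<in> J" "j \<in> J"
  shows "inv_on J A i j = B i j"
  by (rule is_inv_on_unique[OF assms(1) is_inv_on_inv_on[OF assms(2)] assms(2-4)])

lemma det_on_nonzeroI:
  fixes A :: "'v::finite \<Rightarrow> 'v \<Rightarrow> real"
  assumes inj: "\<And>y. (\<forall>i\<in>J. mult_vec_on J A y i = 0) \<Longrightarrow> (\<forall>i\<in>J. y i = 0)"
  shows "det_on J A \<noteq> 0"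
proof -
  have "x = 0" if x: "id_extension J A *v x = 0" for x :: "real^'v"
  proof -
    have s: "(\<Sum>j\<in>UNIV. id_extension J A $ i $ j * x $ j) = 0" for i
      using x by (simp add: vec_eq_iff matrix_vector_mult_def)
    have out: "x $ i = 0" if "i \<notin> J" for i
    proof -
      have "(\<Sum>j\<in>UNIV. id_extension J A $ i $ j * x $ j) = (\<Sum>j\<in>UNIV. if i = j then x $ j else 0)"
        using that by (intro sum.cong) (auto simp: id_extension_def)
      then show ?thesis using s[of i] by simp
    qed
    have "mult_vec_on J A (\<lambda>i. x $ i) i = 0" if "i \<in> J" for i
    proof -
      have "mult_vec_on J A (\<lambda>i. x $ i) i = (\<Sum>j\<in>UNIV. id_extension J A $ i $ j * x $ j)"
        unfolding mult_vec_on_def using that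
        by (intro sum.mono_neutral_cong_left) (auto simp: id_extension_def)
      then show ?thesis by (simp add: s)
    qed
    then have "\<forall>i\<in>J. x $ i = 0" using inj by blast
    then show ?thesis using out by (auto simp: vec_eq_iff)
  qed
  then have "\<exists>B. B ** id_extension J A = mat 1" using matrix_left_invertible_ker by blast
  then have "invertible (id_extension J A)" using invertible_left_inverse by blast
  then show ?thesis by (simp add: invertible_det_nz det_on_id_extension)
qed

lemma is_inv_on_right:
  assumes "finite J" "is_inv_on J A B" "i \<in> J"
  shows "mult_vec_on J A (mult_vec_on J B y) i = y i"
proof -
  have "mult_vec_on J A (mult_vec_on J B y) i = (\<Sum>j\<in>J. (\<Sum>k\<in>J. A i k * B k j) * y j)"
    unfolding mult_vec_on_def sum_distrib_left sum_distrib_right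
    by (subst sum.swap) (simp add: mult.assoc)
  also have "\<dots> = (\<Sum>j\<in>J. if i = j then y j else 0)"
    using assms by (intro sum.cong) (auto simp: is_inv_on_def)
  finally show ?thesis using assms by simp
qed

lemma is_inv_on_left:
  assumes "finite J" "is_inv_on J A B" "i \<in> J"
  shows "mult_vec_on J B (mult_vec_on J A y) i = y i"
proof -
  have "is_inv_on J B A" using assms by (simp add: is_inv_on_def)
  then show ?thesis by (rule is_inv_on_right[OF assms(1) _ assms(3)])
qed

lemma mult_vec_on_cong:
  assumes "\<And>j. j \<in> J \<Longrightarrow> A i j = B i j" "\<And>j. j \<in> J \<Longrightarrow> x j = y j"
  shows "mult_vec_on J A x i = mult_vec_on J B y i"
  unfolding mult_vec_on_def using assms by (intro sum.cong) simp_all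


section \<open>M-matrices\<close>

text \<open>
  For a matrix with nonpositive off-diagonal entries this is one of the classical characterizations of
  a nonsingular M-matrix. It is the working form of the condition \<open>pos_on\<close>: it behaves well under
  Schur complements and implies that the inverse is nonnegative.
\<close>

definition semipos :: "'v set \<Rightarrow> ('v \<Rightarrow> 'v \<Rightarrow> real) \<Rightarrow> bool" where
  "semipos J A \<longleftrightarrow> (\<exists>x. (\<forall>i\<in>J. x i > 0) \<and> (\<forall>i\<in>J. mult_vec_on J A x i > 0))"

lemma H_mat_mult:
  assumes "finite J" "i \<in> J"
  shows "mult_vec_on J (H_mat M \<beta>) x i = \<beta> i * x i - (\<Sum>j\<in>J. M i j * x j)"
proof -
  have "mult_vec_on J (H_mat M \<beta>) x i = (\<Sum>j\<in>J. (if i = j then \<beta> j * x j else 0) - M i j * x j)"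
    unfolding mult_vec_on_def H_mat_def by (intro sum.cong) (auto simp: algebra_simps)
  then show ?thesis using assms by (simp add: sum_subtractf)
qed

text \<open>
  Minimum principle: if \<open>x\<close> is a positive vector with \<open>Hx > 0\<close> and \<open>y / x\<close> takes its minimum \<open>m\<close> at
  \<open>i\<close>, then \<open>(Hy)\<^sub>i \<le> m (Hx)\<^sub>i\<close>, since the off-diagonal entries are nonpositive. So \<open>m < 0\<close> contradicts
  \<open>Hy \<ge> 0\<close>.
\<close>

lemma semipos_monotone:
  fixes M :: "'v::finite \<Rightarrow> 'v \<Rightarrow> real"
  assumes M: "\<And>i j. M i j \<ge> 0" and sp: "semipos J (H_mat M \<beta>)"
    and y: "\<And>i. i \<in> J \<Longrightarrow> mult_vec_on J (H_mat M \<beta>) y i \<ge> 0" and k: "k \<in> J"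
  shows "y k \<ge> 0"
proof -
  obtain x where x: "\<And>i. i \<in> J \<Longrightarrow> x i > 0" and Hx: "\<And>i. i \<in> J \<Longrightarrow> mult_vec_on J (H_mat M \<beta>) x i > 0"
    using sp unfolding semipos_def by blast
  define m where "m = Min ((\<lambda>i. y i / x i) ` J)"
  have "m \<in> (\<lambda>i. y i / x i) ` J" unfolding m_def using k by (intro Min_in) auto
  then obtain i where i: "i \<in> J" "m = y i / x i" by blast
  have mle: "m * x j \<le> y j" if "j \<in> J" for j
  proof -
    have "m \<le> y j / x j" unfolding m_def using that by (intro Min_le) auto
    then show ?thesis using x[OF that] by (simp add: pos_le_divide_eq)
  qed
  have "m \<ge> 0"
  proof (rule ccontr)
    assume "\<not> m \<ge> 0"
    have yi: "y i = m * x i" using i x[of i] by simp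
    have "mult_vec_on J (H_mat M \<beta>) y i = \<beta> i * (m * x i) - (\<Sum>j\<in>J. M i j * y j)"
      using i by (simp add: H_mat_mult yi)
    also have "\<dots> \<le> \<beta> i * (m * x i) - (\<Sum>j\<in>J. M i j * (m * x j))"
      using M mle by (intro diff_left_mono sum_mono mult_left_mono) auto
    also have "\<dots> = m * mult_vec_on J (H_mat M \<beta>) x i"
      using i by (simp add: H_mat_mult algebra_simps sum_distrib_left)
    also have "\<dots> < 0" using \<open>\<not> m \<ge> 0\<close> Hx[OF i(1)] by (simp add: mult_neg_pos)
    finally show False using y[OF i(1)] by simp
  qed
  then have "0 \<le> m * x k" using x[OF k] by simp
  then show ?thesis using mle[OF k] by linarith
qed

lemma semipos_det_nonzero:
  fixes M :: "'v::finite \<Rightarrow> 'v \<Rightarrow> real"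
  assumes M: "\<And>i j. M i j \<ge> 0" and sp: "semipos J (H_mat M \<beta>)"
  shows "det_on J (H_mat M \<beta>) \<noteq> 0"
proof (rule det_on_nonzeroI)
  fix y assume y: "\<forall>i\<in>J. mult_vec_on J (H_mat M \<beta>) y i = 0"
  have "mult_vec_on J (H_mat M \<beta>) (\<lambda>i. - y i) i = - mult_vec_on J (H_mat M \<beta>) y i" for i
    by (simp add: mult_vec_on_def sum_negf)
  then show "\<forall>i\<in>J. y i = 0"
    using semipos_monotone[OF M sp, of y] semipos_monotone[OF M sp, of "\<lambda>i. - y i"] y
    by (simp add: order_antisym)
qed

lemma is_inv_on_G_mat:
  fixes M :: "'v::finite \<Rightarrow> 'v \<Rightarrow> real"
  assumes M: "\<And>i j. M i j \<ge> 0" and sp: "semipos J (H_mat M \<beta>)"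
  shows "is_inv_on J (H_mat M \<beta>) (G_mat J M \<beta>)"
  unfolding G_mat_def by (rule is_inv_on_inv_on[OF is_inv_on_cramer[OF semipos_det_nonzero[OF assms]]])

lemma semipos_inv_nonneg:
  fixes M :: "'v::finite \<Rightarrow> 'v \<Rightarrow> real"
  assumes M: "\<And>i j. M i j \<ge> 0" and sp: "semipos J (H_mat M \<beta>)"
    and B: "is_inv_on J (H_mat M \<beta>) B" and kl: "k \<in> J" "l \<in> J"
  shows "B k l \<ge> 0"
proof (rule semipos_monotone[OF M sp _ kl(1), where y = "\<lambda>k. B k l"])
  fix i assume "i \<in> J"
  then show "mult_vec_on J (H_mat M \<beta>) (\<lambda>k. B k l) i \<ge> 0"
    using B kl by (simp add: mult_vec_on_def is_inv_on_def)
qed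

text \<open>
  The vector \<open>x = H\<^sup>-\<^sup>1 1\<close> is a witness: it is nonnegative with \<open>Hx = 1\<close>, and a zero entry of \<open>x\<close>
  would make the corresponding entry of \<open>Hx\<close> nonpositive.
\<close>

lemma nonneg_inv_semipos:
  fixes M :: "'v::finite \<Rightarrow> 'v \<Rightarrow> real"
  assumes M: "\<And>i j. M i j \<ge> 0" and B: "is_inv_on J (H_mat M \<beta>) B"
    and pos: "\<And>k l. k \<in> J \<Longrightarrow> l \<in> J \<Longrightarrow> B k l \<ge> 0"
  shows "semipos J (H_mat M \<beta>)"
proof -
  define x where "x = mult_vec_on J B (\<lambda>_. 1)"
  have Hx: "mult_vec_on J (H_mat M \<beta>) x i = 1" if "i \<in> J" for i
    unfolding x_def using is_inv_on_right[OF _ B that] by simp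
  have x0: "x i \<ge> 0" if "i \<in> J" for i
    unfolding x_def mult_vec_on_def using pos that by (intro sum_nonneg) auto
  have "x i > 0" if "i \<in> J" for i
  proof (rule ccontr)
    assume "\<not> x i > 0"
    then have "x i = 0" using x0[OF that] by simp
    moreover have "(\<Sum>j\<in>J. M i j * x j) \<ge> 0" using M x0 by (intro sum_nonneg) auto
    ultimately show False using Hx[OF that] that by (simp add: H_mat_mult)
  qed
  then show ?thesis using Hx unfolding semipos_def by (intro exI[of _ x]) auto
qed

text \<open>
  This expresses the positivity condition by finitely many inequalities between explicit functions of
  the entries, which gives both its closedness along a path of invertible matrices and its
  measurability.
\<close>

lemma semipos_iff_cramer:
  fixes M :: "'v::finite \<Rightarrow> 'v \<Rightarrow> real"
  assumes M: "\<And>i j. M i j \<ge> 0"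
  shows "semipos J (H_mat M \<beta>) \<longleftrightarrow> det_on J (H_mat M \<beta>) \<noteq> 0 \<and>
    (\<forall>k\<in>J. \<forall>l\<in>J. cramer_inv J (H_mat M \<beta>) k l \<ge> 0)"
proof
  assume sp: "semipos J (H_mat M \<beta>)"
  then have d: "det_on J (H_mat M \<beta>) \<noteq> 0" using semipos_det_nonzero M by blast
  then show "det_on J (H_mat M \<beta>) \<noteq> 0 \<and> (\<forall>k\<in>J. \<forall>l\<in>J. cramer_inv J (H_mat M \<beta>) k l \<ge> 0)"
    using semipos_inv_nonneg[OF M sp is_inv_on_cramer[OF d]] by blast
next
  assume d: "det_on J (H_mat M \<beta>) \<noteq> 0 \<and> (\<forall>k\<in>J. \<forall>l\<in>J. cramer_inv J (H_mat M \<beta>) k l \<ge> 0)"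
  show "semipos J (H_mat M \<beta>)"
    using d by (intro nonneg_inv_semipos[OF M is_inv_on_cramer]) auto
qed

text \<open>
  Gershgorin's argument after rescaling by \<open>x\<close>: at an index where \<open>\<bar>y\<bar> / x\<close> is maximal, the eigenvalue
  equation gives \<open>\<bar>\<beta>\<^sub>i - z\<bar> < \<beta>\<^sub>i\<close>.
\<close>

lemma semipos_imp_pos_on:
  fixes M :: "'v::finite \<Rightarrow> 'v \<Rightarrow> real"
  assumes M: "\<And>i j. M i j \<ge> 0" and sp: "semipos J (H_mat M \<beta>)"
  shows "pos_on J (H_mat M \<beta>)"
  unfolding pos_on_def eigenvalue_on_def
proof (intro allI impI, elim exE conjE)
  fix z and y :: "'v \<Rightarrow> complex"
  assume nz: "\<exists>i\<in>J. y i \<noteq> 0"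
    and ev: "\<forall>i\<in>J. mult_vec_on J (\<lambda>i j. complex_of_real (H_mat M \<beta> i j)) y i = z * y i"
  obtain x where x: "\<And>i. i \<in> J \<Longrightarrow> x i > 0" and Hx: "\<And>i. i \<in> J \<Longrightarrow> mult_vec_on J (H_mat M \<beta>) x i > 0"
    using sp unfolding semipos_def by blast
  define m where "m = Max ((\<lambda>i. cmod (y i) / x i) ` J)"
  have "m \<in> (\<lambda>i. cmod (y i) / x i) ` J" unfolding m_def using nz by (intro Max_in) auto
  then obtain i where i: "i \<in> J" "m = cmod (y i) / x i" by blast
  have mge: "cmod (y j) \<le> m * x j" if "j \<in> J" for j
  proof -
    have "cmod (y j) / x j \<le> m" unfolding m_def using that by (intro Max_ge) auto
    then show ?thesis using x[OF that] by (simp add: pos_divide_le_eq)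
  qed
  have "m > 0"
  proof -
    obtain j where j: "j \<in> J" "y j \<noteq> 0" using nz by blast
    then have "0 < m * x j" using mge[OF j(1)] by (smt (verit) zero_less_norm_iff)
    then show ?thesis using x[OF j(1)] by (simp add: zero_less_mult_iff)
  qed
  have yi: "cmod (y i) = m * x i" using i x[of i] by simp
  have "(\<Sum>j\<in>J. complex_of_real (H_mat M \<beta> i j) * y j)
      = (\<Sum>j\<in>J. (if i = j then of_real (\<beta> j) * y j else 0) - of_real (M i j) * y j)"
    unfolding H_mat_def by (intro sum.cong) (auto simp: algebra_simps)
  also have "\<dots> = of_real (\<beta> i) * y i - (\<Sum>j\<in>J. of_real (M i j) * y j)"
    using i by (simp add: sum_subtractf)
  finally have "(of_real (\<beta> i) - z) * y i = (\<Sum>j\<in>J. of_real (M i j) * y j)"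
    using ev i unfolding mult_vec_on_def by (simp add: algebra_simps)
  then have "cmod (of_real (\<beta> i) - z) * (m * x i) = cmod (\<Sum>j\<in>J. of_real (M i j) * y j)"
    by (metis norm_mult yi)
  also have "\<dots> \<le> (\<Sum>j\<in>J. M i j * (m * x j))"
    using M mge by (intro sum_norm_le) (auto simp: norm_mult intro!: mult_left_mono)
  also have "\<dots> = m * (\<beta> i * x i - mult_vec_on J (H_mat M \<beta>) x i)"
    using i by (simp add: H_mat_mult sum_distrib_left mult_ac)
  also have "\<dots> < m * (\<beta> i * x i)"
    using Hx[OF i(1)] \<open>m > 0\<close> by (intro mult_strict_left_mono) auto
  finally have "cmod (of_real (\<beta> i) - z) * (m * x i) < \<beta> i * (m * x i)" by (simp add: mult_ac)
  then have "cmod (of_real (\<beta> i) - z) < \<beta> i"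
    using \<open>m > 0\<close> x[OF i(1)] by (simp add: mult_less_cancel_right)
  then show "Re z > 0"
    using complex_Re_le_cmod[of "of_real (\<beta> i) - z"] by simp
qed

lemma small_perturbation:
  fixes h g :: "'a \<Rightarrow> real"
  assumes "finite J" "t > 0" and h: "\<And>i. i \<in> J \<Longrightarrow> h i > 0"
  shows "\<exists>e>0. e < t \<and> (\<forall>i\<in>J. h i - e * g i > 0)"
proof -
  have "\<forall>\<^sub>F e in at_right 0. \<forall>i\<in>J. h i - e * g i > 0"
  proof (rule eventually_ball_finite[OF \<open>finite J\<close>], rule ballI)
    fix i assume "i \<in> J"
    have "((\<lambda>e. h i - e * g i) \<longlongrightarrow> h i - 0 * g i) (at_right 0)" by (intro tendsto_intros)
    then show "\<forall>\<^sub>F e in at_right 0. h i - e * g i > 0"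
      using h[OF \<open>i \<in> J\<close>] by (intro order_tendstoD(1)) auto
  qed
  moreover have "\<forall>\<^sub>F e in at_right 0. e < t \<and> (0::real) < e"
    using \<open>t > 0\<close> by (auto simp: eventually_at_right intro!: exI[of _ t])
  ultimately have "\<forall>\<^sub>F e in at_right 0. (\<forall>i\<in>J. h i - e * g i > 0) \<and> e < t \<and> 0 < e"
    by eventually_elim auto
  then show ?thesis using eventually_happens'[OF trivial_limit_at_right_real] by blast
qed

lemma continuous_det:
  fixes F :: "real \<Rightarrow> real^'v^'v"
  assumes "\<And>i j. isCont (\<lambda>t. F t $ i $ j) t"
  shows "isCont (\<lambda>t. det (F t)) t"
  unfolding det_def isCont_def
  by (intro tendsto_sum tendsto_mult tendsto_const tendsto_prod) (use assms in \<open>simp add: isCont_def\<close>)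

text \<open>
  Follow the path \<open>H + t\<close> down from a large \<open>t\<close>, where it is diagonally dominant, and let \<open>t0\<close> be the
  infimum of the \<open>t \<ge> 0\<close> for which \<open>H + t\<close> is semipositive. As \<open>- t0\<close> is not an eigenvalue of \<open>H\<close>, the
  matrix \<open>H + t0\<close> is invertible, and its inverse is a limit of nonnegative inverses. So \<open>H + t0\<close> is
  semipositive. The witness also works for slightly smaller parameters, whence \<open>t0 = 0\<close>.
\<close>

lemma pos_on_imp_semipos:
  fixes M :: "'v::finite \<Rightarrow> 'v \<Rightarrow> real"
  assumes M: "\<And>i j. M i j \<ge> 0" and pos: "pos_on J (H_mat M \<beta>)"
  shows "semipos J (H_mat M \<beta>)"
proof -
  define f where "f t = H_mat M (\<lambda>i. \<beta> i + t)" for t :: real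
  have fmult: "mult_vec_on J (f t) x i = mult_vec_on J (H_mat M \<beta>) x i + t * x i" if "i \<in> J" for t x i
    using that by (simp add: f_def H_mat_mult algebra_simps)
  define T where "T = {t. t \<ge> 0 \<and> semipos J (f t)}"
  define t0 where "t0 = Inf T"
  have ne: "T \<noteq> {}"
  proof -
    define c where "c = 1 + (\<Sum>i\<in>J. \<bar>\<beta> i\<bar> + (\<Sum>j\<in>J. M i j))"
    have "mult_vec_on J (f c) (\<lambda>_. 1) i > 0" if "i \<in> J" for i
    proof -
      have "\<bar>\<beta> i\<bar> + (\<Sum>j\<in>J. M i j) \<le> (\<Sum>i\<in>J. \<bar>\<beta> i\<bar> + (\<Sum>j\<in>J. M i j))"
        using M that by (intro member_le_sum[where f = "\<lambda>i. \<bar>\<beta> i\<bar> + (\<Sum>j\<in>J. M i j)"]) (auto intro!: sum_nonneg add_nonneg_nonneg)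
      then show ?thesis using that by (simp add: fmult H_mat_mult c_def)
    qed
    moreover have "c \<ge> 0" unfolding c_def using M by (intro add_nonneg_nonneg sum_nonneg) auto
    ultimately have "c \<in> T" by (auto simp: T_def semipos_def intro!: exI[of _ "\<lambda>_. 1"])
    then show ?thesis by blast
  qed
  have bdd: "bdd_below T" by (auto simp: T_def bdd_below_def)
  have t0: "t0 \<ge> 0" unfolding t0_def using ne by (intro cInf_greatest) (auto simp: T_def)
  have det0: "det_on J (f t0) \<noteq> 0"
  proof (rule det_on_nonzeroI)
    fix y assume y: "\<forall>i\<in>J. mult_vec_on J (f t0) y i = 0"
    show "\<forall>i\<in>J. y i = 0"
    proof (rule ccontr)
      assume "\<not> (\<forall>i\<in>J. y i = 0)"
      then have "\<exists>i\<in>J. complex_of_real (y i) \<noteq> 0" by auto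
      moreover have "mult_vec_on J (\<lambda>i j. complex_of_real (H_mat M \<beta> i j)) (\<lambda>i. of_real (y i)) i
          = of_real (- t0) * of_real (y i)" if "i \<in> J" for i
      proof -
        have "mult_vec_on J (H_mat M \<beta>) y i = - t0 * y i"
          using y that by (simp add: fmult eq_neg_iff_add_eq_0)
        then have "complex_of_real (mult_vec_on J (H_mat M \<beta>) y i) = of_real (- t0 * y i)" by simp
        then show ?thesis unfolding mult_vec_on_def by simp
      qed
      ultimately have "eigenvalue_on J (H_mat M \<beta>) (of_real (- t0))"
        unfolding eigenvalue_on_def by (intro exI[of _ "\<lambda>i. of_real (y i)"]) auto
      then have "Re (of_real (- t0)) > 0" using pos unfolding pos_on_def by blast
      then show False using t0 by simp
    qed
  qed
  have contf: "isCont (\<lambda>t. id_extension J (f t) $ i $ j) t" for i j t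
    by (cases "i \<in> J \<and> j \<in> J"; cases "i = j") (auto simp: id_extension_def f_def H_mat_def)
  have cont: "isCont (\<lambda>t. cramer_inv J (f t) k l) t0" for k l
    unfolding cramer_inv_def using det0 unfolding det_on_id_extension
  proof (intro continuous_divide continuous_det)
    show "isCont (\<lambda>t. (\<chi> i j. if j = k then if i = l then 1 else 0 else id_extension J (f t) $ i $ j) $ i $ j) t0" for i j
      using contf[where i = i and j = j] by (cases "j = k"; cases "i = l") auto
  qed (auto intro: contf)
  have spiff: "semipos J (f t) \<longleftrightarrow> det_on J (f t) \<noteq> 0 \<and> (\<forall>k\<in>J. \<forall>l\<in>J. cramer_inv J (f t) k l \<ge> 0)" for t
    unfolding f_def by (rule semipos_iff_cramer[OF M])
  have "cramer_inv J (f t0) k l \<ge> 0" if kl: "k \<in> J" "l \<in> J" for k l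
  proof (rule ccontr)
    assume neg: "\<not> cramer_inv J (f t0) k l \<ge> 0"
    then have "\<forall>\<^sub>F t in at t0. cramer_inv J (f t) k l < 0"
      using cont[of k l] by (intro order_tendstoD(2)[where y = "cramer_inv J (f t0) k l"]) (auto simp: isCont_def)
    then obtain d where d: "d > 0" "\<And>t. t \<noteq> t0 \<Longrightarrow> dist t t0 < d \<Longrightarrow> cramer_inv J (f t) k l < 0"
      unfolding eventually_at by auto
    (* points of T lie arbitrarily close to t0 from above, and there the inverse is nonnegative *)
    obtain t where t: "t \<in> T" "t < t0 + d"
      using cInf_lessD[OF ne, of "t0 + d"] d(1) unfolding t0_def by auto
    have "t \<ge> t0" unfolding t0_def using t(1) bdd by (rule cInf_lower)
    then have "cramer_inv J (f t) k l < 0"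
      using d(2)[of t] t(2) neg by (cases "t = t0") (auto simp: dist_real_def)
    then show False using t(1) kl spiff[of t] by (force simp: T_def)
  qed
  then have sp0: "semipos J (f t0)" using spiff det0 by blast
  have "t0 = 0"
  proof (rule ccontr)
    assume "t0 \<noteq> 0"
    then have "t0 > 0" using t0 by simp
    obtain x where x: "\<And>i. i \<in> J \<Longrightarrow> x i > 0" and Hx: "\<And>i. i \<in> J \<Longrightarrow> mult_vec_on J (f t0) x i > 0"
      using sp0 unfolding semipos_def by blast
    obtain e where e: "0 < e" "e < t0" "\<And>i. i \<in> J \<Longrightarrow> mult_vec_on J (f t0) x i - e * x i > 0"
      using small_perturbation[OF _ \<open>t0 > 0\<close>, of J "mult_vec_on J (f t0) x" x] Hx by auto
    (* the witness x for t0 still works at t0 - e, contradicting the choice of t0 *)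
    have "semipos J (f (t0 - e))"
      unfolding semipos_def using e(3) x
      by (intro exI[of _ x]) (auto simp: fmult algebra_simps)
    then have "t0 - e \<in> T" using e by (simp add: T_def)
    then have "t0 \<le> t0 - e" unfolding t0_def using bdd by (rule cInf_lower)
    then show False using e by simp
  qed
  then show ?thesis using sp0 by (simp add: f_def)
qed

lemma pos_on_iff_semipos:
  fixes M :: "'v::finite \<Rightarrow> 'v \<Rightarrow> real"
  assumes M: "\<And>i j. M i j \<ge> 0"
  shows "pos_on J (H_mat M \<beta>) \<longleftrightarrow> semipos J (H_mat M \<beta>)"
  using semipos_imp_pos_on[of M, OF M] pos_on_imp_semipos[of M, OF M] by blast


section \<open>Schur complements\<close>

lemma mult_vec_on_Un:
  fixes A :: "'v::finite \<Rightarrow> 'v \<Rightarrow> real"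
  assumes "I \<inter> K = {}"
  shows "mult_vec_on (I \<union> K) A x i = mult_vec_on I A x i + mult_vec_on K A x i"
  unfolding mult_vec_on_def using assms by (intro sum.union_disjoint) auto

lemma mult_vec_on_add: "mult_vec_on J A (\<lambda>i. x i + y i) i = mult_vec_on J A x i + mult_vec_on J A y i"
  for A :: "'v \<Rightarrow> 'v \<Rightarrow> real"
  by (simp add: mult_vec_on_def algebra_simps sum.distrib)

lemma mult_vec_on_diff: "mult_vec_on J A (\<lambda>i. x i - y i) i = mult_vec_on J A x i - mult_vec_on J A y i"
  for A :: "'v \<Rightarrow> 'v \<Rightarrow> real"
  by (simp add: mult_vec_on_def algebra_simps sum_subtractf)

lemma mult_vec_on_scale: "mult_vec_on J A (\<lambda>i. c * x i) i = c * mult_vec_on J A x i"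
  for A :: "'v \<Rightarrow> 'v \<Rightarrow> real"
  by (simp add: mult_vec_on_def sum_distrib_left mult_ac)

lemma mult_vec_on_nonneg:
  fixes A :: "'v::finite \<Rightarrow> 'v \<Rightarrow> real"
  assumes "\<And>j. j \<in> J \<Longrightarrow> A i j \<ge> 0" "\<And>j. j \<in> J \<Longrightarrow> x j \<ge> 0"
  shows "mult_vec_on J A x i \<ge> 0"
  unfolding mult_vec_on_def using assms by (intro sum_nonneg) auto

lemma mult_vec_on_H_mat_off:
  assumes "i \<notin> J"
  shows "mult_vec_on J (H_mat M \<beta>) x i = - mult_vec_on J M x i"
  unfolding mult_vec_on_def using assms by (auto simp: H_mat_def simp flip: sum_negf intro!: sum.cong)

lemma check_W_mult:
  fixes W :: "'v::finite \<Rightarrow> 'v \<Rightarrow> real"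
  shows "mult_vec_on K (check_W I W \<beta>) x i =
    mult_vec_on K W x i + mult_vec_on I W (mult_vec_on I (G_mat I W \<beta>) (mult_vec_on K W x)) i"
proof -
  have "(\<Sum>j\<in>K. (\<Sum>k\<in>I. \<Sum>l\<in>I. W i k * G_mat I W \<beta> k l * W l j) * x j)
      = (\<Sum>k\<in>I. W i k * (\<Sum>l\<in>I. G_mat I W \<beta> k l * (\<Sum>j\<in>K. W l j * x j)))"
    unfolding sum_distrib_left sum_distrib_right
    by (subst sum.swap, rule sum.cong[OF refl], subst sum.swap) (simp add: mult_ac)
  then show ?thesis
    by (simp add: mult_vec_on_def check_W_def algebra_simps sum.distrib)
qed

lemma schur_mult:
  fixes W :: "'v::finite \<Rightarrow> 'v \<Rightarrow> real"
  assumes "i \<in> K"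
  shows "mult_vec_on K (H_mat (check_W I W \<beta>) \<beta>) x i = mult_vec_on K (H_mat W \<beta>) x i
    - mult_vec_on I W (mult_vec_on I (G_mat I W \<beta>) (mult_vec_on K W x)) i"
  using assms check_W_mult[of K I W \<beta> x i] by (simp add: H_mat_mult mult_vec_on_def[of K W] mult_vec_on_def[of K "check_W I W \<beta>"])

lemma check_W_nonneg:
  fixes W :: "'v::finite \<Rightarrow> 'v \<Rightarrow> real"
  assumes W: "\<And>i j. W i j \<ge> 0" and sp: "semipos I (H_mat W \<beta>)"
  shows "check_W I W \<beta> i j \<ge> 0"
  unfolding check_W_def
  using W semipos_inv_nonneg[OF W sp is_inv_on_G_mat[OF W sp]]
  by (intro add_nonneg_nonneg sum_nonneg mult_nonneg_nonneg) auto

text \<open>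
  From left to right, a witness on \<open>I \<union> K\<close> restricts to witnesses for the block and for the Schur
  complement. Conversely, a witness \<open>x\<close> for the Schur complement is continued to \<open>I\<close> by
  \<open>H\<^sub>I\<^sup>-\<^sup>1 W x \<ge> 0\<close>, which makes \<open>Hx\<close> vanish on \<open>I\<close>; adding a small multiple of a witness \<open>u\<close> for the
  block \<open>I\<close> makes it positive there without spoiling positivity on \<open>K\<close>.
\<close>

lemma semipos_union_iff:
  fixes W :: "'v::finite \<Rightarrow> 'v \<Rightarrow> real"
  assumes W: "\<And>i j. W i j \<ge> 0" and dis: "I \<inter> K = {}"
  shows "semipos (I \<union> K) (H_mat W \<beta>) \<longleftrightarrow>
    semipos I (H_mat W \<beta>) \<and> semipos K (H_mat (check_W I W \<beta>) \<beta>)"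
proof
  assume "semipos (I \<union> K) (H_mat W \<beta>)"
  then obtain x where x: "\<And>i. i \<in> I \<union> K \<Longrightarrow> x i > 0" 
    and Hx: "\<And>i. i \<in> I \<union> K \<Longrightarrow> mult_vec_on (I \<union> K) (H_mat W \<beta>) x i > 0"
    unfolding semipos_def by blast
  have xK: "mult_vec_on K W x i \<ge> 0" for i using W x by (intro mult_vec_on_nonneg) (auto simp: less_imp_le)
  have I: "mult_vec_on I (H_mat W \<beta>) x i - mult_vec_on K W x i > 0" if "i \<in> I" for i
  proof -
    have "i \<notin> K" using that dis by auto
    then show ?thesis using Hx[of i] that dis by (simp add: mult_vec_on_Un mult_vec_on_H_mat_off)
  qed
  have "mult_vec_on I (H_mat W \<beta>) x i > 0" if "i \<in> I" for i
    using I[OF that] xK[of i] by linarith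
  then have spI: "semipos I (H_mat W \<beta>)" using x unfolding semipos_def by (intro exI[of _ x]) auto
  note inv = is_inv_on_G_mat[OF W spI]
  define G where "G = G_mat I W \<beta>"
  have G: "G k l \<ge> 0" if "k \<in> I" "l \<in> I" for k l
    unfolding G_def using semipos_inv_nonneg[OF W spI inv] that .
  have r: "mult_vec_on I G (\<lambda>i. mult_vec_on I (H_mat W \<beta>) x i - mult_vec_on K W x i) k \<ge> 0" if "k \<in> I" for k
    using G that I by (intro mult_vec_on_nonneg) (auto simp: less_imp_le)
  have le: "mult_vec_on I G (mult_vec_on K W x) k \<le> x k" if "k \<in> I" for k
    using r[OF that] is_inv_on_left[OF _ inv that, of x] by (simp add: mult_vec_on_diff G_def)
  have "mult_vec_on K (H_mat (check_W I W \<beta>) \<beta>) x i > 0" if i: "i \<in> K" for i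
  proof -
    have "mult_vec_on I W (mult_vec_on I G (mult_vec_on K W x)) i \<le> mult_vec_on I W x i"
      unfolding mult_vec_on_def[of I W] using W le by (intro sum_mono mult_left_mono) auto
    moreover have "i \<notin> I" using i dis by auto
    ultimately show ?thesis
      using Hx[of i] i dis by (auto simp: schur_mult mult_vec_on_Un mult_vec_on_H_mat_off G_def)
  qed
  then show "semipos I (H_mat W \<beta>) \<and> semipos K (H_mat (check_W I W \<beta>) \<beta>)"
    using spI x unfolding semipos_def[of K] by blast
next
  assume "semipos I (H_mat W \<beta>) \<and> semipos K (H_mat (check_W I W \<beta>) \<beta>)"
  then have spI: "semipos I (H_mat W \<beta>)" and spK: "semipos K (H_mat (check_W I W \<beta>) \<beta>)" by auto
  note inv = is_inv_on_G_mat[OF W spI]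
  define G where "G = G_mat I W \<beta>"
  have G: "G k l \<ge> 0" if "k \<in> I" "l \<in> I" for k l
    unfolding G_def using semipos_inv_nonneg[OF W spI inv] that .
  obtain u where u: "\<And>i. i \<in> I \<Longrightarrow> u i > 0" and Hu: "\<And>i. i \<in> I \<Longrightarrow> mult_vec_on I (H_mat W \<beta>) u i > 0"
    using spI unfolding semipos_def by blast
  obtain x where x: "\<And>i. i \<in> K \<Longrightarrow> x i > 0"
    and Sx: "\<And>i. i \<in> K \<Longrightarrow> mult_vec_on K (H_mat (check_W I W \<beta>) \<beta>) x i > 0"
    using spK unfolding semipos_def by blast
  (* the solution on I of (Hw)_I = 0 with w = x on K *)
  define v where "v = mult_vec_on I G (mult_vec_on K W x)"
  have v: "v i \<ge> 0" if "i \<in> I" for i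
    unfolding v_def using G W x that by (intro mult_vec_on_nonneg) (auto simp: less_imp_le)
  have Hv: "mult_vec_on I (H_mat W \<beta>) v i = mult_vec_on K W x i" if "i \<in> I" for i
    unfolding v_def G_def using is_inv_on_right[OF _ inv that] by simp
  obtain e where e: "\<And>i. i \<in> K \<Longrightarrow> mult_vec_on K (H_mat (check_W I W \<beta>) \<beta>) x i - e * mult_vec_on I W u i > 0" "0 < e"
    using small_perturbation[of K 1 "mult_vec_on K (H_mat (check_W I W \<beta>) \<beta>) x" "mult_vec_on I W u"] Sx by auto
  define w where "w i = (if i \<in> I then v i + e * u i else x i)" for i
  have wI: "mult_vec_on I A w i = mult_vec_on I A v i + e * mult_vec_on I A u i" for A i
    by (subst mult_vec_on_scale[symmetric], subst mult_vec_on_add[symmetric])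
      (auto simp: w_def intro!: mult_vec_on_cong)
  have wK: "mult_vec_on K A w i = mult_vec_on K A x i" for A :: "'v \<Rightarrow> 'v \<Rightarrow> real" and i
    using dis by (auto simp: w_def intro!: mult_vec_on_cong)
  have "w i > 0" if "i \<in> I \<union> K" for i
    using that e(2) u[of i] v[of i] x[of i] by (auto simp: w_def intro: add_nonneg_pos)
  moreover have "mult_vec_on (I \<union> K) (H_mat W \<beta>) w i > 0" if i: "i \<in> I \<union> K" for i
  proof (cases "i \<in> I")
    case True
    then have "i \<notin> K" using dis by auto
    then have "mult_vec_on (I \<union> K) (H_mat W \<beta>) w i = e * mult_vec_on I (H_mat W \<beta>) u i"
      using True dis by (simp add: mult_vec_on_Un wI wK Hv mult_vec_on_H_mat_off)
    then show ?thesis using e(2) Hu[OF True] by simp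
  next
    case False
    then have "i \<in> K" using i by auto
    then have "mult_vec_on (I \<union> K) (H_mat W \<beta>) w i
        = mult_vec_on K (H_mat (check_W I W \<beta>) \<beta>) x i - e * mult_vec_on I W u i"
      using False dis by (simp add: mult_vec_on_Un wI wK mult_vec_on_H_mat_off schur_mult v_def G_def)
    then show ?thesis using e(1)[OF \<open>i \<in> K\<close>] by simp
  qed
  ultimately show "semipos (I \<union> K) (H_mat W \<beta>)" unfolding semipos_def by blast
qed

lemma matrix_add_rdistrib: "(A + B) ** C = A ** C + B ** C" for A B C :: "real^'v^'v"
  by (simp add: vec_eq_iff matrix_matrix_mult_def algebra_simps sum.distrib)


text \<open>
  Here \<open>N\<close> is a single off-diagonal block, so \<open>N\<^sup>2 = 0\<close>. Doubling the rows in \<open>K\<close> and halving the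
  columns in \<open>K\<close> conjugates \<open>1 + N\<close> into \<open>1 + 2N = (1 + N)\<^sup>2\<close>. Hence the determinant equals its own
  square, and it is nonzero because \<open>1 - N\<close> is an inverse.
\<close>

lemma det_unipotent:
  fixes N :: "real^'v^'v"
  assumes N: "\<And>i j. N $ i $ j \<noteq> 0 \<Longrightarrow> i \<in> K \<and> j \<notin> K"
  shows "det (mat 1 + N) = 1"
proof -
  define D where "D c = ((\<chi> i j. if i = j then (if i \<in> K then c else 1) else 0) :: real^'v^'v)" for c :: real
  have DX: "(D c ** X) $ i $ j = (if i \<in> K then c else 1) * X $ i $ j" for c i j and X :: "real^'v^'v"
  proof -
    have "(D c ** X) $ i $ j = (\<Sum>k\<in>UNIV. if i = k then (if i \<in> K then c else 1) * X $ i $ j else 0)"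
      unfolding matrix_matrix_mult_def D_def vec_lambda_beta by (rule sum.cong) (simp_all cong: if_cong)
    then show ?thesis by simp
  qed
  have XD: "(X ** D c) $ i $ j = X $ i $ j * (if j \<in> K then c else 1)" for c i j and X :: "real^'v^'v"
  proof -
    have "(X ** D c) $ i $ j = (\<Sum>k\<in>UNIV. if j = k then X $ i $ j * (if j \<in> K then c else 1) else 0)"
      unfolding matrix_matrix_mult_def D_def vec_lambda_beta by (rule sum.cong) (auto cong: if_cong)
    then show ?thesis by simp
  qed
  have NN: "N ** N = 0"
  proof -
    have "N $ i $ k * N $ k $ j = 0" for i k j using N[of i k] N[of k j] by auto
    then have "(\<Sum>k\<in>UNIV. N $ i $ k * N $ k $ j) = 0" for i j by (intro sum.neutral ballI)
    then show ?thesis by (simp add: vec_eq_iff matrix_matrix_mult_def)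
  qed
  have sq: "(mat 1 + N) ** (mat 1 + N) = mat 1 + (N + N)"
    by (simp add: matrix_add_ldistrib matrix_add_rdistrib NN)
  (* conjugation by the diagonal matrix D 2 doubles N *)
  have "D 2 ** (mat 1 + N) = (mat 1 + (N + N)) ** D 2"
  proof -
    have "(D 2 ** (mat 1 + N)) $ i $ j = ((mat 1 + (N + N)) ** D 2) $ i $ j" for i j
      using N[of i j] by (cases "N $ i $ j = 0") (auto simp: DX XD mat_def)
    then show ?thesis by (simp add: vec_eq_iff)
  qed
  then have "det (D 2) * det (mat 1 + N) = det (mat 1 + N) * det (mat 1 + N) * det (D 2)"
    by (metis det_mul sq)
  moreover have "det (D 2) \<noteq> 0"
    unfolding D_def by (subst det_diagonal) auto
  moreover have "det (mat 1 + N) \<noteq> 0"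
  proof -
    have "N ** (- N) = 0"
      using NN by (simp add: vec_eq_iff matrix_matrix_mult_def sum_negf)
    then have "(mat 1 + N) ** (mat 1 + - N) = mat 1"
      by (simp add: matrix_add_rdistrib matrix_add_ldistrib del: add_uminus_conv_diff)
    then have "det (mat 1 + N) * det (mat 1 + - N) = 1" by (metis det_I det_mul)
    then show ?thesis by auto
  qed
  ultimately show ?thesis by simp
qed


text \<open>
  The block factorization \<open>H U = L (H\<^sub>I \<oplus> 1) (1 \<oplus> S)\<close> with unipotent block triangular \<open>U\<close> and \<open>L\<close>,
  where \<open>S\<close> is the Schur complement.
\<close>

lemma det_on_union:
  fixes W :: "'v::finite \<Rightarrow> 'v \<Rightarrow> real"
  assumes W: "\<And>i j. W i j \<ge> 0" and dis: "I \<inter> K = {}" and sp: "semipos I (H_mat W \<beta>)"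
  shows "det_on (I \<union> K) (H_mat W \<beta>) = det_on I (H_mat W \<beta>) * det_on K (H_mat (check_W I W \<beta>) \<beta>)"
proof -
  define H S G where "H = H_mat W \<beta>" and "S = H_mat (check_W I W \<beta>) \<beta>" and "G = G_mat I W \<beta>"
  have inv: "is_inv_on I H G" unfolding H_def G_def by (rule is_inv_on_G_mat[OF W sp])
  (* N1 = G W_IK and N2 = - W_KI G are the blocks of U and L *)
  define N1 where "N1 = ((\<chi> i j. if i \<in> I \<and> j \<in> K then \<Sum>l\<in>I. G i l * W l j else 0) :: real^'v^'v)"
  define N2 where "N2 = ((\<chi> i j. if i \<in> K \<and> j \<in> I then - (\<Sum>l\<in>I. W i l * G l j) else 0) :: real^'v^'v)"
  have d1: "det (mat 1 + N1) = 1"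
    using dis by (intro det_unipotent[of _ I]) (auto simp: N1_def split: if_splits)
  have d2: "det (mat 1 + N2) = 1"
    using dis by (intro det_unipotent[of _ K]) (auto simp: N2_def split: if_splits)
  have P: "(id_extension I H ** id_extension K S) $ i $ j = (if i \<in> I then id_extension I H $ i $ j else id_extension K S $ i $ j)" for i j
  proof (cases "i \<in> I")
    case True
    have "id_extension I H $ i $ k * id_extension K S $ k $ j = (if k = j then id_extension I H $ i $ k else 0)" for k
      using True dis by (auto simp: id_extension_def)
    then show ?thesis using True by (simp add: matrix_matrix_mult_def)
  next
    case False
    have "id_extension I H $ i $ k * id_extension K S $ k $ j = (if i = k then id_extension K S $ k $ j else 0)" for k
      using False by (auto simp: id_extension_def)
    then show ?thesis using False by (simp add: matrix_matrix_mult_def)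
  qed
  have Hoff: "H i j = - W i j" if "i \<noteq> j" for i j using that by (simp add: H_def H_mat_def)
  have NP: "(N2 ** (id_extension I H ** id_extension K S)) $ i $ j = (if i \<in> K \<and> j \<in> I then - W i j else 0)" for i j
  proof (cases "i \<in> K \<and> j \<in> I")
    case True
    have "(N2 ** (id_extension I H ** id_extension K S)) $ i $ j = (\<Sum>k\<in>UNIV. N2 $ i $ k * (id_extension I H ** id_extension K S) $ k $ j)"
      by (simp add: matrix_matrix_mult_def)
    also have "\<dots> = (\<Sum>k\<in>I. - (\<Sum>l\<in>I. W i l * G l k) * id_extension I H $ k $ j)"
      unfolding P by (rule sum.mono_neutral_cong_right) (use True in \<open>auto simp: N2_def\<close>)
    also have "\<dots> = (\<Sum>k\<in>I. - (\<Sum>l\<in>I. W i l * G l k) * H k j)"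
      using True by (intro sum.cong refl) (simp add: id_extension_def)
    also have "\<dots> = - (\<Sum>l\<in>I. W i l * (\<Sum>k\<in>I. G l k * H k j))"
      unfolding sum_distrib_left sum_negf[symmetric] mult_minus_left sum_distrib_right
      by (subst sum.swap) (simp add: mult_ac)
    also have "\<dots> = - (\<Sum>l\<in>I. if l = j then W i l else 0)"
    proof -
      have "W i l * (\<Sum>k\<in>I. G l k * H k j) = (if l = j then W i l else 0)" if "l \<in> I" for l
        using inv True that by (auto simp: is_inv_on_def)
      then show ?thesis by simp
    qed
    finally show ?thesis using True by simp
  next
    case False
    have "N2 $ i $ k * (id_extension I H ** id_extension K S) $ k $ j = 0" for k
      using False dis unfolding P by (auto simp: N2_def id_extension_def)
    then have "(\<Sum>k\<in>UNIV. N2 $ i $ k * (id_extension I H ** id_extension K S) $ k $ j) = 0"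
      by (intro sum.neutral ballI)
    then show ?thesis using False by (auto simp: matrix_matrix_mult_def[of N2])
  qed
  have FN: "(id_extension (I \<union> K) H ** N1) $ i $ j = (if j \<in> K then if i \<in> I then W i j
      else if i \<in> K then - (\<Sum>k\<in>I. \<Sum>l\<in>I. W i k * G k l * W l j) else 0 else 0)" for i j
  proof -
    consider "j \<notin> K \<or> i \<notin> I \<union> K" | "j \<in> K" "i \<in> I" | "j \<in> K" "i \<in> K" "i \<notin> I" by blast
    then show ?thesis
    proof cases
      case 1
      then have "id_extension (I \<union> K) H $ i $ k * N1 $ k $ j = 0" for k
        by (auto simp: N1_def id_extension_def)
      then have "(\<Sum>k\<in>UNIV. id_extension (I \<union> K) H $ i $ k * N1 $ k $ j) = 0"
        by (intro sum.neutral ballI)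
      then show ?thesis using 1 by (auto simp: matrix_matrix_mult_def)
    next
      case 2
      have "(id_extension (I \<union> K) H ** N1) $ i $ j = (\<Sum>k\<in>I. H i k * (\<Sum>l\<in>I. G k l * W l j))"
        unfolding matrix_matrix_mult_def vec_lambda_beta
        by (rule sum.mono_neutral_cong_right) (use 2 in \<open>auto simp: N1_def id_extension_def\<close>)
      also have "\<dots> = (\<Sum>l\<in>I. (\<Sum>k\<in>I. H i k * G k l) * W l j)"
        unfolding sum_distrib_left sum_distrib_right by (subst sum.swap) (simp add: mult_ac)
      also have "\<dots> = (\<Sum>l\<in>I. if i = l then W l j else 0)"
        using inv 2 by (intro sum.cong refl) (auto simp: is_inv_on_def)
      finally show ?thesis using 2 by simp
    next
      case 3
      have "(id_extension (I \<union> K) H ** N1) $ i $ j = (\<Sum>k\<in>I. H i k * (\<Sum>l\<in>I. G k l * W l j))"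
        unfolding matrix_matrix_mult_def vec_lambda_beta
        by (rule sum.mono_neutral_cong_right) (use 3 in \<open>auto simp: N1_def id_extension_def\<close>)
      also have "\<dots> = (\<Sum>k\<in>I. - (\<Sum>l\<in>I. W i k * G k l * W l j))"
      proof (rule sum.cong[OF refl])
        fix k assume "k \<in> I"
        then have "i \<noteq> k" using 3 by auto
        then show "H i k * (\<Sum>l\<in>I. G k l * W l j) = - (\<Sum>l\<in>I. W i k * G k l * W l j)"
          by (simp add: Hoff sum_distrib_left sum_negf mult_ac)
      qed
      finally show ?thesis using 3 by (simp add: sum_negf)
    qed
  qed
  have "id_extension (I \<union> K) H ** (mat 1 + N1) = (mat 1 + N2) ** (id_extension I H ** id_extension K S)"
  proof -
    have "id_extension (I \<union> K) H $ i $ j + (id_extension (I \<union> K) H ** N1) $ i $ j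
        = (id_extension I H ** id_extension K S) $ i $ j + (N2 ** (id_extension I H ** id_extension K S)) $ i $ j" for i j
    proof -
      have ne: "i \<noteq> j" if "i \<in> I" "j \<in> K \<or> i \<in> K" for i j using dis that by auto
      consider "i \<in> I" "j \<in> K" | "i \<in> K" "j \<in> I" | "i \<in> K" "j \<in> K" | "i \<in> I" "j \<in> I" 
        | "i \<notin> I \<union> K \<or> j \<notin> I \<union> K" by blast
      then show ?thesis
      proof cases
        case 1 then show ?thesis using dis Hoff[of i j] unfolding FN NP P by (auto simp: id_extension_def)
      next
        case 2 then show ?thesis using dis Hoff[of i j] unfolding FN NP P by (auto simp: id_extension_def)
      next
        case 3 then show ?thesis using dis unfolding FN NP P
          by (auto simp: id_extension_def S_def H_def H_mat_def check_W_def G_def)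
      next
        case 4 then show ?thesis using dis unfolding FN NP P by (auto simp: id_extension_def)
      next
        case 5 then show ?thesis using dis unfolding FN NP P by (auto simp: id_extension_def)
      qed
    qed
    then show ?thesis by (simp add: vec_eq_iff matrix_add_ldistrib matrix_add_rdistrib)
  qed
  then have "det (id_extension (I \<union> K) H) * det (mat 1 + N1) = det (mat 1 + N2) * (det (id_extension I H) * det (id_extension K S))"
    by (metis det_mul)
  then show ?thesis using d1 d2 by (simp add: det_on_id_extension H_def S_def)
qed

lemma det_on_singleton: "det_on {k} A = A k k"
  by (simp add: det_on_def permutes_sing)

lemma semipos_det_pos:
  fixes W :: "'v::finite \<Rightarrow> 'v \<Rightarrow> real"
  assumes "\<And>i j. W i j \<ge> 0" "semipos J (H_mat W \<beta>)"
  shows "det_on J (H_mat W \<beta>) > 0"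
proof -
  have "finite J" by simp
  then show ?thesis using assms
  proof (induction J arbitrary: W rule: finite_induct)
    case empty
    then show ?case by (simp add: det_on_def)
  next
    case (insert k F)
    have dis: "{k} \<inter> F = {}" using insert by simp
    have sp: "semipos {k} (H_mat W \<beta>)" "semipos F (H_mat (check_W {k} W \<beta>) \<beta>)"
      using semipos_union_iff[OF insert.prems(1) dis, where \<beta> = \<beta>] insert.prems(2) by auto
    have "det_on F (H_mat (check_W {k} W \<beta>) \<beta>) > 0"
      using insert.IH[OF check_W_nonneg[OF insert.prems(1) sp(1)] sp(2)] .
    moreover have "det_on {k} (H_mat W \<beta>) > 0"
      using sp(1) by (auto simp: det_on_singleton semipos_def mult_vec_on_def zero_less_mult_iff)
    ultimately show ?case
      using det_on_union[OF insert.prems(1) dis sp(1)] by simp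
  qed
qed

section \<open>The star pairing\<close>

lemma pairing_commute:
  assumes inv: "\<And>i. star (star i) = i" and I: "star ` I = I"
  shows "pairing star I x y = pairing star I y x"
proof -
  have inj: "inj_on star I" by (metis inj_onI inv)
  have "pairing star I x y = (\<Sum>i\<in>star ` I. x (star i) * y i)" by (simp add: pairing_def I)
  also have "\<dots> = pairing star I y x"
    by (subst sum.reindex[OF inj]) (simp add: pairing_def inv mult.commute)
  finally show ?thesis .
qed

lemma pairing_add_right: "pairing star I x (\<lambda>i. y i + z i) = pairing star I x y + pairing star I x z"
  by (simp add: pairing_def algebra_simps sum.distrib)
lemma pairing_diff_right: "pairing star I x (\<lambda>i. y i - z i) = pairing star I x y - pairing star I x z"
  by (simp add: pairing_def algebra_simps sum_subtractf)
lemma pairing_add_left: "pairing star I (\<lambda>i. y i + z i) x = pairing star I y x + pairing star I z x"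
  by (simp add: pairing_def algebra_simps sum.distrib)

lemma pairing_cong:
  assumes "star ` I = I" "\<And>i. i \<in> I \<Longrightarrow> x i = x' i" "\<And>i. i \<in> I \<Longrightarrow> y i = y' i"
  shows "pairing star I x y = pairing star I x' y'"
  unfolding pairing_def using assms by (intro sum.cong) auto

lemma pairing_Un:
  fixes I :: "'v::finite set"
  assumes "I \<inter> K = {}"
  shows "pairing star (I \<union> K) x y = pairing star I x y + pairing star K x y"
  unfolding pairing_def using assms by (intro sum.union_disjoint) auto

text \<open>
  A star-symmetric block \<open>M\<^sub>I\<^sub>K\<close> is the adjoint of \<open>M\<^sub>K\<^sub>I\<close> for the star pairing.
\<close>

lemma pairing_adjoint:
  fixes M :: "'v::finite \<Rightarrow> 'v \<Rightarrow> real"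
  assumes inv: "\<And>i. star (star i) = i" and I: "star ` I = I" and K: "star ` K = K"
    and M: "\<And>i k. i \<in> I \<Longrightarrow> k \<in> K \<Longrightarrow> M i k = M (star k) (star i)"
  shows "pairing star I x (mult_vec_on K M y) = pairing star K (mult_vec_on I M x) y"
proof -
  have inj: "inj_on star I" by (metis inj_onI inv)
  have "pairing star I x (mult_vec_on K M y) = (\<Sum>k\<in>K. (\<Sum>i\<in>I. M (star k) (star i) * x (star i)) * y k)"
    unfolding pairing_def mult_vec_on_def sum_distrib_left sum_distrib_right
    by (subst sum.swap) (auto intro!: sum.cong simp: M)
  moreover have "(\<Sum>i\<in>I. M (star k) (star i) * x (star i)) = (\<Sum>i\<in>I. M (star k) i * x i)" for k
    using sum.reindex[OF inj, of "\<lambda>i. M (star k) i * x i"] by (simp add: I)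
  ultimately show ?thesis by (simp add: pairing_def mult_vec_on_def)
qed

lemma H_mat_star:
  assumes "\<And>i. star (star i) = i" "\<And>i j. M i j = M (star j) (star i)" "\<beta> (star i) = \<beta> i"
  shows "H_mat M \<beta> i j = H_mat M \<beta> (star j) (star i)"
  using assms by (auto simp: H_mat_def) metis+

text \<open>
  The starred transpose of an inverse is again an inverse of the star-symmetric matrix \<open>H\<close>.
\<close>

lemma G_mat_star:
  fixes M :: "'v::finite \<Rightarrow> 'v \<Rightarrow> real"
  assumes inv: "\<And>i. star (star i) = i" and I: "star ` I = I" and M: "\<And>i j. M i j = M (star j) (star i)"
    and \<beta>: "\<And>i. i \<in> I \<Longrightarrow> \<beta> (star i) = \<beta> i" and nn: "\<And>i j. M i j \<ge> 0" and sp: "semipos I (H_mat M \<beta>)"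
    and ij: "i \<in> I" "j \<in> I"
  shows "G_mat I M \<beta> i j = G_mat I M \<beta> (star j) (star i)"
proof -
  have inj: "inj_on star I" by (metis inj_onI inv)
  define H G where "H = H_mat M \<beta>" and "G = G_mat I M \<beta>"
  have G: "is_inv_on I H G" unfolding H_def G_def by (rule is_inv_on_G_mat[OF nn sp])
  have H: "H i j = H (star j) (star i)" if "i \<in> I" for i j
    unfolding H_def using H_mat_star[of star M \<beta>, OF inv M] \<beta>[OF that] by blast
  have eq: "(star i = star j) = (i = j)" for i j by (metis inv)
  have st: "star i \<in> I" if "i \<in> I" for i using I that by blast
  have "is_inv_on I H (\<lambda>i j. G (star j) (star i))"
    unfolding is_inv_on_def
  proof (intro ballI conjI)
    fix i j assume ij: "i \<in> I" "j \<in> I"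
    have "(\<Sum>k\<in>I. H i k * G (star j) (star k)) = (\<Sum>k\<in>I. G (star j) (star k) * H (star k) (star i))"
      using ij by (intro sum.cong refl) (simp add: H[symmetric])
    also have "\<dots> = (\<Sum>k\<in>I. G (star j) k * H k (star i))"
      using sum.reindex[OF inj, of "\<lambda>k. G (star j) k * H k (star i)"] by (simp add: I)
    also have "\<dots> = (if i = j then 1 else 0)" using G ij st by (auto simp: is_inv_on_def eq)
    finally show "(\<Sum>k\<in>I. H i k * G (star j) (star k)) = (if i = j then 1 else 0)" .
    have "(\<Sum>k\<in>I. G (star k) (star i) * H k j) = (\<Sum>k\<in>I. H (star j) (star k) * G (star k) (star i))"
      using ij by (intro sum.cong refl) (simp add: H[symmetric])
    also have "\<dots> = (\<Sum>k\<in>I. H (star j) k * G k (star i))"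
      using sum.reindex[OF inj, of "\<lambda>k. H (star j) k * G k (star i)"] by (simp add: I)
    also have "\<dots> = (if i = j then 1 else 0)" using G ij st by (auto simp: is_inv_on_def eq)
    finally show "(\<Sum>k\<in>I. G (star k) (star i) * H k j) = (if i = j then 1 else 0)" .
  qed
  from is_inv_on_unique[OF _ G this ij] show ?thesis by (simp add: G_def)
qed

lemma check_W_star:
  fixes W :: "'v::finite \<Rightarrow> 'v \<Rightarrow> real"
  assumes inv: "\<And>i. star (star i) = i" and I: "star ` I = I" and W: "\<And>i j. W i j = W (star j) (star i)"
    and \<beta>: "\<And>i. i \<in> I \<Longrightarrow> \<beta> (star i) = \<beta> i" and nn: "\<And>i j. W i j \<ge> 0" and sp: "semipos I (H_mat W \<beta>)"
  shows "check_W I W \<beta> i j = check_W I W \<beta> (star j) (star i)"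
proof -
  have inj: "inj_on star I" by (metis inj_onI inv)
  define G where "G = G_mat I W \<beta>"
  have G: "G i j = G (star j) (star i)" if "i \<in> I" "j \<in> I" for i j
    unfolding G_def using G_mat_star[OF inv I W \<beta> nn sp] that by blast
  have "(\<Sum>k\<in>I. \<Sum>l\<in>I. W i k * G k l * W l j)
      = (\<Sum>k\<in>I. \<Sum>l\<in>I. W (star k) (star i) * G (star l) (star k) * W (star j) (star l))"
    by (intro sum.cong refl) (simp add: W[symmetric] G[symmetric])
  also have "\<dots> = (\<Sum>k\<in>I. \<Sum>l\<in>I. W k (star i) * G l k * W (star j) l)"
    using sum.reindex[OF inj, of "\<lambda>k. \<Sum>l\<in>I. W k (star i) * G (star l) k * W (star j) (star l)"]
      sum.reindex[OF inj, of "\<lambda>l. W k (star i) * G l k * W (star j) l" for k] by (simp add: I)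
  also have "\<dots> = (\<Sum>l\<in>I. \<Sum>k\<in>I. W (star j) l * G l k * W k (star i))"
    by (subst sum.swap) (simp add: mult_ac)
  finally show ?thesis using W[of i j] by (simp add: check_W_def G_def)
qed

lemma check_eta_nonneg:
  fixes W :: "'v::finite \<Rightarrow> 'v \<Rightarrow> real"
  assumes W: "\<And>i j. W i j \<ge> 0" and sp: "semipos I (H_mat W \<beta>)" and \<eta>: "\<And>i. \<eta> i \<ge> 0"
  shows "check_eta I W \<eta> \<beta> i \<ge> 0"
  unfolding check_eta_def
  using W \<eta> semipos_inv_nonneg[OF W sp is_inv_on_G_mat[OF W sp]]
  by (intro add_nonneg_nonneg mult_vec_on_nonneg) auto


section \<open>Factorization of the densities\<close>

lemma half_of_inter:
  assumes inv: "\<And>i. star (star i) = i" and half: "half_of star (I \<union> K) J1" and I: "star ` I = I"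
  shows "half_of star I (J1 \<inter> I)"
proof -
  have st: "star i \<in> I \<longleftrightarrow> i \<in> I" for i using I inv by (metis imageI)
  have h: "i \<in> fixed_pts star (I \<union> K) \<or> i \<in> J1 \<or> i \<in> star ` J1" if "i \<in> I" for i
    using half that unfolding half_of_def by blast
  have d: "fixed_pts star (I \<union> K) \<inter> J1 = {}" "fixed_pts star (I \<union> K) \<inter> star ` J1 = {}" "J1 \<inter> star ` J1 = {}"
    using half unfolding half_of_def by blast+
  have im: "star ` (J1 \<inter> I) = star ` J1 \<inter> I"
    using st by auto
  have f: "fixed_pts star I = fixed_pts star (I \<union> K) \<inter> I" by (auto simp: fixed_pts_def)
  show ?thesis unfolding half_of_def im f using h d by blast
qed

lemma half_card:
  fixes I :: "'v::finite set"
  assumes dis: "I \<inter> K = {}" and half: "half_of star (I \<union> K) J1"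
  shows "card J1 = card (J1 \<inter> I) + card (J1 \<inter> K)"
    "card (fixed_pts star (I \<union> K) \<union> J1) = card (fixed_pts star I \<union> (J1 \<inter> I)) + card (fixed_pts star K \<union> (J1 \<inter> K))"
proof -
  have sub: "J1 \<subseteq> I \<union> K" using half unfolding half_of_def by blast
  have "J1 = (J1 \<inter> I) \<union> (J1 \<inter> K)" using sub by blast
  then show "card J1 = card (J1 \<inter> I) + card (J1 \<inter> K)"
    using dis by (metis (no_types, lifting) card_Un_disjoint finite inf_assoc inf_bot_right inf_left_commute)
  have "fixed_pts star (I \<union> K) \<union> J1 = (fixed_pts star I \<union> (J1 \<inter> I)) \<union> (fixed_pts star K \<union> (J1 \<inter> K))"
    using sub by (auto simp: fixed_pts_def)
  moreover have "(fixed_pts star I \<union> (J1 \<inter> I)) \<inter> (fixed_pts star K \<union> (J1 \<inter> K)) = {}"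
    using dis by (auto simp: fixed_pts_def)
  ultimately show "card (fixed_pts star (I \<union> K) \<union> J1) = card (fixed_pts star I \<union> (J1 \<inter> I)) + card (fixed_pts star K \<union> (J1 \<inter> K))"
    by (simp add: card_Un_disjoint)
qed

locale star_matrix =
  fixes star :: "'v::finite \<Rightarrow> 'v" and W :: "'v \<Rightarrow> 'v \<Rightarrow> real"
  assumes inv: "\<And>i. star (star i) = i" and W_nonneg: "\<And>i j. W i j \<ge> 0"
    and W_star: "\<And>i j. W i j = W (star j) (star i)"
begin

abbreviation shift_eta where
  "shift_eta K x \<eta> \<equiv> \<lambda>i. \<eta> i + mult_vec_on K W x i"

lemma pairing_W:
  assumes "star ` I = I" "star ` K = K"
  shows "pairing star I x (mult_vec_on K W z) = pairing star K (mult_vec_on I W x) z"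
  by (intro pairing_adjoint[OF inv assms]) (rule W_star)

lemma pairing_G:
  assumes I: "star ` I = I" and sp: "semipos I (H_mat W \<beta>)" and \<beta>: "\<And>i. i \<in> I \<Longrightarrow> \<beta> (star i) = \<beta> i"
  shows "pairing star I x (mult_vec_on I (G_mat I W \<beta>) z) = pairing star I (mult_vec_on I (G_mat I W \<beta>) x) z"
  using G_mat_star[OF inv I W_star _ W_nonneg sp] \<beta> by (intro pairing_adjoint[OF inv I I]) auto

text \<open>
  Star symmetry of the inverse makes the two cross terms equal.
\<close>

lemma pairing_G_shift:
  assumes I: "star ` I = I" and sp: "semipos I (H_mat W \<beta>)" and \<beta>: "\<And>i. i \<in> I \<Longrightarrow> \<beta> (star i) = \<beta> i"
  defines "B \<equiv> pairing star I" and "g \<equiv> mult_vec_on I (G_mat I W \<beta>)"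
  shows "B (\<lambda>i. x i + z i) (g (\<lambda>i. x i + z i)) = B x (g x) + 2 * B x (g z) + B z (g z)"
proof -
  have "B z (g x) = B (g z) x" unfolding B_def g_def by (rule pairing_G[OF I sp \<beta>])
  also have "\<dots> = B x (g z)" unfolding B_def by (rule pairing_commute[OF inv I])
  finally have "B z (g x) = B x (g z)" .
  moreover have "g (\<lambda>i. x i + z i) = (\<lambda>i. g x i + g z i)"
    by (rule ext) (simp add: g_def mult_vec_on_add)
  ultimately show ?thesis by (simp add: B_def pairing_add_left pairing_add_right)
qed

text \<open>
  In the exponent, \<open>y = G\<eta>\<close> on \<open>I \<union> K\<close> is computed by block elimination: its restriction to \<open>K\<close> solves
  the Schur complement system with right-hand side \<open>check_eta\<close>, and its restriction to \<open>I\<close> is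
  \<open>G\<^sub>I (\<eta> + W y\<^sub>K)\<close>. With the notation \<open>g = G\<^sub>I\<close> and \<open>w = W\<^sub>I\<^sub>K \<theta>\<^sub>K\<close>, the cross terms \<open>\<langle>\<eta>, g w\<rangle>\<close> and
  \<open>\<langle>w, g w\<rangle>\<close> coming from the shifted \<open>\<eta> + w\<close> cancel against those of the \<open>K\<close> factor.
\<close>

lemma nu_S_dens_union:
  assumes dis: "I \<inter> K = {}" and I: "star ` I = I" and K: "star ` K = K"
    and half: "half_of star (I \<union> K) J1" and \<beta>: "\<And>i. i \<in> I \<union> K \<Longrightarrow> \<beta> (star i) = \<beta> i"
  shows "nu_S_dens star (I \<union> K) J1 W \<theta> \<eta> \<beta> =
    nu_S_dens star I (J1 \<inter> I) W \<theta> (shift_eta K \<theta> \<eta>) \<beta> *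
    nu_S_dens star K (J1 \<inter> K) (check_W I W \<beta>) \<theta> (check_eta I W \<eta> \<beta>) \<beta>"
proof (cases "semipos (I \<union> K) (H_mat W \<beta>)")
  case False
  then have "\<not> semipos I (H_mat W \<beta>) \<or> (semipos I (H_mat W \<beta>) \<and> \<not> semipos K (H_mat (check_W I W \<beta>) \<beta>))"
    using semipos_union_iff[of W, OF W_nonneg dis] by blast
  then have "\<not> pos_on I (H_mat W \<beta>) \<or> \<not> pos_on K (H_mat (check_W I W \<beta>) \<beta>)"
    using pos_on_iff_semipos[of W, OF W_nonneg] pos_on_iff_semipos[of "check_W I W \<beta>", OF check_W_nonneg[of W, OF W_nonneg]] by blast
  moreover have "\<not> pos_on (I \<union> K) (H_mat W \<beta>)"
    using False pos_on_iff_semipos[of W, OF W_nonneg] by blast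
  ultimately show ?thesis by (auto simp: nu_S_dens_def)
next
  case True
  then have spI: "semipos I (H_mat W \<beta>)" and spK: "semipos K (H_mat (check_W I W \<beta>) \<beta>)"
    using semipos_union_iff[of W, OF W_nonneg dis] by blast+
  note cnn = check_W_nonneg[of W, OF W_nonneg spI]
  have pos: "pos_on (I \<union> K) (H_mat W \<beta>)" "pos_on I (H_mat W \<beta>)" "pos_on K (H_mat (check_W I W \<beta>) \<beta>)"
    using True spI spK pos_on_iff_semipos[of W, OF W_nonneg] pos_on_iff_semipos[of "check_W I W \<beta>", OF cnn] by blast+
  define g where "g = mult_vec_on I (G_mat I W \<beta>)"
  define wK where "wK = mult_vec_on K W"
  define wI where "wI = mult_vec_on I W"
  define hI where "hI = mult_vec_on I (H_mat W \<beta>)"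
  define hK where "hK = mult_vec_on K (H_mat W \<beta>)"
  define s where "s = mult_vec_on K (H_mat (check_W I W \<beta>) \<beta>)"
  define y where "y = mult_vec_on (I \<union> K) (G_mat (I \<union> K) W \<beta>) \<eta>"
  define BI where "BI = pairing star I"
  define BK where "BK = pairing star K"
  have commI: "BI x z = BI z x" for x z unfolding BI_def by (rule pairing_commute[OF inv I])
  have gsym: "BI x (g z) = BI (g x) z" for x z
    unfolding BI_def g_def using \<beta> by (intro pairing_G[OF I spI]) auto
  have wadj: "BI x (wK z) = BK (wI x) z" for x z
    unfolding BI_def BK_def wK_def wI_def by (rule pairing_W[OF I K])
  have wadj': "BK x (wI z) = BI (wK x) z" for x z
    unfolding BI_def BK_def wK_def wI_def by (rule pairing_W[OF K I])
  have HJ_I: "mult_vec_on (I \<union> K) (H_mat W \<beta>) x i = hI x i - wK x i" if "i \<in> I" for x i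
  proof -
    have "i \<notin> K" using that dis by auto
    then show ?thesis by (simp add: mult_vec_on_Un[OF dis] mult_vec_on_H_mat_off hI_def wK_def)
  qed
  have HJ_K: "mult_vec_on (I \<union> K) (H_mat W \<beta>) x i = hK x i - wI x i" if "i \<in> K" for x i
  proof -
    have "i \<notin> I" using that dis by auto
    then show ?thesis by (simp add: mult_vec_on_Un[OF dis] mult_vec_on_H_mat_off hK_def wI_def)
  qed
  have sK: "s x i = hK x i - wI (g (wK x)) i" if "i \<in> K" for x i
    using schur_mult[OF that] by (simp add: s_def hK_def wI_def g_def wK_def)
  have quad: "pairing star (I \<union> K) \<theta> (mult_vec_on (I \<union> K) (H_mat W \<beta>) \<theta>)
      = BI \<theta> (hI \<theta>) + BK \<theta> (hK \<theta>) - 2 * BI \<theta> (wK \<theta>)"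
  proof -
    have "BI \<theta> (mult_vec_on (I \<union> K) (H_mat W \<beta>) \<theta>) = BI \<theta> (\<lambda>i. hI \<theta> i - wK \<theta> i)"
      unfolding BI_def by (rule pairing_cong[OF I refl HJ_I])
    moreover have "BK \<theta> (mult_vec_on (I \<union> K) (H_mat W \<beta>) \<theta>) = BK \<theta> (\<lambda>i. hK \<theta> i - wI \<theta> i)"
      unfolding BK_def by (rule pairing_cong[OF K refl HJ_K])
    moreover have "BK \<theta> (wI \<theta>) = BI \<theta> (wK \<theta>)" using wadj' commI by simp
    ultimately show ?thesis
      by (simp add: pairing_Un[OF dis] pairing_diff_right flip: BI_def BK_def) (simp add: BI_def BK_def pairing_diff_right)
  qed
  have quadK: "BK \<theta> (s \<theta>) = BK \<theta> (hK \<theta>) - BI (wK \<theta>) (g (wK \<theta>))"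
  proof -
    have "BK \<theta> (s \<theta>) = BK \<theta> (\<lambda>i. hK \<theta> i - wI (g (wK \<theta>)) i)"
      unfolding BK_def by (rule pairing_cong[OF K refl sK])
    then show ?thesis using wadj' by (simp add: BK_def pairing_diff_right)
  qed
  have Hy: "mult_vec_on (I \<union> K) (H_mat W \<beta>) y i = \<eta> i" if "i \<in> I \<union> K" for i
    unfolding y_def using is_inv_on_right[OF _ is_inv_on_G_mat[of W, OF W_nonneg True] that] by simp
  have yI: "y i = g \<eta> i + g (wK y) i" if i: "i \<in> I" for i
  proof -
    have "y i = g (hI y) i"
      unfolding g_def hI_def using is_inv_on_left[OF _ is_inv_on_G_mat[of W, OF W_nonneg spI] i] by simp
    also have "\<dots> = g (\<lambda>i. \<eta> i + wK y i) i"
    proof -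
      have "hI y j = \<eta> j + wK y j" if "j \<in> I" for j using Hy[of j] HJ_I[OF that, of y] that by simp
      then show ?thesis unfolding g_def by (intro mult_vec_on_cong refl)
    qed
    finally show ?thesis by (simp add: g_def mult_vec_on_add)
  qed
  (* hence the right-hand side of the system for y on K is the checked eta *)
  have wIy: "wI y i = wI (g \<eta>) i + wI (g (wK y)) i" for i
    unfolding wI_def using yI by (subst mult_vec_on_add[symmetric]) (auto intro: mult_vec_on_cong)
  have sy: "s y i = check_eta I W \<eta> \<beta> i" if i: "i \<in> K" for i
    using Hy[of i] HJ_K[OF i, of y] sK[OF i, of y] wIy[of i] i
    by (simp add: check_eta_def wI_def g_def)
  have yK: "y i = mult_vec_on K (G_mat K (check_W I W \<beta>) \<beta>) (check_eta I W \<eta> \<beta>) i" if i: "i \<in> K" for i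
  proof -
    have "y i = mult_vec_on K (G_mat K (check_W I W \<beta>) \<beta>) (s y) i"
      unfolding s_def using is_inv_on_left[OF _ is_inv_on_G_mat[of "check_W I W \<beta>", OF cnn spK] i] by simp
    also have "\<dots> = mult_vec_on K (G_mat K (check_W I W \<beta>) \<beta>) (check_eta I W \<eta> \<beta>) i"
      using sy by (intro mult_vec_on_cong) auto
    finally show ?thesis .
  qed
  have ce: "check_eta I W \<eta> \<beta> = (\<lambda>i. \<eta> i + wI (g \<eta>) i)" by (simp add: check_eta_def wI_def g_def)
  have inv_quad: "pairing star (I \<union> K) \<eta> y = BI \<eta> (g \<eta>) +
      BK (check_eta I W \<eta> \<beta>) (mult_vec_on K (G_mat K (check_W I W \<beta>) \<beta>) (check_eta I W \<eta> \<beta>))"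
  proof -
    have "BK (check_eta I W \<eta> \<beta>) (mult_vec_on K (G_mat K (check_W I W \<beta>) \<beta>) (check_eta I W \<eta> \<beta>))
        = BK (\<lambda>i. \<eta> i + wI (g \<eta>) i) y"
      unfolding BK_def ce[symmetric] using yK by (intro pairing_cong[OF K]) auto
    also have "\<dots> = BK \<eta> y + BI \<eta> (g (wK y))"
      using gsym wadj by (simp add: BK_def pairing_add_left)
    finally have 1: "BK (check_eta I W \<eta> \<beta>) (mult_vec_on K (G_mat K (check_W I W \<beta>) \<beta>) (check_eta I W \<eta> \<beta>))
        = BK \<eta> y + BI \<eta> (g (wK y))" .
    have "BI \<eta> y = BI \<eta> (\<lambda>i. g \<eta> i + g (wK y) i)"
      unfolding BI_def using yI by (intro pairing_cong[OF I]) auto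
    also have "\<dots> = BI \<eta> (g \<eta>) + BI \<eta> (g (wK y))" by (simp add: BI_def pairing_add_right)
    finally show ?thesis unfolding 1 by (simp add: pairing_Un[OF dis] BI_def BK_def)
  qed
  have hat_quad: "BI (\<lambda>i. \<eta> i + wK \<theta> i) (g (\<lambda>i. \<eta> i + wK \<theta> i))
      = BI \<eta> (g \<eta>) + 2 * BI \<eta> (g (wK \<theta>)) + BI (wK \<theta>) (g (wK \<theta>))"
    unfolding BI_def g_def wK_def using \<beta> by (intro pairing_G_shift[OF I spI]) auto
  have hat_lin: "BI \<theta> (\<lambda>i. \<eta> i + wK \<theta> i) = BI \<theta> \<eta> + BI \<theta> (wK \<theta>)"
    by (simp add: BI_def pairing_add_right)
  have check_lin: "BK \<theta> (check_eta I W \<eta> \<beta>) = BK \<theta> \<eta> + BI \<eta> (g (wK \<theta>))"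
  proof -
    have "BK \<theta> (wI (g \<eta>)) = BI \<eta> (g (wK \<theta>))" using gsym[of "wK \<theta>" \<eta>] wadj' commI by metis
    then show ?thesis by (simp add: ce BK_def pairing_add_right)
  qed
  have lin: "pairing star (I \<union> K) \<theta> \<eta> = BI \<theta> \<eta> + BK \<theta> \<eta>"
    by (simp add: pairing_Un[OF dis] BI_def BK_def)
  have expo: "- (1/2) * pairing star (I \<union> K) \<theta> (mult_vec_on (I \<union> K) (H_mat W \<beta>) \<theta>)
      - (1/2) * pairing star (I \<union> K) \<eta> y + pairing star (I \<union> K) \<theta> \<eta>
    = (- (1/2) * BI \<theta> (hI \<theta>) - (1/2) * BI (\<lambda>i. \<eta> i + wK \<theta> i) (g (\<lambda>i. \<eta> i + wK \<theta> i)) + BI \<theta> (\<lambda>i. \<eta> i + wK \<theta> i))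
    + (- (1/2) * BK \<theta> (s \<theta>) - (1/2) * BK (check_eta I W \<eta> \<beta>) (mult_vec_on K (G_mat K (check_W I W \<beta>) \<beta>) (check_eta I W \<eta> \<beta>))
       + BK \<theta> (check_eta I W \<eta> \<beta>))"
    unfolding quad quadK inv_quad hat_quad hat_lin check_lin lin by (simp add: field_simps)
  have prodJ: "(\<Prod>i\<in>fixed_pts star (I \<union> K). \<theta> i) = (\<Prod>i\<in>fixed_pts star I. \<theta> i) * (\<Prod>i\<in>fixed_pts star K. \<theta> i)"
  proof -
    have "fixed_pts star (I \<union> K) = fixed_pts star I \<union> fixed_pts star K" "fixed_pts star I \<inter> fixed_pts star K = {}"
      using dis by (auto simp: fixed_pts_def)
    then show ?thesis by (simp add: prod.union_disjoint)
  qed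
  show ?thesis
    unfolding nu_S_dens_def y_def[symmetric] expo exp_add prodJ half_card(2)[OF dis half] power_add
      det_on_union[of W, OF W_nonneg dis spI] real_sqrt_mult
    using pos by (simp add: BI_def BK_def hI_def g_def wK_def s_def mult_ac)
qed

text \<open>
  The part of the density of \<open>\<nu>\<^sub>A\<close> on \<open>I \<union> K\<close> that depends only on the coordinates in \<open>K\<close> once the
  interaction between \<open>I\<close> and \<open>K\<close> has been absorbed into \<open>\<eta>\<close>. The last term compensates for the
  normalization of that absorbed density on \<open>I\<close> at \<open>a = 0\<close>.
\<close>

definition split_factor where
  "split_factor I K K1 \<theta> \<eta> a = (1 / sqrt (2 * pi) ^ card K1) *
     exp (- (1/2) * pairing star K (exp_star star a \<theta>) (mult_vec_on K W (exp_star star a \<theta>))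
          + (1/2) * pairing star K \<theta> (mult_vec_on K W \<theta>)
          - pairing star K \<eta> (\<lambda>i. exp_star star a \<theta> i - \<theta> i)
          - pairing star I \<theta> (mult_vec_on K W (\<lambda>i. exp_star star a \<theta> i - \<theta> i)))"

text \<open>
  The interaction \<open>\<langle>y\<^sub>I, W y\<^sub>K\<rangle>\<close> of the two blocks is linear in \<open>y\<^sub>I\<close> for fixed \<open>y\<^sub>K\<close>, so it can be absorbed
  into the linear term with \<open>\<eta>\<close>.
\<close>

lemma nu_A_dens_union:
  assumes dis: "I \<inter> K = {}" and I: "star ` I = I" and K: "star ` K = K"
    and half: "half_of star (I \<union> K) J1"
  shows "nu_A_dens star (I \<union> K) J1 W \<theta> \<eta> a = split_factor I K (J1 \<inter> K) \<theta> \<eta> a *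
    nu_A_dens star I (J1 \<inter> I) W \<theta> (shift_eta K (exp_star star a \<theta>) \<eta>) a"
proof -
  define y where "y = exp_star star a \<theta>"
  define wK where "wK = mult_vec_on K W"
  define wI where "wI = mult_vec_on I W"
  define BI where "BI = pairing star I"
  define BK where "BK = pairing star K"
  have commI: "BI x z = BI z x" for x z unfolding BI_def by (rule pairing_commute[OF inv I])
  have wadj': "BK x (wI z) = BI (wK x) z" for x z
    unfolding BI_def BK_def wK_def wI_def by (rule pairing_W[OF K I])
  have W_add: "mult_vec_on (I \<union> K) W x = (\<lambda>i. wI x i + wK x i)" for x
    by (rule ext) (simp add: mult_vec_on_Un[OF dis] wI_def wK_def)
  have quad: "pairing star (I \<union> K) x (mult_vec_on (I \<union> K) W x) =
      BI x (wI x) + 2 * BI x (wK x) + BK x (wK x)" for x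
    using wadj'[of x x] commI[of "wK x" x] unfolding W_add pairing_Un[OF dis] pairing_add_right BI_def BK_def by simp
  have "- (1/2) * pairing star (I \<union> K) y (mult_vec_on (I \<union> K) W y)
          + (1/2) * pairing star (I \<union> K) \<theta> (mult_vec_on (I \<union> K) W \<theta>)
          - pairing star (I \<union> K) \<eta> (\<lambda>i. y i - \<theta> i)
     = (- (1/2) * BK y (wK y) + (1/2) * BK \<theta> (wK \<theta>) - BK \<eta> (\<lambda>i. y i - \<theta> i) - BI \<theta> (wK (\<lambda>i. y i - \<theta> i)))
     + (- (1/2) * BI y (wI y) + (1/2) * BI \<theta> (wI \<theta>) - BI (\<lambda>i. \<eta> i + wK y i) (\<lambda>i. y i - \<theta> i))"
  proof -
    have "wK (\<lambda>i. y i - \<theta> i) = (\<lambda>i. wK y i - wK \<theta> i)" by (rule ext) (simp add: wK_def mult_vec_on_diff)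
    then show ?thesis using commI[of "wK y" y] commI[of "wK y" \<theta>] unfolding quad unfolding pairing_Un[OF dis]
      by (simp add: BI_def BK_def pairing_add_left pairing_diff_right algebra_simps)
  qed
  then show ?thesis
    unfolding nu_A_dens_def split_factor_def y_def[symmetric] half_card(1)[OF dis half] power_add
    by (simp add: exp_add BI_def BK_def wI_def wK_def)
qed

text \<open>
  Both the shifted parameter and the checked ones contribute terms with \<open>G = G\<^sub>I\<close>. Those with \<open>\<theta>\<close> cancel, and
  the others combine to \<open>\<langle>\<eta> + Wy, G(\<eta> + Wy)\<rangle>\<close> with \<open>y = e\<^bsup>a*\<^esup>\<theta>\<close>. In this form the dependence on \<open>\<beta>\<close>
  sits in a density of \<open>\<nu>\<^sub>S\<close> on \<open>I\<close> alone.
\<close>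

lemma mixed_dens:
  assumes dis: "I \<inter> K = {}" and I: "star ` I = I" and K: "star ` K = K"
    and \<beta>: "\<And>i. i \<in> I \<Longrightarrow> \<beta> (star i) = \<beta> i"
  shows "nu_S_dens star I I1 W \<theta> (shift_eta K \<theta> \<eta>) \<beta> *
    nu_A_dens star K K1 (check_W I W \<beta>) \<theta> (check_eta I W \<eta> \<beta>) a =
    split_factor I K K1 \<theta> \<eta> a *
    nu_S_dens star I I1 W \<theta> (shift_eta K (exp_star star a \<theta>) \<eta>) \<beta>"
proof (cases "pos_on I (H_mat W \<beta>)")
  case False
  then show ?thesis by (simp add: nu_S_dens_def)
next
  case True
  then have spI: "semipos I (H_mat W \<beta>)" using pos_on_iff_semipos[of W, OF W_nonneg] by blast
  define y where "y = exp_star star a \<theta>"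
  define g where "g = mult_vec_on I (G_mat I W \<beta>)"
  define wK where "wK = mult_vec_on K W"
  define wI where "wI = mult_vec_on I W"
  define BI where "BI = pairing star I"
  define BK where "BK = pairing star K"
  have commI: "BI x z = BI z x" for x z unfolding BI_def by (rule pairing_commute[OF inv I])
  have gsym: "BI x (g z) = BI (g x) z" for x z
    unfolding BI_def g_def using \<beta> by (intro pairing_G[OF I spI]) auto
  have wadj': "BK x (wI z) = BI (wK x) z" for x z
    unfolding BI_def BK_def wK_def wI_def by (rule pairing_W[OF K I])
  have wadj: "BK (wI x) z = BI x (wK z)" for x z
    unfolding BI_def BK_def wK_def wI_def by (rule pairing_W[OF I K, symmetric])
  have ce: "check_eta I W \<eta> \<beta> = (\<lambda>i. \<eta> i + wI (g \<eta>) i)" by (simp add: check_eta_def wI_def g_def)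
  have cW: "mult_vec_on K (check_W I W \<beta>) x = (\<lambda>i. wK x i + wI (g (wK x)) i)" for x
    by (rule ext) (simp add: check_W_mult wI_def wK_def g_def)
  have quad: "BK x (mult_vec_on K (check_W I W \<beta>) x) = BK x (wK x) + BI (wK x) (g (wK x))" for x
    unfolding cW using wadj' by (simp add: BK_def pairing_add_right)
  have hat_quad: "BI (\<lambda>i. \<eta> i + wK x i) (g (\<lambda>i. \<eta> i + wK x i))
      = BI \<eta> (g \<eta>) + 2 * BI \<eta> (g (wK x)) + BI (wK x) (g (wK x))" for x
    unfolding BI_def g_def wK_def using \<beta> by (intro pairing_G_shift[OF I spI]) auto
  have hat_lin: "BI \<theta> (\<lambda>i. \<eta> i + wK x i) = BI \<theta> \<eta> + BI \<theta> (wK x)" for x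
    by (simp add: BI_def pairing_add_right)
  have wdiff: "wK (\<lambda>i. y i - \<theta> i) = (\<lambda>i. wK y i - wK \<theta> i)" by (rule ext) (simp add: wK_def mult_vec_on_diff)
  have check_lin: "BK (check_eta I W \<eta> \<beta>) (\<lambda>i. y i - \<theta> i)
      = BK \<eta> (\<lambda>i. y i - \<theta> i) + BI \<eta> (g (wK y)) - BI \<eta> (g (wK \<theta>))"
  proof -
    have "BK (wI (g \<eta>)) (\<lambda>i. y i - \<theta> i) = BI (g \<eta>) (wK (\<lambda>i. y i - \<theta> i))" by (rule wadj)
    also have "\<dots> = BI (g \<eta>) (wK y) - BI (g \<eta>) (wK \<theta>)" unfolding wdiff by (simp add: BI_def pairing_diff_right)
    finally show ?thesis unfolding ce using gsym by (simp add: BK_def pairing_add_left)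
  qed
  have lin: "BI \<theta> (wK (\<lambda>i. y i - \<theta> i)) = BI \<theta> (wK y) - BI \<theta> (wK \<theta>)"
    unfolding wdiff by (simp add: BI_def pairing_diff_right)
  define h where "h = BI \<theta> (mult_vec_on I (H_mat W \<beta>) \<theta>)"
  have expo: "(- (1/2) * h - (1/2) * BI (\<lambda>i. \<eta> i + wK \<theta> i) (g (\<lambda>i. \<eta> i + wK \<theta> i)) + BI \<theta> (\<lambda>i. \<eta> i + wK \<theta> i))
    + (- (1/2) * BK y (mult_vec_on K (check_W I W \<beta>) y) + (1/2) * BK \<theta> (mult_vec_on K (check_W I W \<beta>) \<theta>)
        - BK (check_eta I W \<eta> \<beta>) (\<lambda>i. y i - \<theta> i))
    = (- (1/2) * BK y (wK y) + (1/2) * BK \<theta> (wK \<theta>) - BK \<eta> (\<lambda>i. y i - \<theta> i) - BI \<theta> (wK (\<lambda>i. y i - \<theta> i)))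
    + (- (1/2) * h - (1/2) * BI (\<lambda>i. \<eta> i + wK y i) (g (\<lambda>i. \<eta> i + wK y i)) + BI \<theta> (\<lambda>i. \<eta> i + wK y i))"
    unfolding quad hat_quad hat_lin check_lin lin by (simp add: field_simps)
  have "exp (- (1/2) * h - (1/2) * BI (\<lambda>i. \<eta> i + wK \<theta> i) (g (\<lambda>i. \<eta> i + wK \<theta> i)) + BI \<theta> (\<lambda>i. \<eta> i + wK \<theta> i))
    * exp (- (1/2) * BK y (mult_vec_on K (check_W I W \<beta>) y) + (1/2) * BK \<theta> (mult_vec_on K (check_W I W \<beta>) \<theta>)
        - BK (check_eta I W \<eta> \<beta>) (\<lambda>i. y i - \<theta> i))
    = exp (- (1/2) * BK y (wK y) + (1/2) * BK \<theta> (wK \<theta>) - BK \<eta> (\<lambda>i. y i - \<theta> i) - BI \<theta> (wK (\<lambda>i. y i - \<theta> i)))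
    * exp (- (1/2) * h - (1/2) * BI (\<lambda>i. \<eta> i + wK y i) (g (\<lambda>i. \<eta> i + wK y i)) + BI \<theta> (\<lambda>i. \<eta> i + wK y i))"
    unfolding exp_add[symmetric] expo ..
  then show ?thesis
    unfolding nu_S_dens_def nu_A_dens_def split_factor_def y_def[symmetric] BI_def[symmetric] BK_def[symmetric]
      wK_def[symmetric] g_def[symmetric] h_def[symmetric]
    by (simp add: mult_ac)
qed

end

section \<open>Measurability of the densities\<close>

lemma det_measurable:
  fixes F :: "'a \<Rightarrow> real^'v^'v"
  assumes "\<And>i j. (\<lambda>x. F x $ i $ j) \<in> borel_measurable N"
  shows "(\<lambda>x. det (F x)) \<in> borel_measurable N"
  unfolding det_def
  by (intro borel_measurable_sum borel_measurable_times borel_measurable_const borel_measurable_prod assms)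

text \<open>
  This rests on \<open>semipos_det_pos\<close>: a negative determinant would make the real square root negative.
\<close>

lemma nu_S_dens_nonneg:
  fixes W :: "'v::finite \<Rightarrow> 'v \<Rightarrow> real"
  assumes W: "\<And>i j. W i j \<ge> 0" and \<theta>: "\<And>i. \<theta> i > 0"
  shows "nu_S_dens star J J1 W \<theta> \<eta> \<beta> \<ge> 0"
proof (cases "pos_on J (H_mat W \<beta>)")
  case True
  then have "det_on J (H_mat W \<beta>) > 0"
    using semipos_det_pos[of W, OF W] pos_on_iff_semipos[of W, OF W] by blast
  then show ?thesis using \<theta> unfolding nu_S_dens_def
    by (intro mult_nonneg_nonneg prod_nonneg) (auto intro: less_imp_le)
qed (simp add: nu_S_dens_def)

text \<open>
  Where the indicator does not vanish, the chosen inverse \<open>G_mat\<close> agrees with Cramer's rule, and the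
  condition itself is expressed by \<open>semipos_iff_cramer\<close>. The parameter \<open>\<eta>\<close> may vary along with \<open>\<beta>\<close>;
  this joint measurability is needed for Tonelli's theorem.
\<close>

lemma nu_S_dens_measurable:
  fixes W :: "'v::finite \<Rightarrow> 'v \<Rightarrow> real"
  assumes W: "\<And>i j. W i j \<ge> 0" and J: "star ` J = J"
    and \<beta>: "\<And>i. i \<in> J \<Longrightarrow> (\<lambda>x. \<beta> x i) \<in> borel_measurable N"
    and \<eta>: "\<And>i. i \<in> J \<Longrightarrow> (\<lambda>x. \<eta> x i) \<in> borel_measurable N"
  shows "(\<lambda>x. nu_S_dens star J J1 W \<theta> (\<eta> x) (\<beta> x)) \<in> borel_measurable N"
proof -
  define H where "H x = H_mat W (\<beta> x)" for x
  define P where "P x \<longleftrightarrow> det_on J (H x) \<noteq> 0 \<and> (\<forall>k\<in>J. \<forall>l\<in>J. cramer_inv J (H x) k l \<ge> 0)" for x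
  have star_J: "star i \<in> J" if "i \<in> J" for i using J that by blast
  note \<beta>[measurable] \<eta>[measurable]
  have [measurable]: "(\<lambda>x. H x i j) \<in> borel_measurable N" if "i \<in> J" "j \<in> J" for i j
    using that \<beta>[OF that(1)] by (cases "i = j") (simp_all add: H_def H_mat_def)
  have id_extension: "(\<lambda>x. id_extension J (H x) $ i $ j) \<in> borel_measurable N" for i j
    by (cases "i \<in> J \<and> j \<in> J"; cases "i = j") (auto simp: id_extension_def)
  have [measurable]: "(\<lambda>x. det_on J (H x)) \<in> borel_measurable N"
    unfolding det_on_id_extension by (intro det_measurable id_extension)
  have [measurable]: "(\<lambda>x. cramer_inv J (H x) k l) \<in> borel_measurable N" for k l
  proof -
    have "(\<lambda>x. det ((\<chi> i j. if j = k then if i = l then 1 else 0 else id_extension J (H x) $ i $ j) :: real^'v^'v)) \<in> borel_measurable N"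
    proof (rule det_measurable)
      show "(\<lambda>x. (\<chi> i j. if j = k then if i = l then 1 else 0 else id_extension J (H x) $ i $ j) $ i $ j) \<in> borel_measurable N" for i j
        using id_extension[of i j] by (cases "j = k") auto
    qed
    then show ?thesis unfolding cramer_inv_def by measurable
  qed
  have P[measurable]: "Measurable.pred N P"
    unfolding P_def by measurable
  define g where "g x = (if P x then (\<Prod>i\<in>fixed_pts star J. \<theta> i) * (1 / sqrt (2 * pi) ^ card (fixed_pts star J \<union> J1)) *
     exp (- (1/2) * (\<Sum>i\<in>J. \<theta> (star i) * (\<Sum>j\<in>J. H x i j * \<theta> j))
          - (1/2) * (\<Sum>i\<in>J. \<eta> x (star i) * (\<Sum>j\<in>J. cramer_inv J (H x) i j * \<eta> x j))
          + (\<Sum>i\<in>J. \<theta> (star i) * \<eta> x i)) * (1 / sqrt (det_on J (H x))) else 0)" for x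
  have "nu_S_dens star J J1 W \<theta> (\<eta> x) (\<beta> x) = g x" for x
  proof (cases "P x")
    case True
    then have pos: "pos_on J (H_mat W (\<beta> x))"
      using semipos_iff_cramer[of W, OF W] pos_on_iff_semipos[of W, OF W] unfolding P_def H_def by blast
    have "G_mat J W (\<beta> x) i j = cramer_inv J (H x) i j" if "i \<in> J" "j \<in> J" for i j
      unfolding G_mat_def H_def
      by (rule inv_on_eq) (use True that in \<open>auto intro: is_inv_on_cramer simp: P_def H_def\<close>)
    then show ?thesis using True pos unfolding nu_S_dens_def g_def pairing_def mult_vec_on_def
      by (simp add: H_def)
  next
    case False
    then have "\<not> pos_on J (H_mat W (\<beta> x))"
      using semipos_iff_cramer[of W, OF W] pos_on_iff_semipos[of W, OF W] unfolding P_def H_def by blast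
    then show ?thesis using False by (simp add: nu_S_dens_def g_def)
  qed
  moreover have "g \<in> borel_measurable N"
    unfolding g_def
    by (intro measurable_If borel_measurable_times borel_measurable_const borel_measurable_divide
        borel_measurable_add borel_measurable_diff measurable_compose[OF _ borel_measurable_exp]
        borel_measurable_sum measurable_compose[OF _ borel_measurable_sqrt] P[unfolded pred_def])
      (auto intro: \<eta> star_J)
  ultimately show ?thesis by simp
qed

lemma exp_star_measurable:
  assumes "star ` K = K" "\<And>i. i \<in> K \<Longrightarrow> (\<lambda>x. a x i) \<in> borel_measurable N" "i \<in> K"
  shows "(\<lambda>x. exp_star star (a x) \<theta> i) \<in> borel_measurable N"
proof -
  have "star i \<in> K" using assms by blast
  note assms(2)[OF this, measurable]
  show ?thesis unfolding exp_star_def by measurable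
qed

lemma nu_A_dens_measurable:
  fixes M :: "'v::finite \<Rightarrow> 'v \<Rightarrow> real"
  assumes K: "star ` K = K" and a: "\<And>i. i \<in> K \<Longrightarrow> (\<lambda>x. a x i) \<in> borel_measurable N"
  shows "(\<lambda>x. nu_A_dens star K K1 M \<theta> \<eta> (a x)) \<in> borel_measurable N"
proof -
  note m = exp_star_measurable[of star K a N, OF K a]
  have s: "star i \<in> K" if "i \<in> K" for i using K that by blast
  show ?thesis unfolding nu_A_dens_def pairing_def mult_vec_on_def
    by (intro borel_measurable_times borel_measurable_const
        borel_measurable_add borel_measurable_diff measurable_compose[OF _ borel_measurable_exp]
        borel_measurable_sum m s) auto
qed

lemma (in star_matrix) split_factor_measurable:
  assumes K: "star ` K = K" and a: "\<And>i. i \<in> K \<Longrightarrow> (\<lambda>x. a x i) \<in> borel_measurable N"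
  shows "(\<lambda>x. split_factor I K K1 \<theta> \<eta> (a x)) \<in> borel_measurable N"
proof -
  note m = exp_star_measurable[of star K a N, OF K a]
  have s: "star i \<in> K" if "i \<in> K" for i using K that by blast
  show ?thesis unfolding split_factor_def pairing_def mult_vec_on_def
    by (intro borel_measurable_times borel_measurable_const
        borel_measurable_add borel_measurable_diff measurable_compose[OF _ borel_measurable_exp]
        borel_measurable_sum m s) auto
qed


section \<open>Total masses as integrals over the free coordinates\<close>

definition sym_integral where
  "sym_integral star J J1 W \<theta> \<eta> =
     (\<integral>\<^sup>+x. ennreal (nu_S_dens star J J1 W \<theta> \<eta> (sym_ext star J J1 x)) \<partial>(\<Pi>\<^sub>M i\<in>fixed_pts star J \<union> J1. lborel))"

definition asym_integral where
  "asym_integral star J J1 W \<theta> \<eta> =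
     (\<integral>\<^sup>+x. ennreal (nu_A_dens star J J1 W \<theta> \<eta> (asym_ext star J J1 x)) \<partial>(\<Pi>\<^sub>M i\<in>J1. lborel))"

lemma sym_ext_component_measurable:
  assumes "\<And>i. star (star i) = i" "half_of star J J1" "i \<in> J"
  shows "(\<lambda>x. sym_ext star J J1 x i) \<in> borel_measurable (\<Pi>\<^sub>M i\<in>fixed_pts star J \<union> J1. lborel)"
proof -
  have "sym_ext star J J1 \<in> (\<Pi>\<^sub>M i\<in>fixed_pts star J \<union> J1. lborel) \<rightarrow>\<^sub>M (\<Pi>\<^sub>M i\<in>J. borel)"
    using sym_ext_measurable[OF assms(1,2)] by (simp add: measurable_restrict_space2_iff)
  from measurable_compose[OF this measurable_component_singleton[OF assms(3)]] show ?thesis by simp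
qed

lemma asym_ext_component_measurable:
  assumes "\<And>i. star (star i) = i" "half_of star J J1" "i \<in> J"
  shows "(\<lambda>x. asym_ext star J J1 x i) \<in> borel_measurable (\<Pi>\<^sub>M i\<in>J1. lborel)"
proof -
  have "asym_ext star J J1 \<in> (\<Pi>\<^sub>M i\<in>J1. lborel) \<rightarrow>\<^sub>M (\<Pi>\<^sub>M i\<in>J. borel)"
    using asym_ext_measurable[OF assms(1,2)] by (simp add: measurable_restrict_space2_iff)
  from measurable_compose[OF this measurable_component_singleton[OF assms(3)]] show ?thesis by simp
qed

lemma half_star:
  assumes inv: "\<And>i. star (star i) = i" and half: "half_of star J J1"
  shows "star ` J = J"
proof -
  have J: "J = fixed_pts star J \<union> J1 \<union> star ` J1" using half unfolding half_of_def by blast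
  have f: "star ` fixed_pts star J = fixed_pts star J" by (force simp: fixed_pts_def)
  have "star ` (fixed_pts star J \<union> J1 \<union> star ` J1) = fixed_pts star J \<union> star ` J1 \<union> J1"
    using f by (simp add: image_Un image_image inv)
  then show ?thesis using J by (metis Un_commute Un_left_commute)
qed

lemma sym_ext_star:
  assumes inv: "\<And>i. star (star i) = i" and half: "half_of star J J1" and i: "i \<in> J"
  shows "sym_ext star J J1 x (star i) = sym_ext star J J1 x i"
proof -
  have J: "J = fixed_pts star J \<union> J1 \<union> star ` J1"
    and d: "fixed_pts star J \<inter> star ` J1 = {}" "J1 \<inter> star ` J1 = {}"
    using half unfolding half_of_def by blast+
  have st: "star i \<in> J" using half_star[OF inv half] i by blast
  consider "i \<in> fixed_pts star J" | "i \<in> J1" | "i \<in> star ` J1" "i \<notin> fixed_pts star J" "i \<notin> J1" using J i d by blast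
  then show ?thesis
  proof cases
    case 1
    then show ?thesis by (simp add: fixed_pts_def)
  next
    case 2
    then have "star i \<notin> J1" "star i \<notin> fixed_pts star J" using d by blast+
    then show ?thesis using 2 i st inv by (simp add: sym_ext_def)
  next
    case 3
    then have "star i \<in> J1" using inv by auto
    then show ?thesis using 3 i st by (simp add: sym_ext_def)
  qed
qed

lemma sym_ext_union:
  assumes inv: "\<And>i. star (star i) = i" and half: "half_of star (I \<union> K) J1" and I: "star ` I = I"
    and i: "i \<in> I" and x: "\<And>j. j \<in> fixed_pts star I \<union> (J1 \<inter> I) \<Longrightarrow> z j = x j"
  shows "sym_ext star (I \<union> K) J1 z i = sym_ext star I (J1 \<inter> I) x i"
proof -
  have J: "i \<in> fixed_pts star (I \<union> K) \<or> i \<in> J1 \<or> i \<in> star ` J1"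
    using half i unfolding half_of_def by blast
  have st: "star i \<in> I" using I i by blast
  have "star i \<in> J1" if "i \<notin> fixed_pts star (I \<union> K) \<union> J1" using J that inv by auto
  then show ?thesis using i st x[of i] x[of "star i"] by (auto simp: sym_ext_def fixed_pts_def)
qed

lemma asym_ext_union:
  assumes inv: "\<And>i. star (star i) = i" and half: "half_of star (I \<union> K) J1" and I: "star ` I = I"
    and i: "i \<in> I" and x: "\<And>j. j \<in> J1 \<inter> I \<Longrightarrow> z j = x j"
  shows "asym_ext star (I \<union> K) J1 z i = asym_ext star I (J1 \<inter> I) x i"
proof -
  have J: "i \<in> fixed_pts star (I \<union> K) \<or> i \<in> J1 \<or> i \<in> star ` J1"
    using half i unfolding half_of_def by blast
  have st: "star i \<in> I" using I i by blast
  have "star i \<in> J1" if "i \<notin> fixed_pts star (I \<union> K) \<union> J1" using J that inv by auto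
  then show ?thesis using i st x[of i] x[of "star i"] by (auto simp: asym_ext_def fixed_pts_def)
qed

lemma inv_on_cong:
  assumes "\<And>i j. i \<in> J \<Longrightarrow> j \<in> J \<Longrightarrow> A i j = B i j"
  shows "inv_on J A = inv_on J B"
  unfolding inv_on_def using assms by (intro arg_cong[where f = Eps] ext) simp

lemma G_mat_cong:
  assumes "\<And>i. i \<in> J \<Longrightarrow> \<beta> i = \<beta>' i"
  shows "G_mat J M \<beta> = G_mat J M \<beta>'"
  unfolding G_mat_def using assms by (intro inv_on_cong) (simp add: H_mat_def)

lemma check_cong:
  assumes "\<And>i. i \<in> I \<Longrightarrow> \<beta> i = \<beta>' i"
  shows "check_W I W \<beta> = check_W I W \<beta>'" "check_eta I W \<eta> \<beta> = check_eta I W \<eta> \<beta>'"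
proof -
  have G: "G_mat I W \<beta> = G_mat I W \<beta>'" by (rule G_mat_cong[OF assms])
  show "check_W I W \<beta> = check_W I W \<beta>'" "check_eta I W \<eta> \<beta> = check_eta I W \<eta> \<beta>'"
    unfolding check_W_def check_eta_def G by simp_all
qed

lemma nu_S_dens_cong:
  fixes M :: "'v::finite \<Rightarrow> 'v \<Rightarrow> real"
  assumes J: "star ` J = J" and \<beta>: "\<And>i. i \<in> J \<Longrightarrow> \<beta> i = \<beta>' i" and \<eta>: "\<And>i. i \<in> J \<Longrightarrow> \<eta> i = \<eta>' i"
  shows "nu_S_dens star J J1 M \<theta> \<eta> \<beta> = nu_S_dens star J J1 M \<theta> \<eta>' \<beta>'"
proof -
  have H: "H_mat M \<beta> i j = H_mat M \<beta>' i j" if "i \<in> J" for i j using \<beta>[OF that] by (auto simp: H_mat_def)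
  have d: "det_on J (H_mat M \<beta>) = det_on J (H_mat M \<beta>')"
    unfolding det_on_def using H by (intro sum.cong refl arg_cong2[where f = "(*)"] prod.cong) auto
  have p: "pos_on J (H_mat M \<beta>) = pos_on J (H_mat M \<beta>')"
    unfolding pos_on_def eigenvalue_on_def mult_vec_on_def using H by simp
  have h: "pairing star J \<theta> (mult_vec_on J (H_mat M \<beta>) \<theta>) = pairing star J \<theta> (mult_vec_on J (H_mat M \<beta>') \<theta>)"
    using H by (intro pairing_cong[OF J] mult_vec_on_cong) auto
  have G: "G_mat J M \<beta> = G_mat J M \<beta>'" by (rule G_mat_cong[OF \<beta>])
  have g: "pairing star J \<eta> (mult_vec_on J (G_mat J M \<beta>) \<eta>) = pairing star J \<eta>' (mult_vec_on J (G_mat J M \<beta>') \<eta>')"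
    unfolding G using \<eta> by (intro pairing_cong[OF J] mult_vec_on_cong) auto
  have l: "pairing star J \<theta> \<eta> = pairing star J \<theta> \<eta>'" using \<eta> by (intro pairing_cong[OF J]) auto
  show ?thesis unfolding nu_S_dens_def d p h g l ..
qed

lemma exp_star_cong:
  assumes "star ` K = K" "\<And>i. i \<in> K \<Longrightarrow> a i = a' i" "i \<in> K"
  shows "exp_star star a \<theta> i = exp_star star a' \<theta> i"
proof -
  have "star i \<in> K" using assms by blast
  then show ?thesis using assms(2) by (simp add: exp_star_def)
qed

lemma nu_A_dens_cong:
  fixes M :: "'v::finite \<Rightarrow> 'v \<Rightarrow> real"
  assumes J: "star ` J = J" and a: "\<And>i. i \<in> J \<Longrightarrow> a i = a' i"
  shows "nu_A_dens star J J1 M \<theta> \<eta> a = nu_A_dens star J J1 M \<theta> \<eta> a'"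
proof -
  note e = exp_star_cong[of star J a a', OF J a]
  have q: "pairing star J (exp_star star a \<theta>) (mult_vec_on J M (exp_star star a \<theta>))
      = pairing star J (exp_star star a' \<theta>) (mult_vec_on J M (exp_star star a' \<theta>))"
    using e by (intro pairing_cong[OF J] mult_vec_on_cong) auto
  have l: "pairing star J \<eta> (\<lambda>i. exp_star star a \<theta> i - \<theta> i) = pairing star J \<eta> (\<lambda>i. exp_star star a' \<theta> i - \<theta> i)"
    using e by (intro pairing_cong[OF J]) auto
  show ?thesis unfolding nu_A_dens_def q l ..
qed

lemma (in star_matrix) split_factor_cong:
  assumes K: "star ` K = K" and a: "\<And>i. i \<in> K \<Longrightarrow> a i = a' i"
  shows "split_factor I K K1 \<theta> \<eta> a = split_factor I K K1 \<theta> \<eta> a'"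
proof -
  note e = exp_star_cong[of star K a a', OF K a]
  have q: "pairing star K (exp_star star a \<theta>) (mult_vec_on K W (exp_star star a \<theta>))
      = pairing star K (exp_star star a' \<theta>) (mult_vec_on K W (exp_star star a' \<theta>))"
    using e by (intro pairing_cong[OF K] mult_vec_on_cong) auto
  have l: "pairing star K \<eta> (\<lambda>i. exp_star star a \<theta> i - \<theta> i) = pairing star K \<eta> (\<lambda>i. exp_star star a' \<theta> i - \<theta> i)"
    using e by (intro pairing_cong[OF K]) auto
  have m: "mult_vec_on K W (\<lambda>i. exp_star star a \<theta> i - \<theta> i) = mult_vec_on K W (\<lambda>i. exp_star star a' \<theta> i - \<theta> i)"
    using e by (intro ext mult_vec_on_cong) auto
  show ?thesis unfolding split_factor_def q l m ..
qed

context star_matrix begin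

lemma nu_S_dens_eq_0: "\<not> semipos I (H_mat W \<beta>) \<Longrightarrow> nu_S_dens star I I1 W \<theta> \<eta> \<beta> = 0"
  using pos_on_iff_semipos[of W, OF W_nonneg] by (simp add: nu_S_dens_def)

text \<open>
  Integrated form of \<open>nu_S_dens_union\<close>. The inner integral is only identified where the first factor
  is nonzero, since only there the checked matrix is known to be nonnegative.
\<close>

lemma sym_integral_union:
  assumes dis: "I \<inter> K = {}" and I: "star ` I = I" and K: "star ` K = K"
    and half: "half_of star (I \<union> K) J1" and \<theta>: "\<And>i. \<theta> i > 0"
  shows "sym_integral star (I \<union> K) J1 W \<theta> \<eta> =
    (\<integral>\<^sup>+x. ennreal (nu_S_dens star I (J1 \<inter> I) W \<theta> (shift_eta K \<theta> \<eta>) (sym_ext star I (J1 \<inter> I) x)) *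
       sym_integral star K (J1 \<inter> K) (check_W I W (sym_ext star I (J1 \<inter> I) x)) \<theta> (check_eta I W \<eta> (sym_ext star I (J1 \<inter> I) x))
       \<partial>(\<Pi>\<^sub>M i\<in>fixed_pts star I \<union> (J1 \<inter> I). lborel))"
proof -
  let ?b = "sym_ext star I (J1 \<inter> I)" and ?bJ = "sym_ext star (I \<union> K) J1"
  let ?dJ = "nu_S_dens star (I \<union> K) J1 W \<theta> \<eta>"
  let ?dI = "nu_S_dens star I (J1 \<inter> I) W \<theta> (shift_eta K \<theta> \<eta>)"
  let ?dK = "\<lambda>\<beta>. nu_S_dens star K (J1 \<inter> K) (check_W I W \<beta>) \<theta> (check_eta I W \<eta> \<beta>)"
  let ?SK = "\<lambda>\<beta>. sym_integral star K (J1 \<inter> K) (check_W I W \<beta>) \<theta> (check_eta I W \<eta> \<beta>)"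
  interpret product_sigma_finite "\<lambda>_::'v. lborel :: real measure" by standard
  define FI where "FI = fixed_pts star I \<union> (J1 \<inter> I)"
  define FK where "FK = fixed_pts star K \<union> (J1 \<inter> K)"
  have halfI: "half_of star I (J1 \<inter> I)" by (rule half_of_inter[OF inv half I])
  have half': "half_of star (K \<union> I) J1" using half by (simp add: Un_commute)
  have halfK: "half_of star K (J1 \<inter> K)" by (rule half_of_inter[OF inv half' K])
  have J: "star ` (I \<union> K) = I \<union> K" using I K by (simp add: image_Un)
  have "J1 \<subseteq> I \<union> K" using half unfolding half_of_def by blast
  then have F: "fixed_pts star (I \<union> K) \<union> J1 = FI \<union> FK" by (auto simp: FI_def FK_def fixed_pts_def)
  have FIK: "FI \<inter> FK = {}" using dis by (auto simp: FI_def FK_def fixed_pts_def)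
  have eq: "?dJ (?bJ (merge FI FK (x, y))) =
    ?dI (?b x) *
    ?dK (?b x) (sym_ext star K (J1 \<inter> K) y)" for x y
  proof -
    define \<beta> where "\<beta> = ?bJ (merge FI FK (x, y))"
    have \<beta>I: "\<beta> i = ?b x i" if "i \<in> I" for i
      unfolding \<beta>_def using FIK by (intro sym_ext_union[OF inv half I that]) (auto simp: merge_def FI_def)
    have \<beta>K: "\<beta> i = sym_ext star K (J1 \<inter> K) y i" if "i \<in> K" for i
      unfolding \<beta>_def Un_commute[of I K] using FIK
      by (intro sym_ext_union[OF inv half' K that]) (auto simp: merge_def FK_def)
    have 1: "?dI \<beta>
      = ?dI (?b x)"
      using \<beta>I by (intro nu_S_dens_cong[OF I]) auto
    have cc: "check_W I W \<beta> = check_W I W (?b x)"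
      "check_eta I W \<eta> \<beta> = check_eta I W \<eta> (?b x)"
      by (rule check_cong[OF \<beta>I], assumption)+
    have 2: "?dK \<beta> \<beta>
      = ?dK (?b x) (sym_ext star K (J1 \<inter> K) y)"
      unfolding cc
      using \<beta>K by (intro nu_S_dens_cong[OF K]) auto
    have "?dJ \<beta> =
      ?dI \<beta> *
      ?dK \<beta> \<beta>"
      by (rule nu_S_dens_union[OF dis I K half]) (simp add: \<beta>_def sym_ext_star[OF inv half])
    then show ?thesis unfolding 1 2 unfolding \<beta>_def .
  qed
  have m: "(\<lambda>x. ennreal (?dJ (?bJ x)))
      \<in> borel_measurable (\<Pi>\<^sub>M i\<in>FI \<union> FK. lborel)"
    using sym_ext_component_measurable[OF inv half] unfolding F
    by (intro measurable_compose[OF _ measurable_ennreal] nu_S_dens_measurable[OF W_nonneg J]) auto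
  have "sym_integral star (I \<union> K) J1 W \<theta> \<eta> = (\<integral>\<^sup>+x. \<integral>\<^sup>+y.
      ennreal (?dJ (?bJ (merge FI FK (x, y))))
      \<partial>(\<Pi>\<^sub>M i\<in>FK. lborel) \<partial>(\<Pi>\<^sub>M i\<in>FI. lborel))"
    unfolding sym_integral_def F by (rule product_nn_integral_fold[OF FIK _ _ m]) auto
  also have "\<dots> = (\<integral>\<^sup>+x. ennreal (?dI (?b x)) *
       ?SK (?b x)
       \<partial>(\<Pi>\<^sub>M i\<in>FI. lborel))"
  proof (rule nn_integral_cong)
    fix x
    define \<beta> where "\<beta> = ?b x"
    show "(\<integral>\<^sup>+y. ennreal (?dJ (?bJ (merge FI FK (x, y))))
      \<partial>(\<Pi>\<^sub>M i\<in>FK. lborel)) = ennreal (?dI (?b x)) *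
       ?SK (?b x)"
      unfolding eq \<beta>_def[symmetric] ennreal_mult'[OF nu_S_dens_nonneg[OF W_nonneg \<theta>]]
    proof (cases "semipos I (H_mat W \<beta>)")
      case True
      have "(\<lambda>y. ?dK \<beta> (sym_ext star K (J1 \<inter> K) y))
          \<in> borel_measurable (\<Pi>\<^sub>M i\<in>FK. lborel)"
        unfolding FK_def
        by (intro nu_S_dens_measurable[OF check_W_nonneg[of W, OF W_nonneg True] K]
            sym_ext_component_measurable[OF inv halfK]) auto
      then show "(\<integral>\<^sup>+y. ennreal (?dI \<beta>) *
          ennreal (?dK \<beta> (sym_ext star K (J1 \<inter> K) y)) \<partial>(\<Pi>\<^sub>M i\<in>FK. lborel))
        = ennreal (?dI \<beta>) *
          ?SK \<beta>"
        unfolding sym_integral_def FK_def[symmetric] by (intro nn_integral_cmult) simp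
    next
      case False
      then have "?dI \<beta> = 0" by (rule nu_S_dens_eq_0)
      then show "(\<integral>\<^sup>+y. ennreal (?dI \<beta>) *
          ennreal (?dK \<beta> (sym_ext star K (J1 \<inter> K) y)) \<partial>(\<Pi>\<^sub>M i\<in>FK. lborel))
        = ennreal (?dI \<beta>) *
          ?SK \<beta>" by simp
    qed
  qed
  finally show ?thesis unfolding FI_def .
qed

lemma split_factor_nonneg: "split_factor I K K1 \<theta> \<eta> a \<ge> 0"
  by (simp add: split_factor_def)

lemma asym_integral_union:
  assumes dis: "I \<inter> K = {}" and I: "star ` I = I" and K: "star ` K = K"
    and half: "half_of star (I \<union> K) J1"
  shows "asym_integral star (I \<union> K) J1 W \<theta> \<eta> =
    (\<integral>\<^sup>+y. ennreal (split_factor I K (J1 \<inter> K) \<theta> \<eta> (asym_ext star K (J1 \<inter> K) y)) *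
       asym_integral star I (J1 \<inter> I) W \<theta> (shift_eta K (exp_star star (asym_ext star K (J1 \<inter> K) y) \<theta>) \<eta>)
       \<partial>(\<Pi>\<^sub>M i\<in>J1 \<inter> K. lborel))"
proof -
  let ?aI = "asym_ext star I (J1 \<inter> I)" and ?aK = "asym_ext star K (J1 \<inter> K)"
  let ?aJ = "asym_ext star (I \<union> K) J1" and ?c = "split_factor I K (J1 \<inter> K) \<theta> \<eta>"
  let ?dJ = "nu_A_dens star (I \<union> K) J1 W \<theta> \<eta>" and ?dI = "nu_A_dens star I (J1 \<inter> I) W \<theta>"
  interpret product_sigma_finite "\<lambda>_::'v. lborel :: real measure" by standard
  have halfI: "half_of star I (J1 \<inter> I)" by (rule half_of_inter[OF inv half I])
  have half': "half_of star (K \<union> I) J1" using half by (simp add: Un_commute)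
  have J: "star ` (I \<union> K) = I \<union> K" using I K by (simp add: image_Un)
  have "J1 \<subseteq> I \<union> K" using half unfolding half_of_def by blast
  then have F: "J1 = (J1 \<inter> K) \<union> (J1 \<inter> I)" by blast
  have FIK: "(J1 \<inter> K) \<inter> (J1 \<inter> I) = {}" using dis by blast
  let ?mrg = "\<lambda>y x. merge (J1 \<inter> K) (J1 \<inter> I) (y, x)"
  have eq: "?dJ (?aJ (?mrg y x)) =
    ?c (?aK y) *
    ?dI (shift_eta K (exp_star star (?aK y) \<theta>) \<eta>) (?aI x)" for x y
  proof -
    define a where "a = ?aJ (?mrg y x)"
    have aI: "a i = ?aI x i" if "i \<in> I" for i
      unfolding a_def using FIK by (intro asym_ext_union[OF inv half I that]) (auto simp: merge_def)
    have aK: "a i = ?aK y i" if "i \<in> K" for i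
      unfolding a_def Un_commute[of I K] using FIK
      by (intro asym_ext_union[OF inv half' K that]) (auto simp: merge_def)
    have 1: "?c a = ?c (?aK y)"
      by (rule split_factor_cong[OF K aK])
    have 2: "mult_vec_on K W (exp_star star a \<theta>) = mult_vec_on K W (exp_star star (?aK y) \<theta>)"
      using exp_star_cong[of star K a, OF K aK] by (intro ext mult_vec_on_cong) auto
    have 3: "?dI \<eta>' a = ?dI \<eta>' (?aI x)" for \<eta>'
      by (rule nu_A_dens_cong[OF I aI])
    show ?thesis using nu_A_dens_union[OF dis I K half, of \<theta> \<eta> a] unfolding 1 2 3 unfolding a_def .
  qed
  have m: "(\<lambda>x. ennreal (?dJ (?aJ x)))
      \<in> borel_measurable (\<Pi>\<^sub>M i\<in>(J1 \<inter> K) \<union> (J1 \<inter> I). lborel)"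
    unfolding F[symmetric]
    by (intro measurable_compose[OF _ measurable_ennreal] nu_A_dens_measurable[OF J] asym_ext_component_measurable[OF inv half])
  have "asym_integral star (I \<union> K) J1 W \<theta> \<eta> =
      (\<integral>\<^sup>+x. ennreal (?dJ (?aJ x)) \<partial>(\<Pi>\<^sub>M i\<in>(J1 \<inter> K) \<union> (J1 \<inter> I). lborel))"
    unfolding asym_integral_def F[symmetric] ..
  also have "\<dots> = (\<integral>\<^sup>+y. \<integral>\<^sup>+x.
      ennreal (?dJ (?aJ (?mrg y x)))
      \<partial>(\<Pi>\<^sub>M i\<in>J1 \<inter> I. lborel) \<partial>(\<Pi>\<^sub>M i\<in>J1 \<inter> K. lborel))"
    by (rule product_nn_integral_fold[OF FIK _ _ m]) auto
  also have "\<dots> = (\<integral>\<^sup>+y. ennreal (?c (?aK y)) *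
       asym_integral star I (J1 \<inter> I) W \<theta> (shift_eta K (exp_star star (?aK y) \<theta>) \<eta>)
       \<partial>(\<Pi>\<^sub>M i\<in>J1 \<inter> K. lborel))"
    unfolding asym_integral_def eq ennreal_mult'[OF split_factor_nonneg]
    by (intro nn_integral_cong nn_integral_cmult measurable_compose[OF _ measurable_ennreal]
        nu_A_dens_measurable[OF I] asym_ext_component_measurable[OF inv halfI])
  finally show ?thesis .
qed

text \<open>
  The total mass of the mixed measure in free coordinates, for \<open>\<beta>\<close> on \<open>I\<close> and \<open>a\<close> on an arbitrary
  set \<open>K\<close> disjoint from \<open>I\<close>, as the induction over orbits requires.
\<close>

definition mixed_integral where
  "mixed_integral I I1 K K1 \<theta> \<eta> =
    (\<integral>\<^sup>+x. ennreal (nu_S_dens star I I1 W \<theta> (shift_eta K \<theta> \<eta>) (sym_ext star I I1 x)) *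
       asym_integral star K K1 (check_W I W (sym_ext star I I1 x)) \<theta> (check_eta I W \<eta> (sym_ext star I I1 x))
       \<partial>(\<Pi>\<^sub>M i\<in>fixed_pts star I \<union> I1. lborel))"

text \<open>
  The form of the mixed density given by \<open>mixed_dens\<close> is also what makes it jointly measurable, so that
  Tonelli applies.
\<close>

lemma mixed_integral_swap:
  assumes dis: "I \<inter> K = {}" and I1: "half_of star I I1" and K1: "half_of star K K1" and \<theta>: "\<And>i. \<theta> i > 0"
  shows "mixed_integral I I1 K K1 \<theta> \<eta> =
    (\<integral>\<^sup>+y. ennreal (split_factor I K K1 \<theta> \<eta> (asym_ext star K K1 y)) *
       sym_integral star I I1 W \<theta> (shift_eta K (exp_star star (asym_ext star K K1 y) \<theta>) \<eta>)
       \<partial>(\<Pi>\<^sub>M i\<in>K1. lborel))"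
proof -
  let ?b = "sym_ext star I I1" and ?aK = "asym_ext star K K1"
  let ?c = "split_factor I K K1 \<theta> \<eta>" and ?dI = "nu_S_dens star I I1 W \<theta>"
  let ?AK = "\<lambda>\<beta>. asym_integral star K K1 (check_W I W \<beta>) \<theta> (check_eta I W \<eta> \<beta>)"
  interpret product_sigma_finite "\<lambda>_::'v. lborel :: real measure" by standard
  interpret PI: finite_product_sigma_finite "\<lambda>_::'v. lborel :: real measure" "fixed_pts star I \<union> I1" by standard simp
  interpret PK: finite_product_sigma_finite "\<lambda>_::'v. lborel :: real measure" "K1" by standard simp
  let ?MI = "\<Pi>\<^sub>M i\<in>fixed_pts star I \<union> I1. lborel :: real measure"
  let ?MK = "\<Pi>\<^sub>M i\<in>K1. lborel :: real measure"
  interpret P: pair_sigma_finite ?MI ?MK ..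
  note I = half_star[OF inv I1] and K = half_star[OF inv K1]
  let ?g = "\<lambda>x y. ennreal (?c (?aK y)) *
       ennreal (?dI (shift_eta K (exp_star star (?aK y) \<theta>) \<eta>) (?b x))"
  have ms: "(\<lambda>y. ennreal (?c (?aK y))) \<in> borel_measurable ?MK"
    by (intro measurable_compose[OF _ measurable_ennreal] split_factor_measurable[OF K]
        asym_ext_component_measurable[OF inv K1])
  have md: "(\<lambda>z. ?dI (shift_eta K (exp_star star (?aK (snd z)) \<theta>) \<eta>)
      (?b (fst z))) \<in> borel_measurable (?MI \<Otimes>\<^sub>M ?MK)"
  proof (rule nu_S_dens_measurable[OF W_nonneg I])
    show "(\<lambda>z. ?b (fst z) i) \<in> borel_measurable (?MI \<Otimes>\<^sub>M ?MK)" if "i \<in> I" for i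
      by (rule measurable_compose[OF measurable_fst sym_ext_component_measurable[OF inv I1 that]])
    have "(\<lambda>z. exp_star star (?aK (snd z)) \<theta> j) \<in> borel_measurable (?MI \<Otimes>\<^sub>M ?MK)" if "j \<in> K" for j
      by (rule exp_star_measurable[OF K _ that])
        (rule measurable_compose[OF measurable_snd asym_ext_component_measurable[OF inv K1]])
    then show "(\<lambda>z. \<eta> i + mult_vec_on K W (exp_star star (?aK (snd z)) \<theta>) i) \<in> borel_measurable (?MI \<Otimes>\<^sub>M ?MK)" for i
      unfolding mult_vec_on_def by (intro borel_measurable_add borel_measurable_const borel_measurable_sum borel_measurable_times)
  qed
  have mg: "(\<lambda>(x, y). ?g x y) \<in> borel_measurable (?MI \<Otimes>\<^sub>M ?MK)"
    unfolding case_prod_beta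
    by (rule borel_measurable_times_ennreal[OF measurable_compose[OF measurable_snd ms] measurable_compose[OF md measurable_ennreal]])
  have "mixed_integral I I1 K K1 \<theta> \<eta> = (\<integral>\<^sup>+x. \<integral>\<^sup>+y. ?g x y \<partial>?MK \<partial>?MI)"
    unfolding mixed_integral_def
  proof (rule nn_integral_cong)
    fix x
    define \<beta> where "\<beta> = ?b x"
    have "ennreal (?dI (shift_eta K \<theta> \<eta>) \<beta>) *
       ?AK \<beta>
      = (\<integral>\<^sup>+y. ennreal (?dI (shift_eta K \<theta> \<eta>) \<beta>) *
       ennreal (nu_A_dens star K K1 (check_W I W \<beta>) \<theta> (check_eta I W \<eta> \<beta>) (?aK y)) \<partial>?MK)"
      unfolding asym_integral_def
      by (intro nn_integral_cmult[symmetric] measurable_compose[OF _ measurable_ennreal]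
        nu_A_dens_measurable[OF K] asym_ext_component_measurable[OF inv K1])
    also have "\<dots> = (\<integral>\<^sup>+y. ?g x y \<partial>?MK)"
      unfolding ennreal_mult'[OF nu_S_dens_nonneg[OF W_nonneg \<theta>], symmetric] ennreal_mult'[OF split_factor_nonneg, symmetric]
      using sym_ext_star[OF inv I1] by (subst mixed_dens[OF dis I K]) (auto simp: \<beta>_def)
    finally show "ennreal (?dI (shift_eta K \<theta> \<eta>) (?b x)) *
       ?AK (?b x) = (\<integral>\<^sup>+y. ?g x y \<partial>?MK)"
      unfolding \<beta>_def .
  qed
  also have "\<dots> = (\<integral>\<^sup>+y. \<integral>\<^sup>+x. ?g x y \<partial>?MI \<partial>?MK)"
    by (rule P.Fubini'[OF mg, symmetric])
  also have "\<dots> = (\<integral>\<^sup>+y. ennreal (?c (?aK y)) *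
       sym_integral star I I1 W \<theta> (shift_eta K (exp_star star (?aK y) \<theta>) \<eta>) \<partial>?MK)"
    unfolding sym_integral_def
    by (intro nn_integral_cong nn_integral_cmult measurable_compose[OF _ measurable_ennreal]
        nu_S_dens_measurable[OF W_nonneg I] sym_ext_component_measurable[OF inv I1]) auto
  finally show ?thesis .
qed

end

text \<open>
  The two selections \<open>J1\<close> and \<open>J1'\<close> are independent of each other. This makes both integrals independent
  of the selection, which is needed because the restriction of a selection on \<open>I \<union> K\<close> to one block may
  differ from the selection given there.
\<close>

definition balanced :: "('v::finite \<Rightarrow> 'v) \<Rightarrow> 'v set \<Rightarrow> bool" where
  "balanced star J \<longleftrightarrow> (\<forall>W \<theta> \<eta> J1 J1'. star_matrix star W \<longrightarrow> (\<forall>i. \<theta> i > 0) \<longrightarrow> (\<forall>i. \<eta> i \<ge> 0) \<longrightarrow>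
     half_of star J J1 \<longrightarrow> half_of star J J1' \<longrightarrow> sym_integral star J J1 W \<theta> \<eta> = asym_integral star J J1' W \<theta> \<eta>)"

lemma balancedD:
  assumes "balanced star J" "star_matrix star W" "\<And>i. \<theta> i > 0" "\<And>i. \<eta> i \<ge> 0" "half_of star J J1" "half_of star J J1'"
  shows "sym_integral star J J1 W \<theta> \<eta> = asym_integral star J J1' W \<theta> \<eta>"
  using assms unfolding balanced_def by blast

context star_matrix begin

lemma star_matrix_check:
  assumes I1: "half_of star I I1" and sp: "semipos I (H_mat W (sym_ext star I I1 x))"
  shows "star_matrix star (check_W I W (sym_ext star I I1 x))"
proof
  fix i j
  show "check_W I W (sym_ext star I I1 x) i j = check_W I W (sym_ext star I I1 x) (star j) (star i)"
    by (rule check_W_star[OF inv half_star[OF inv I1] W_star sym_ext_star[OF inv I1] W_nonneg sp])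
  show "check_W I W (sym_ext star I I1 x) i j \<ge> 0" by (rule check_W_nonneg[of W, OF W_nonneg sp])
qed (rule inv)

text \<open>
  Where the block on \<open>I\<close> fails to be an M-matrix, the density is zero.
\<close>

lemma nn_integral_sym_dens_cong:
  assumes "\<And>x. semipos I (H_mat W (sym_ext star I I1 x)) \<Longrightarrow> f x = g x"
  shows "(\<integral>\<^sup>+x. ennreal (nu_S_dens star I I1 W \<theta> \<eta> (sym_ext star I I1 x)) * f x \<partial>N)
    = (\<integral>\<^sup>+x. ennreal (nu_S_dens star I I1 W \<theta> \<eta> (sym_ext star I I1 x)) * g x \<partial>N)"
proof (rule nn_integral_cong)
  fix x
  show "ennreal (nu_S_dens star I I1 W \<theta> \<eta> (sym_ext star I I1 x)) * f x
    = ennreal (nu_S_dens star I I1 W \<theta> \<eta> (sym_ext star I I1 x)) * g x"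
    using assms[of x] nu_S_dens_eq_0[of I "sym_ext star I I1 x"]
    by (cases "semipos I (H_mat W (sym_ext star I I1 x))") simp_all
qed

text \<open>
  Here \<open>S = A\<close> on \<open>K\<close> is applied for each fixed \<open>\<beta>\<close> on \<open>I\<close>, with the checked parameters.
\<close>

lemma sym_eq_mixed_integral:
  assumes bal: "balanced star K" and dis: "I \<inter> K = {}" and I: "star ` I = I" and K: "star ` K = K"
    and half: "half_of star (I \<union> K) J1" and K1: "half_of star K K1"
    and \<theta>: "\<And>i. \<theta> i > 0" and \<eta>: "\<And>i. \<eta> i \<ge> 0"
  shows "sym_integral star (I \<union> K) J1 W \<theta> \<eta> = mixed_integral I (J1 \<inter> I) K K1 \<theta> \<eta>"
proof -
  have halfI: "half_of star I (J1 \<inter> I)" by (rule half_of_inter[OF inv half I])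
  have half': "half_of star (K \<union> I) J1" using half by (simp add: Un_commute)
  have halfK: "half_of star K (J1 \<inter> K)" by (rule half_of_inter[OF inv half' K])
  show ?thesis
    unfolding sym_integral_union[OF dis I K half \<theta>] mixed_integral_def
    by (intro nn_integral_sym_dens_cong balancedD[OF bal star_matrix_check[OF halfI] \<theta>]
        check_eta_nonneg[of W, OF W_nonneg _ \<eta>] halfK K1)
qed

lemma mixed_integral_half_indep_right:
  assumes bal: "balanced star K" and I1: "half_of star I I1" and K1: "half_of star K K1" and K1': "half_of star K K1'"
    and \<theta>: "\<And>i. \<theta> i > 0" and \<eta>: "\<And>i. \<eta> i \<ge> 0"
  shows "mixed_integral I I1 K K1 \<theta> \<eta> = mixed_integral I I1 K K1' \<theta> \<eta>"
  unfolding mixed_integral_def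
proof (rule nn_integral_sym_dens_cong)
  fix x assume sp: "semipos I (H_mat W (sym_ext star I I1 x))"
  note b = balancedD[OF bal star_matrix_check[OF I1 sp] \<theta> check_eta_nonneg[of W, OF W_nonneg sp \<eta>] K1]
  show "asym_integral star K K1 (check_W I W (sym_ext star I I1 x)) \<theta> (check_eta I W \<eta> (sym_ext star I I1 x))
    = asym_integral star K K1' (check_W I W (sym_ext star I I1 x)) \<theta> (check_eta I W \<eta> (sym_ext star I I1 x))"
    using b[OF K1] b[OF K1'] by simp
qed

text \<open>
  After exchanging the integrations, \<open>S = A\<close> on \<open>I\<close> is applied for each fixed \<open>a\<close> on \<open>K\<close>; the shifted
  parameter \<open>\<eta> + W y\<close> is again nonnegative.
\<close>

lemma mixed_integral_fibrewise:
  assumes bal: "balanced star I" and dis: "I \<inter> K = {}" and I1: "half_of star I I1" and I1': "half_of star I I1'"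
    and K1: "half_of star K K1" and \<theta>: "\<And>i. \<theta> i > 0" and \<eta>: "\<And>i. \<eta> i \<ge> 0"
  shows "mixed_integral I I1 K K1 \<theta> \<eta> = (\<integral>\<^sup>+y. ennreal (split_factor I K K1 \<theta> \<eta> (asym_ext star K K1 y)) *
       asym_integral star I I1' W \<theta> (shift_eta K (exp_star star (asym_ext star K K1 y) \<theta>) \<eta>)
       \<partial>(\<Pi>\<^sub>M i\<in>K1. lborel))"
  unfolding mixed_integral_swap[OF dis I1 K1 \<theta>]
proof (rule nn_integral_cong, rule arg_cong2[where f = "(*)"], rule refl)
  fix y
  show "sym_integral star I I1 W \<theta> (shift_eta K (exp_star star (asym_ext star K K1 y) \<theta>) \<eta>)
    = asym_integral star I I1' W \<theta> (shift_eta K (exp_star star (asym_ext star K K1 y) \<theta>) \<eta>)"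
  proof (rule balancedD[OF bal star_matrix_axioms \<theta> _ I1 I1'])
    show "\<eta> i + mult_vec_on K W (exp_star star (asym_ext star K K1 y) \<theta>) i \<ge> 0" for i
      using \<eta> W_nonneg \<theta> by (intro add_nonneg_nonneg mult_vec_on_nonneg) (auto simp: exp_star_def intro: less_imp_le)
  qed
qed

lemma mixed_eq_asym_integral:
  assumes bal: "balanced star I" and dis: "I \<inter> K = {}" and I: "star ` I = I" and K: "star ` K = K"
    and I1: "half_of star I I1" and half: "half_of star (I \<union> K) J1"
    and \<theta>: "\<And>i. \<theta> i > 0" and \<eta>: "\<And>i. \<eta> i \<ge> 0"
  shows "mixed_integral I I1 K (J1 \<inter> K) \<theta> \<eta> = asym_integral star (I \<union> K) J1 W \<theta> \<eta>"
proof -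
  have half': "half_of star (K \<union> I) J1" using half by (simp add: Un_commute)
  show ?thesis
    unfolding asym_integral_union[OF dis I K half]
    by (rule mixed_integral_fibrewise[OF bal dis I1 half_of_inter[OF inv half I] half_of_inter[OF inv half' K] \<theta> \<eta>])
qed

lemma mixed_integral_half_indep_left:
  assumes bal: "balanced star I" and dis: "I \<inter> K = {}" and I1: "half_of star I I1" and I1': "half_of star I I1'"
    and K1: "half_of star K K1" and \<theta>: "\<And>i. \<theta> i > 0" and \<eta>: "\<And>i. \<eta> i \<ge> 0"
  shows "mixed_integral I I1 K K1 \<theta> \<eta> = mixed_integral I I1' K K1 \<theta> \<eta>"
  using mixed_integral_fibrewise[OF bal dis I1 I1 K1 \<theta> \<eta>] mixed_integral_fibrewise[OF bal dis I1' I1 K1 \<theta> \<eta>] by simp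

end

lemma balanced_union:
  assumes inv: "\<And>i. star (star i) = i" and bI: "balanced star I" and bK: "balanced star K"
    and dis: "I \<inter> K = {}" and I: "star ` I = I" and K: "star ` K = K"
  shows "balanced star (I \<union> K)"
  unfolding balanced_def
proof (intro allI impI)
  fix W and \<theta> \<eta> :: "'a \<Rightarrow> real" and J1 J1'
  assume sm: "star_matrix star W" and \<theta>: "\<forall>i. \<theta> i > 0" and \<eta>: "\<forall>i. \<eta> i \<ge> 0"
    and h: "half_of star (I \<union> K) J1" and h': "half_of star (I \<union> K) J1'"
  interpret star_matrix star W by fact
  have h'': "half_of star (K \<union> I) J1'" using h' by (simp add: Un_commute)
  have "sym_integral star (I \<union> K) J1 W \<theta> \<eta> = mixed_integral I (J1 \<inter> I) K (J1' \<inter> K) \<theta> \<eta>"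
    using \<theta> \<eta> by (intro sym_eq_mixed_integral[OF bK dis I K h half_of_inter[OF inv h'' K]]) auto
  also have "\<dots> = asym_integral star (I \<union> K) J1' W \<theta> \<eta>"
    using \<theta> \<eta> by (intro mixed_eq_asym_integral[OF bI dis I K half_of_inter[OF inv h I] h']) auto
  finally show "sym_integral star (I \<union> K) J1 W \<theta> \<eta> = asym_integral star (I \<union> K) J1' W \<theta> \<eta>" .
qed

section \<open>One-dimensional integrals\<close>

lemma borel_measurable_sinh_cosh [measurable]:
  "(sinh :: real \<Rightarrow> real) \<in> borel_measurable borel" "(cosh :: real \<Rightarrow> real) \<in> borel_measurable borel"
  by (rule borel_measurable_continuous_onI, rule continuous_on_sinh[OF continuous_on_id])
    (rule borel_measurable_continuous_onI, rule continuous_on_cosh[OF continuous_on_id])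

text \<open>
  Substitution on the whole line without any integrability assumption, obtained from the compact case
  by monotone convergence.
\<close>

lemma nn_integral_substitution_range:
  fixes f :: "real \<Rightarrow> ennreal" and g g' :: "real \<Rightarrow> real"
  assumes f[measurable]: "f \<in> borel_measurable borel"
    and deriv: "\<And>x. (g has_real_derivative g' x) (at x)"
    and cont: "continuous_on UNIV g'" and nn: "\<And>x. g' x \<ge> 0"
    and range: "range g = T" and [measurable]: "T \<in> sets borel"
  shows "(\<integral>\<^sup>+x. f x * indicator T x \<partial>lborel) = (\<integral>\<^sup>+x. f (g x) * ennreal (g' x) \<partial>lborel)"
proof -
  have mono: "mono g"
    by (rule monoI, rule DERIV_nonneg_imp_nondecreasing) (use deriv nn in blast)+
  have gc: "continuous_on UNIV g"
    using deriv by (meson DERIV_continuous continuous_at_imp_continuous_on)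
  have [measurable]: "g \<in> borel_measurable borel" "g' \<in> borel_measurable borel"
    using gc cont by (auto intro: borel_measurable_continuous_onI)
  define c where "c n = real (Suc n)" for n
  have c: "c n \<le> c (Suc n)" "0 < c n" for n by (auto simp: c_def)
  have gcm: "g (- c (Suc n)) \<le> g (- c n)" "g (c n) \<le> g (c (Suc n))" for n
    using c by (auto intro!: monoD[OF mono])
  have seg: "(\<integral>\<^sup>+x. f x * indicator {g (- c n)..g (c n)} x \<partial>lborel)
      = (\<integral>\<^sup>+x. f (g x) * ennreal (g' x) * indicator {- c n..c n} x \<partial>lborel)" for n
    by (rule nn_integral_substitution_aux)
      (use deriv nn cont c(2)[of n] in \<open>auto intro: continuous_on_subset\<close>)
  have sup1: "(SUP n. f x * indicator {g (- c n)..g (c n)} x) = f x * indicator T x" for x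
  proof -
    have "(SUP n. indicator {g (- c n)..g (c n)} x) = (indicator T x :: ennreal)"
    proof (cases "x \<in> T")
      case True
      then obtain y where y: "x = g y" using range by blast
      obtain n where n: "\<bar>y\<bar> \<le> real n" using real_arch_simple by blast
      have "x \<in> {g (- c n)..g (c n)}" unfolding y using n by (auto simp: c_def intro!: monoD[OF mono])
      then have "(1::ennreal) \<le> (SUP n. indicator {g (- c n)..g (c n)} x)"
        by (intro SUP_upper2[of n]) auto
      moreover have "(SUP n. indicator {g (- c n)..g (c n)} x) \<le> (1::ennreal)"
        by (intro SUP_least) (auto split: split_indicator)
      ultimately have "(SUP n. indicator {g (- c n)..g (c n)} x) = (1::ennreal)" by (intro antisym)
      then show ?thesis using True by simp
    next
      case False
      have "x \<notin> {g (- c n)..g (c n)}" for n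
      proof
        assume "x \<in> {g (- c n)..g (c n)}"
        then have "g (- c n) \<le> x" "x \<le> g (c n)" by auto
        then obtain y where "g y = x"
          using IVT'[of g "- c n" x "c n"] c(2)[of n] continuous_on_subset[OF gc] by auto
        then show False using False range by blast
      qed
      then show ?thesis using False by simp
    qed
    then show ?thesis by (simp add: SUP_mult_left_ennreal[symmetric])
  qed
  have sup2: "(SUP n. f (g x) * ennreal (g' x) * indicator {- c n..c n} x) = f (g x) * ennreal (g' x)" for x
  proof -
    obtain n where n: "\<bar>x\<bar> \<le> real n" using real_arch_simple by blast
    have "x \<in> {- c n..c n}" using n by (auto simp: c_def)
    then have "(1::ennreal) \<le> (SUP n. indicator {- c n..c n} x)"
      by (intro SUP_upper2[of n]) auto
    moreover have "(SUP n. indicator {- c n..c n} x) \<le> (1::ennreal)"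
      by (intro SUP_least) (auto split: split_indicator)
    ultimately have "(SUP n. indicator {- c n..c n} x) = (1::ennreal)" by (intro antisym)
    then show ?thesis by (simp add: SUP_mult_left_ennreal[symmetric])
  qed
  have "(\<integral>\<^sup>+x. f x * indicator T x \<partial>lborel) = (\<integral>\<^sup>+x. (SUP n. f x * indicator {g (- c n)..g (c n)} x) \<partial>lborel)"
    by (simp add: sup1)
  also have "\<dots> = (SUP n. \<integral>\<^sup>+x. f x * indicator {g (- c n)..g (c n)} x \<partial>lborel)"
  proof (rule nn_integral_monotone_convergence_SUP)
    show "incseq (\<lambda>n x. f x * indicator {g (- c n)..g (c n)} x)"
    proof (rule incseq_SucI, rule le_funI, rule mult_left_mono)
      fix n x show "indicator {g (- c n)..g (c n)} x \<le> (indicator {g (- c (Suc n))..g (c (Suc n))} x :: ennreal)"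
        using gcm[of n] by (auto split: split_indicator)
    qed simp
  qed measurable
  also have "\<dots> = (SUP n. \<integral>\<^sup>+x. f (g x) * ennreal (g' x) * indicator {- c n..c n} x \<partial>lborel)"
    unfolding seg ..
  also have "\<dots> = (\<integral>\<^sup>+x. (SUP n. f (g x) * ennreal (g' x) * indicator {- c n..c n} x) \<partial>lborel)"
  proof (rule nn_integral_monotone_convergence_SUP[symmetric])
    show "incseq (\<lambda>n x. f (g x) * ennreal (g' x) * indicator {- c n..c n} x)"
    proof (rule incseq_SucI, rule le_funI, rule mult_left_mono)
      fix n x show "indicator {- c n..c n} x \<le> (indicator {- c (Suc n)..c (Suc n)} x :: ennreal)"
        using c(1)[of n] by (auto split: split_indicator)
    qed simp
  qed measurable
  finally show ?thesis by (simp add: sup2)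
qed

lemma nn_integral_exp_substitution:
  fixes f :: "real \<Rightarrow> ennreal"
  assumes f: "f \<in> borel_measurable borel" and "k > 0" "m > 0"
  shows "(\<integral>\<^sup>+x. f x * indicator {0<..} x \<partial>lborel) = (\<integral>\<^sup>+w. f (k * exp (m * w)) * ennreal (k * m * exp (m * w)) \<partial>lborel)"
proof (rule nn_integral_substitution_range[OF f])
  show "((\<lambda>w. k * exp (m * w)) has_real_derivative k * m * exp (m * x)) (at x)" for x
    by (auto intro!: derivative_eq_intros)
  show "range (\<lambda>w. k * exp (m * w)) = {0<..}"
  proof (intro equalityI subsetI)
    fix y :: real assume "y \<in> {0<..}"
    then have "y = k * exp (m * (ln (y / k) / m))" using assms by simp
    then show "y \<in> range (\<lambda>w. k * exp (m * w))" by blast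
  qed (use assms in auto)
qed (use assms in \<open>auto intro!: continuous_intros\<close>)

lemma nn_integral_sinh_substitution:
  fixes f :: "real \<Rightarrow> ennreal"
  assumes f: "f \<in> borel_measurable borel" and "k > 0"
  shows "(\<integral>\<^sup>+x. f x \<partial>lborel) = (\<integral>\<^sup>+u. f (k * sinh u) * ennreal (k * cosh u) \<partial>lborel)"
proof -
  have "(\<integral>\<^sup>+x. f x * indicator UNIV x \<partial>lborel) = (\<integral>\<^sup>+u. f (k * sinh u) * ennreal (k * cosh u) \<partial>lborel)"
  proof (rule nn_integral_substitution_range[OF f])
    show "((\<lambda>w. k * sinh w) has_real_derivative k * cosh x) (at x)" for x
      by (auto intro!: derivative_eq_intros)
    show "range (\<lambda>w. k * sinh w) = UNIV"
    proof (intro equalityI subsetI)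
      fix y :: real
      have "y = k * sinh (arsinh (y / k))" using assms by simp
      then show "y \<in> range (\<lambda>w. k * sinh w)" by blast
    qed auto
  qed (use assms in \<open>auto intro!: continuous_intros simp: less_imp_le\<close>)
  then show ?thesis by simp
qed

text \<open>
  Completing the square reduces this to the normalization of a normal density.
\<close>

lemma nn_integral_gaussian:
  fixes k l :: real
  assumes k: "k > 0"
  shows "(\<integral>\<^sup>+z. ennreal (exp (- k * z\<^sup>2 + l * z)) \<partial>lborel) = ennreal (sqrt (pi / k) * exp (l\<^sup>2 / (4 * k)))"
proof -
  define \<sigma> where "\<sigma> = sqrt (1 / (2 * k))"
  have \<sigma>: "\<sigma> > 0" "\<sigma>\<^sup>2 = 1 / (2 * k)" using k by (auto simp: \<sigma>_def)
  interpret prob_space "density lborel (normal_density (l / (2 * k)) \<sigma>)"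
    by (rule prob_space_normal_density[OF \<sigma>(1)])
  have one: "(\<integral>\<^sup>+z. ennreal (normal_density (l / (2 * k)) \<sigma> z) \<partial>lborel) = 1"
    using emeasure_space_1 by (simp add: emeasure_density)
  have eq: "exp (- k * z\<^sup>2 + l * z) = sqrt (pi / k) * exp (l\<^sup>2 / (4 * k)) * normal_density (l / (2 * k)) \<sigma> z" for z
  proof -
    have "- (z - l / (2 * k))\<^sup>2 / (2 * \<sigma>\<^sup>2) = - k * (z - l / (2 * k))\<^sup>2" using k by (simp add: \<sigma>(2))
    also have "\<dots> = - k * z\<^sup>2 + l * z - l\<^sup>2 / (4 * k)" using k by (simp add: power2_eq_square field_simps)
    finally have "normal_density (l / (2 * k)) \<sigma> z = 1 / sqrt (pi / k) * exp (- k * z\<^sup>2 + l * z - l\<^sup>2 / (4 * k))"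
      unfolding normal_density_def by (simp add: \<sigma>(2))
    then show ?thesis using k by (simp add: exp_diff)
  qed
  have "(\<integral>\<^sup>+z. ennreal (exp (- k * z\<^sup>2 + l * z)) \<partial>lborel)
      = (\<integral>\<^sup>+z. ennreal (sqrt (pi / k) * exp (l\<^sup>2 / (4 * k))) * ennreal (normal_density (l / (2 * k)) \<sigma> z) \<partial>lborel)"
    unfolding eq using k by (intro nn_integral_cong ennreal_mult') simp
  also have "\<dots> = ennreal (sqrt (pi / k) * exp (l\<^sup>2 / (4 * k)))"
    by (subst nn_integral_cmult) (simp_all add: one)
  finally show ?thesis .
qed

text \<open>
  The normalization of the reciprocal inverse Gaussian distribution (a gamma distribution if \<open>A = 0\<close>).
  For \<open>A > 0\<close> put \<open>m = sqrt (A \<alpha>)\<close> and substitute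
  \<open>s = sqrt (A / \<alpha>) e\<^bsup>2w\<^esup>\<close>; the exponent becomes \<open>- m (4 (sinh w)\<^sup>2 + 2)\<close>, which is even in \<open>w\<close>. So the
  Jacobian \<open>e\<^sup>w\<close> may be replaced by \<open>cosh w\<close>, and \<open>u = sinh w\<close> gives a Gaussian integral. For \<open>A = 0\<close>
  the substitution \<open>s = r\<^sup>2\<close> gives a Gaussian integral over a half-line.
\<close>

lemma nn_integral_exp_inverse_sqrt:
  fixes \<alpha> A :: real
  assumes \<alpha>: "\<alpha> > 0" and A: "A \<ge> 0"
  shows "(\<integral>\<^sup>+s. ennreal (exp (- \<alpha> * s - A / s) / sqrt s) * indicator {0<..} s \<partial>lborel)
    = ennreal (sqrt (pi / \<alpha>) * exp (- 2 * sqrt (A * \<alpha>)))" (is "?I = _")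
proof (cases "A = 0")
  case True
  have "?I
    = (\<integral>\<^sup>+w. ennreal (exp (- \<alpha> * exp (2 * w))/ sqrt (exp (2 * w))) * ennreal (1 * 2 * exp (2 * w)) \<partial>lborel)"
    using True by (subst nn_integral_exp_substitution[of _ 1 2]) simp_all
  also have "\<dots> = (\<integral>\<^sup>+w. 2 * (ennreal (exp (- \<alpha> * (exp w)\<^sup>2)) * ennreal (1 * 1 * exp (1 * w))) \<partial>lborel)"
  proof (rule nn_integral_cong)
    fix w :: real
    have e: "exp (2 * w) = (exp w)\<^sup>2" by (simp add: power2_eq_square flip: exp_add)
    show "ennreal (exp (- \<alpha> * exp (2 * w)) / sqrt (exp (2 * w))) * ennreal (1 * 2 * exp (2 * w))
      = 2 * (ennreal (exp (- \<alpha> * (exp w)\<^sup>2)) * ennreal (1 * 1 * exp (1 * w)))"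
      unfolding e by (simp add: ennreal_mult'[symmetric] power2_eq_square flip: ennreal_numeral)
  qed
  also have "\<dots> = 2 * (\<integral>\<^sup>+w. ennreal (exp (- \<alpha> * (1 * exp (1 * w))\<^sup>2)) * ennreal (1 * 1 * exp (1 * w)) \<partial>lborel)"
    by (subst nn_integral_cmult) simp_all
  also have "\<dots> = 2 * (\<integral>\<^sup>+s. ennreal (exp (- \<alpha> * s\<^sup>2)) * indicator {0<..} s \<partial>lborel)"
    by (subst nn_integral_exp_substitution[of _ 1 1]) simp_all
  also have "\<dots> = (\<integral>\<^sup>+s. ennreal (exp (- \<alpha> * s\<^sup>2)) * indicator {0<..} s \<partial>lborel)
      + (\<integral>\<^sup>+s. ennreal (exp (- \<alpha> * s\<^sup>2)) * indicator {0<..} (- s) \<partial>lborel)"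
    using nn_integral_real_affine[of "\<lambda>s. ennreal (exp (- \<alpha> * s\<^sup>2)) * indicator {0<..} s" "-1" 0]
    by (simp add: mult_2)
  also have "\<dots> = (\<integral>\<^sup>+s. ennreal (exp (- \<alpha> * s\<^sup>2)) * indicator {0<..} s + ennreal (exp (- \<alpha> * s\<^sup>2)) * indicator {0<..} (- s) \<partial>lborel)"
    by (subst nn_integral_add) simp_all
  also have "\<dots> = (\<integral>\<^sup>+s. ennreal (exp (- \<alpha> * s\<^sup>2 + 0 * s)) \<partial>lborel)"
    by (intro nn_integral_cong_AE eventually_mono[OF AE_lborel_singleton[of 0]])
      (auto split: split_indicator)
  also have "\<dots> = ennreal (sqrt (pi / \<alpha>) * exp (- 2 * sqrt (A * \<alpha>)))"
    using nn_integral_gaussian[OF \<alpha>, of 0] True by simp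
  finally show ?thesis .
next
  case False
  then have A: "A > 0" using A by simp
  define m where "m = sqrt (A * \<alpha>)"
  have m: "m > 0" using A \<alpha> by (simp add: m_def)
  define k where "k = sqrt (A / \<alpha>)"
  have k: "k > 0" using A \<alpha> by (simp add: k_def)
  have ak: "\<alpha> * k = m" using A \<alpha> by (simp add: k_def m_def real_sqrt_divide real_sqrt_mult real_div_sqrt field_simps)
  have Ak: "A / k = m" using A \<alpha> by (simp add: k_def m_def real_sqrt_divide real_sqrt_mult real_div_sqrt field_simps)
  define h where "h w = exp (- m * (4 * (sinh w)\<^sup>2 + 2))" for w :: real
  have ex: "- \<alpha> * (k * exp (2 * w)) - A / (k * exp (2 * w)) = - m * (4 * (sinh w)\<^sup>2 + 2)" for w
  proof -
    have "exp (2 * w) = exp w * exp w" "exp (- (2 * w)) = exp (- w) * exp (- w)" "exp w * exp (- w) = 1"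
      by (simp_all flip: exp_add)
    then have s: "exp (2 * w) + exp (- (2 * w)) = 4 * (sinh w)\<^sup>2 + 2"
      by (simp add: sinh_def power2_eq_square field_simps)
    have "- \<alpha> * (k * exp (2 * w)) - A / (k * exp (2 * w)) = - (\<alpha> * k) * exp (2 * w) - (A / k) * exp (- (2 * w))"
      by (simp add: exp_minus field_simps)
    also have "\<dots> = - m * (exp (2 * w) + exp (- (2 * w)))" unfolding ak Ak by (simp add: algebra_simps)
    finally show ?thesis unfolding s .
  qed
  let ?f = "\<lambda>s. exp (- \<alpha> * s - A / s) / sqrt s"
  let ?l = "\<lambda>w. ennreal (2 * sqrt k * exp w * h w)" and ?l' = "\<lambda>w. ennreal (2 * sqrt k * exp (- w) * h w)"
  let ?C = "ennreal (4 * sqrt k * exp (- 2 * m))" and ?g = "\<lambda>u. ennreal (exp (- (4 * m) * u\<^sup>2 + 0 * u))"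
  let ?X = "\<integral>\<^sup>+w. ?l w \<partial>lborel"
  have "?I
    = (\<integral>\<^sup>+w. ennreal (?f (k * exp (2 * w))) * ennreal (k * 2 * exp (2 * w)) \<partial>lborel)"
    using k by (subst nn_integral_exp_substitution[of _ k 2]) simp_all
  also have "\<dots> = ?X"
  proof (rule nn_integral_cong)
    fix w :: real
    have e: "exp (2 * w) = (exp w)\<^sup>2" by (simp add: power2_eq_square flip: exp_add)
    have "sqrt (k * exp (2 * w)) = sqrt k * exp w" by (simp add: e real_sqrt_mult)
    then have "?f (k * exp (2 * w)) * (k * 2 * exp (2 * w))
      = h w / (sqrt k * exp w) * (sqrt k * sqrt k * 2 * (exp w * exp w))"
      unfolding ex h_def using k by (simp add: e power2_eq_square)
    also have "\<dots> = 2 * sqrt k * exp w * h w" using k by (simp add: field_simps)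
    finally show "ennreal (?f (k * exp (2 * w))) * ennreal (k * 2 * exp (2 * w))
      = ?l w"
      using k by (subst ennreal_mult'[symmetric]) simp_all
  qed
  finally have X: "?I = ?X" .
  have hm[measurable]: "h \<in> borel_measurable borel"
    unfolding h_def by measurable
  (* h is even, so the reflected integral has the same value *)
  have X': "?X = (\<integral>\<^sup>+w. ?l' w \<partial>lborel)"
    by (subst nn_integral_real_affine[of _ "-1" 0]) (simp_all add: h_def)
  have "2 * ?X = (\<integral>\<^sup>+w. ?l w + ?l' w \<partial>lborel)"
  proof (subst nn_integral_add)
    show "2 * ?X = ?X + (\<integral>\<^sup>+w. ?l' w \<partial>lborel)"
      unfolding X'[symmetric] by (rule mult_2)
  qed measurable
  also have "\<dots> = (\<integral>\<^sup>+w. ?C * (?g (1 * sinh w) * ennreal (1 * cosh w)) \<partial>lborel)"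
  proof (rule nn_integral_cong)
    fix w :: real
    have h: "h w = exp (- 2 * m) * exp (- (4 * m) * (sinh w)\<^sup>2)"
    proof -
      have "- m * (4 * (sinh w)\<^sup>2 + 2) = - 2 * m + - (4 * m) * (sinh w)\<^sup>2" by (simp add: algebra_simps)
      then show ?thesis unfolding h_def by (simp only: exp_add)
    qed
    have "?l w + ?l' w
      = ennreal (2 * sqrt k * exp w * h w + 2 * sqrt k * exp (- w) * h w)"
      using k by (intro ennreal_plus[symmetric]) (auto simp: h_def)
    also have "2 * sqrt k * exp w * h w + 2 * sqrt k * exp (- w) * h w = 2 * sqrt k * h w * (exp w + exp (- w))"
      by (simp only: distrib_left mult_ac)
    also have "exp w + exp (- w) = 2 * cosh w" by (simp add: cosh_def)
    also have "2 * sqrt k * h w * (2 * cosh w) = (4 * sqrt k * exp (- 2 * m)) * (exp (- (4 * m) * (sinh w)\<^sup>2) * cosh w)"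
      unfolding h by simp
    also have "ennreal \<dots> = ?C * (ennreal (exp (- (4 * m) * (sinh w)\<^sup>2)) * ennreal (cosh w))"
    proof -
      have "0 \<le> 4 * sqrt k * exp (- 2 * m)" "0 \<le> exp (- (4 * m) * (sinh w)\<^sup>2)" using k by simp_all
      note this[THEN ennreal_mult']
      then show ?thesis by (simp only:)
    qed
    finally show "?l w + ?l' w
      = ?C * (?g (1 * sinh w) * ennreal (1 * cosh w))"
      by (simp only: mult_1 mult_zero_left add_0_right)
  qed
  also have "\<dots> = ?C * (\<integral>\<^sup>+w. ?g (1 * sinh w) * ennreal (1 * cosh w) \<partial>lborel)"
    by (rule nn_integral_cmult) measurable
  also have "\<dots> = ?C * (\<integral>\<^sup>+u. ennreal (exp (- (4 * m) * u\<^sup>2 + 0 * u)) \<partial>lborel)"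
    by (subst nn_integral_sinh_substitution[of "\<lambda>u. ennreal (exp (- (4 * m) * u\<^sup>2 + 0 * u))" 1]) simp_all
  also have "\<dots> = ?C * ennreal (sqrt (pi / (4 * m)))"
    using nn_integral_gaussian[of "4 * m" 0] m by simp
  also have "\<dots> = ennreal (4 * sqrt k * exp (- 2 * m) * sqrt (pi / (4 * m)))"
    using k m by (subst ennreal_mult') simp_all
  also have "4 * sqrt k * exp (- 2 * m) * sqrt (pi / (4 * m)) = 2 * (sqrt (pi / \<alpha>) * exp (- 2 * m))"
  proof -
    have "sqrt k * sqrt (pi / (4 * m)) = sqrt (k * (pi / (4 * m)))" by (simp only: real_sqrt_mult)
    also have "k * (pi / (4 * m)) = (1/4) * (pi / \<alpha>)" unfolding ak[symmetric] using k \<alpha> by (simp add: field_simps)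
    also have "sqrt \<dots> = sqrt (1/4) * sqrt (pi / \<alpha>)" by (rule real_sqrt_mult)
    also have "sqrt (1/4) = 1/2" by (simp add: real_sqrt_divide)
    finally show ?thesis by simp
  qed
  also have "ennreal (2 * (sqrt (pi / \<alpha>) * exp (- 2 * m))) = 2 * ennreal (sqrt (pi / \<alpha>) * exp (- 2 * m))"
    by (subst ennreal_mult') simp_all
  finally have "?X = ennreal (sqrt (pi / \<alpha>) * exp (- 2 * m))"
    by (subst (asm) ennreal_mult_cancel_left) auto
  then show ?thesis unfolding X m_def .
qed

text \<open>
  Linearizing \<open>B\<^sup>2 / k\<close> in \<open>k\<close> at the price of an auxiliary integral.
\<close>

lemma exp_div_sqrt_as_gaussian:
  fixes k B :: real
  assumes "k > 0"
  shows "ennreal (exp (B\<^sup>2 / k) / sqrt k) = ennreal (1 / sqrt pi) * (\<integral>\<^sup>+z. ennreal (exp (- k * z\<^sup>2 + (2 * B) * z)) \<partial>lborel)"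
proof -
  have e: "(2 * B)\<^sup>2 / (4 * k) = B\<^sup>2 / k" by (simp add: power_mult_distrib)
  have "1 / sqrt pi * (sqrt (pi / k) * exp (B\<^sup>2 / k)) = exp (B\<^sup>2 / k) / sqrt k"
    by (simp add: real_sqrt_divide)
  then show ?thesis unfolding nn_integral_gaussian[OF assms] e
    by (subst ennreal_mult'[symmetric]) simp_all
qed

lemma nn_integral_shift_right:
  fixes f :: "real \<Rightarrow> ennreal"
  assumes [measurable]: "f \<in> borel_measurable borel"
  shows "(\<integral>\<^sup>+x. f x * indicator {r<..} x \<partial>lborel) = (\<integral>\<^sup>+x. f (r + x) * indicator {0<..} x \<partial>lborel)"
  by (subst nn_integral_real_affine[of _ 1 r]) (auto intro!: nn_integral_cong split: split_indicator)

text \<open>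
  With \<open>A = ((E + F) / 2)\<^sup>2\<close> and \<open>B = (F - E) / 2\<close> the quotient in the exponent is
  \<open>A / (b - r) - B\<^sup>2 / (b + r)\<close>. Writing \<open>e\<^bsup>B\<^sup>2 / (b + r)\<^esup> / sqrt (b + r)\<close> as a Gaussian integral over \<open>z\<close>
  leaves, after Tonelli, an integral over \<open>s = b - r\<close> of inverse Gaussian type with \<open>\<alpha> = c + z\<^sup>2\<close>.
  The resulting factor \<open>1 / sqrt (c + z\<^sup>2)\<close> is cancelled by the substitution \<open>z = sqrt c sinh u\<close>.
\<close>

lemma sym_pair_integral_normalised:
  fixes r c E F :: real
  assumes r: "r > 0" and c: "c > 0" and EF: "E + F \<ge> 0"
  shows "(\<integral>\<^sup>+b. ennreal (exp (- b * c - (b * E * F + r * F\<^sup>2 / 2 + r * E\<^sup>2 / 2) / (b\<^sup>2 - r\<^sup>2)) / sqrt (b\<^sup>2 - r\<^sup>2)) * indicator {r<..} b \<partial>lborel)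
    = (\<integral>\<^sup>+u. ennreal (exp (- r * c * (1 + 2 * (sinh u)\<^sup>2) - sqrt c * ((E + F) * cosh u + (E - F) * sinh u))) \<partial>lborel)"
proof -
  let ?f = "\<lambda>b. exp (- b * c - (b * E * F + r * F\<^sup>2 / 2 + r * E\<^sup>2 / 2) / (b\<^sup>2 - r\<^sup>2)) / sqrt (b\<^sup>2 - r\<^sup>2)"
  let ?h = "\<lambda>u. exp (- r * c * (1 + 2 * (sinh u)\<^sup>2) - sqrt c * ((E + F) * cosh u + (E - F) * sinh u))"
  define A where "A = ((E + F) / 2)\<^sup>2"
  define B where "B = (F - E) / 2"
  let ?g = "\<lambda>z. exp (- r * c - 2 * r * z\<^sup>2 + (2 * B) * z - (E + F) * sqrt (c + z\<^sup>2)) / sqrt (c + z\<^sup>2)"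
  let ?ig = "\<lambda>z. sqrt (pi / (c + z\<^sup>2)) * exp (- 2 * sqrt (A * (c + z\<^sup>2)))"
  have A: "A \<ge> 0" "sqrt A = (E + F) / 2" using EF by (simp_all add: A_def)
  let ?P = "\<lambda>s z. ennreal (exp (- (s + r) * c - A / s) / sqrt s) * ennreal (1 / sqrt pi) * ennreal (exp (- (s + 2 * r) * z\<^sup>2 + (2 * B) * z)) * indicator {0<..} s"
  have pf: "(b * E * F + r * F\<^sup>2 / 2 + r * E\<^sup>2 / 2) / (b\<^sup>2 - r\<^sup>2) = A / (b - r) - B\<^sup>2 / (b + r)" if "b > r" for b
  proof -
    have nz: "b - r \<noteq> 0" "b + r \<noteq> 0" using that r by auto
    have "A / (b - r) - B\<^sup>2 / (b + r) = (A * (b + r) - B\<^sup>2 * (b - r)) / ((b - r) * (b + r))"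
      using nz by (simp add: diff_frac_eq)
    also have "A * (b + r) - B\<^sup>2 * (b - r) = b * E * F + r * F\<^sup>2 / 2 + r * E\<^sup>2 / 2"
      by (simp add: A_def B_def power2_eq_square field_simps)
    also have "(b - r) * (b + r) = b\<^sup>2 - r\<^sup>2" by (simp add: power2_eq_square algebra_simps)
    finally show ?thesis ..
  qed
  have "(\<integral>\<^sup>+b. ennreal (?f b) * indicator {r<..} b \<partial>lborel)
      = (\<integral>\<^sup>+s. ennreal (?f (r + s)) * indicator {0<..} s \<partial>lborel)"
    by (rule nn_integral_shift_right) measurable
  also have "\<dots> = (\<integral>\<^sup>+s. \<integral>\<^sup>+z. ?P s z \<partial>lborel \<partial>lborel)"
  proof (rule nn_integral_cong)
    fix s :: real
    show "ennreal (?f (r + s)) * indicator {0<..} s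
      = (\<integral>\<^sup>+z. ?P s z \<partial>lborel)"
    proof (cases "s > 0")
      case True
      have k: "s + 2 * r > 0" using True r by simp
      have sq: "sqrt ((r + s)\<^sup>2 - r\<^sup>2) = sqrt s * sqrt (s + 2 * r)"
        unfolding real_sqrt_mult[symmetric] by (simp add: power2_eq_square algebra_simps)
      have ar: "r + s - r = s" "r + s + r = s + 2 * r" by simp_all
      have "exp (- (r + s) * c - ((r + s) * E * F + r * F\<^sup>2 / 2 + r * E\<^sup>2 / 2) / ((r + s)\<^sup>2 - r\<^sup>2))
          = exp ((- (s + r) * c - A / s) + B\<^sup>2 / (s + 2 * r))"
        using pf[of "r + s"] True unfolding ar by (simp add: add.commute)
      also have "\<dots> = exp (- (s + r) * c - A / s) * exp (B\<^sup>2 / (s + 2 * r))" by (rule exp_add)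
      finally have "?f (r + s)
        = (exp (- (s + r) * c - A / s) / sqrt s) * (exp (B\<^sup>2 / (s + 2 * r)) / sqrt (s + 2 * r))"
        unfolding sq by simp
      then have "ennreal (?f (r + s))
        = ennreal (exp (- (s + r) * c - A / s) / sqrt s) * ennreal (exp (B\<^sup>2 / (s + 2 * r)) / sqrt (s + 2 * r))"
        using True by (simp only: ennreal_mult' real_sqrt_ge_zero divide_nonneg_nonneg exp_ge_zero less_imp_le)
      also have "\<dots> = (\<integral>\<^sup>+z. ennreal (exp (- (s + r) * c - A / s) / sqrt s) * ennreal (1 / sqrt pi) * ennreal (exp (- (s + 2 * r) * z\<^sup>2 + (2 * B) * z)) \<partial>lborel)"
        unfolding exp_div_sqrt_as_gaussian[OF k] mult.assoc[symmetric]
        by (rule nn_integral_cmult[symmetric]) measurable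
      finally show ?thesis using True by simp
    qed simp
  qed
  also have "\<dots> = (\<integral>\<^sup>+z. \<integral>\<^sup>+s. ?P s z \<partial>lborel \<partial>lborel)"
    by (rule lborel_pair.Fubini') measurable
  also have "\<dots> = (\<integral>\<^sup>+z. ennreal (?g z) \<partial>lborel)"
  proof (rule nn_integral_cong)
    fix z :: real
    have cz: "c + z\<^sup>2 > 0" using c by (simp add: add_pos_nonneg)
    define D where "D = exp (- r * c - 2 * r * z\<^sup>2 + (2 * B) * z)"
    have "?P s z = ennreal (1 / sqrt pi * D) * (ennreal (exp (- (c + z\<^sup>2) * s - A / s) / sqrt s) * indicator {0<..} s)" for s
    proof (cases "s > 0")
      case True
      have "exp (- (s + r) * c - A / s) * exp (- (s + 2 * r) * z\<^sup>2 + (2 * B) * z) = D * exp (- (c + z\<^sup>2) * s - A / s)"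
        unfolding D_def mult_exp_exp by (rule arg_cong[where f = exp]) (simp add: algebra_simps)
      then have e: "exp (- (s + r) * c - A / s) / sqrt s * (1 / sqrt pi) * exp (- (s + 2 * r) * z\<^sup>2 + (2 * B) * z)
        = 1 / sqrt pi * D * (exp (- (c + z\<^sup>2) * s - A / s) / sqrt s)" by (simp add: mult_ac)
      have n1: "0 \<le> exp (- (s + r) * c - A / s) / sqrt s" "0 \<le> exp (- (s + r) * c - A / s) / sqrt s * (1 / sqrt pi)" "0 \<le> 1 / sqrt pi * D"
        using True by (simp_all add: D_def)
      show ?thesis using True
        by (simp only: ennreal_mult'[OF n1(1), symmetric] ennreal_mult'[OF n1(2), symmetric] e ennreal_mult'[OF n1(3)])
          (simp add: mult_ac)
    qed simp
    then have "(\<integral>\<^sup>+s. ?P s z \<partial>lborel) = (\<integral>\<^sup>+s. ennreal (1 / sqrt pi * D) * (ennreal (exp (- (c + z\<^sup>2) * s - A / s) / sqrt s) * indicator {0<..} s) \<partial>lborel)"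
      by simp
    also have "\<dots> = ennreal (1 / sqrt pi * D) * (\<integral>\<^sup>+s. ennreal (exp (- (c + z\<^sup>2) * s - A / s) / sqrt s) * indicator {0<..} s \<partial>lborel)"
      by (rule nn_integral_cmult) measurable
    also have "\<dots> = ennreal (1 / sqrt pi * D) * ennreal (?ig z)"
      unfolding nn_integral_exp_inverse_sqrt[OF cz A(1)] ..
    also have "\<dots> = ennreal (1 / sqrt pi * D * (?ig z))"
      by (rule ennreal_mult'[symmetric]) (simp add: D_def)
    also have "1 / sqrt pi * D * (?ig z)
      = ?g z"
    proof -
      have "- 2 * sqrt (A * (c + z\<^sup>2)) = - ((E + F) * sqrt (c + z\<^sup>2))" by (simp add: real_sqrt_mult A(2))
      then have "D * exp (- 2 * sqrt (A * (c + z\<^sup>2))) = exp (- r * c - 2 * r * z\<^sup>2 + (2 * B) * z - (E + F) * sqrt (c + z\<^sup>2))"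
        unfolding D_def mult_exp_exp by (intro arg_cong[where f = exp]) simp
      then show ?thesis by (simp add: real_sqrt_divide)
    qed
    finally show "(\<integral>\<^sup>+s. ?P s z \<partial>lborel) = ennreal (?g z)" .
  qed
  also have "\<dots> = (\<integral>\<^sup>+u. ennreal (?g (sqrt c * sinh u)) * ennreal (sqrt c * cosh u) \<partial>lborel)"
    using c by (intro nn_integral_sinh_substitution) simp_all
  also have "\<dots> = (\<integral>\<^sup>+u. ennreal (?h u) \<partial>lborel)"
  proof (rule nn_integral_cong)
    fix u :: real
    have sq: "sqrt (c + (sqrt c * sinh u)\<^sup>2) = sqrt c * cosh u"
    proof -
      have "c + (sqrt c * sinh u)\<^sup>2 = (sqrt c * cosh u)\<^sup>2"
        using c by (simp add: power_mult_distrib cosh_square_eq algebra_simps)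
      then show ?thesis using c by simp
    qed
    have e: "- r * c - 2 * r * (sqrt c * sinh u)\<^sup>2 + (2 * B) * (sqrt c * sinh u) - (E + F) * (sqrt c * cosh u)
      = - r * c * (1 + 2 * (sinh u)\<^sup>2) - sqrt c * ((E + F) * cosh u + (E - F) * sinh u)"
    proof -
      have "2 * B = F - E" by (simp add: B_def)
      show ?thesis unfolding \<open>2 * B = F - E\<close> using c by (simp add: power_mult_distrib algebra_simps)
    qed
    have "sqrt c * cosh u > 0" using c by simp
    then show "ennreal (?g (sqrt c * sinh u)) * ennreal (sqrt c * cosh u)
      = ennreal (?h u)"
      unfolding sq e using c by (subst ennreal_mult'[symmetric]) simp_all
  qed
  finally show ?thesis .
qed

text \<open>
  The masses of \<open>\<nu>\<^sub>S\<close> (in \<open>b = \<beta>\<^sub>i - W\<^sub>i\<^sub>i\<close>) and of \<open>\<nu>\<^sub>A\<close> on a two-point orbit \<open>{i, j}\<close>, up to a common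
  constant. Here \<open>p\<close>, \<open>q\<close> are the two off-diagonal entries, \<open>c = s * t\<close> with \<open>s\<close>, \<open>t\<close> the values of \<open>\<theta>\<close>, and
  \<open>e\<close>, \<open>f\<close> are the values of \<open>\<eta>\<close>.
\<close>

definition "sym_pair_integral p q c e f = (\<integral>\<^sup>+b. ennreal (exp (- b * c - (b * e * f + p * f\<^sup>2 / 2 + q * e\<^sup>2 / 2) / (b\<^sup>2 - p * q)) / sqrt (b\<^sup>2 - p * q)) * indicator {sqrt (p * q)<..} b \<partial>lborel)"
definition "asym_pair_integral p q s t e f = (\<integral>\<^sup>+a. ennreal (exp (- p * (exp a * t)\<^sup>2 / 2 - q * (exp (- a) * s)\<^sup>2 / 2 - f * (exp (- a) * s) - e * (exp a * t))) \<partial>lborel)"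

text \<open>
  Scaling \<open>e\<close> by \<open>l\<close> and \<open>f\<close> by \<open>1 / l\<close>, where \<open>l\<^sup>4 = q / p\<close>, replaces both off-diagonal entries by
  \<open>r = sqrt (p q)\<close>. In the integral over \<open>a\<close> the scaling is a translation.
\<close>

lemma pair_integrals_eq_pos:
  assumes p: "p > 0" and q: "q > 0" and s: "s > 0" and t: "t > 0" and e: "e \<ge> 0" and f: "f \<ge> 0"
  shows "sym_pair_integral p q (s * t) e f = asym_pair_integral p q s t e f"
proof -
  define r where "r = sqrt (p * q)"
  (* chosen such that p l^2 = q / l^2 = r *)
  define l where "l = sqrt (sqrt (q / p))"
  have r: "r > 0" "r\<^sup>2 = p * q" using p q by (simp_all add: r_def)
  have l: "l > 0" "l\<^sup>2 = sqrt (q / p)" using p q by (simp_all add: l_def)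
  have pl: "p * l\<^sup>2 = r" unfolding l(2) r_def using p q by (simp add: real_sqrt_divide real_sqrt_mult field_simps)
  have ql: "q / l\<^sup>2 = r" unfolding l(2) r_def using p q by (simp add: real_sqrt_divide real_sqrt_mult field_simps)
  define c where "c = s * t"
  have c: "c > 0" using s t by (simp add: c_def)
  have e1: "b * e * f + p * f\<^sup>2 / 2 + q * e\<^sup>2 / 2 = b * (e * l) * (f / l) + r * (f / l)\<^sup>2 / 2 + r * (e * l)\<^sup>2 / 2" for b
  proof -
    have "r * (f / l)\<^sup>2 = p * f\<^sup>2" unfolding pl[symmetric] using l(1) by (simp add: power_divide)
    moreover have "r * (e * l)\<^sup>2 = q * e\<^sup>2" unfolding ql[symmetric] using l(1) by (simp add: power_mult_distrib)
    moreover have "b * (e * l) * (f / l) = b * e * f" using l(1) by simp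
    ultimately show ?thesis by simp
  qed
  let ?h = "\<lambda>u. - r * c * (1 + 2 * (sinh u)\<^sup>2) - sqrt c * ((e * l + f / l) * cosh u + (e * l - f / l) * sinh u)"
  let ?k = "\<lambda>a. - p * (exp a * t)\<^sup>2 / 2 - q * (exp (- a) * s)\<^sup>2 / 2 - f * (exp (- a) * s) - e * (exp a * t)"
  have "sym_pair_integral p q (s * t) e f = (\<integral>\<^sup>+u. ennreal (exp (?h u)) \<partial>lborel)"
    unfolding sym_pair_integral_def r_def[symmetric] unfolding e1 r(2)[symmetric] c_def[symmetric]
    using e f l by (intro sym_pair_integral_normalised[OF r(1) c]) auto
  also have "\<dots> = asym_pair_integral p q s t e f"
  proof -
    (* exp (d + u) t = sqrt c l exp u, which balances the two quadratic terms *)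
    define d where "d = ln (sqrt c * l / t)"
    have "asym_pair_integral p q s t e f = (\<integral>\<^sup>+u. ennreal (exp (?k (d + 1 * u))) \<partial>lborel)"
      unfolding asym_pair_integral_def by (subst nn_integral_real_affine[of _ 1 d]) simp_all
    also have "\<dots> = (\<integral>\<^sup>+u. ennreal (exp (?h u)) \<partial>lborel)"
    proof (rule nn_integral_cong, rule arg_cong[where f = ennreal], rule arg_cong[where f = exp])
      fix u :: real
      define x where "x = exp u"
      define y where "y = exp (- u)"
      have xy: "x * y = 1" by (simp add: x_def y_def flip: exp_add)
      have ed: "exp d = sqrt c * l / t" unfolding d_def using c l t by simp
      have t1: "exp (d + 1 * u) * t = sqrt c * l * x" unfolding exp_add ed x_def using t by simp
      have "exp (- (d + 1 * u)) * s = t / (sqrt c * l) * y * s"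
      proof -
        have "exp (- (d + 1 * u)) = exp (- d) * y" by (simp add: y_def flip: exp_add)
        also have "exp (- d) = t / (sqrt c * l)" by (simp add: exp_minus ed)
        finally show ?thesis by simp
      qed
      also have "\<dots> = sqrt c / l * y"
      proof -
        have "t * s = sqrt c * sqrt c" using c by (simp add: c_def mult.commute)
        then show ?thesis using c l by (simp add: field_simps)
      qed
      finally have t2: "exp (- (d + 1 * u)) * s = sqrt c / l * y" .
      have q1: "p * (sqrt c * l * x)\<^sup>2 = r * c * x\<^sup>2" unfolding pl[symmetric] using c by (simp add: power_mult_distrib)
      have q2: "q * (sqrt c / l * y)\<^sup>2 = r * c * y\<^sup>2" unfolding ql[symmetric] using c by (simp add: power_mult_distrib power_divide)
      have sh: "sinh u = (x - y) / 2" and ch: "cosh u = (x + y) / 2" by (simp_all add: sinh_def cosh_def x_def y_def)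
      have sh2: "1 + 2 * (sinh u)\<^sup>2 = (x\<^sup>2 + y\<^sup>2) / 2" unfolding sh using xy by (simp add: power2_eq_square field_simps)
      have "?k (d + 1 * u)
        = - (p * (sqrt c * l * x)\<^sup>2) / 2 - q * (sqrt c / l * y)\<^sup>2 / 2 - f * (sqrt c / l * y) - e * (sqrt c * l * x)"
        unfolding t1 t2 by simp
      also have "\<dots> = - r * c * ((x\<^sup>2 + y\<^sup>2) / 2) - sqrt c * ((e * l) * x + (f / l) * y)"
        unfolding q1 q2 by (simp add: algebra_simps add_divide_distrib)
      also have "\<dots> = ?h u"
      proof -
        define g where "g = f / l"
        show ?thesis unfolding sh2 unfolding sh ch g_def[symmetric] by (simp add: field_simps)
      qed
      finally show "?k (d + 1 * u)
        = ?h u" .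
    qed
    finally show ?thesis ..
  qed
  finally show ?thesis .
qed

lemma nn_integral_top_if_bounded_below:
  fixes g :: "real \<Rightarrow> ennreal"
  assumes c: "c > 0" and g: "\<And>x. x \<le> 0 \<Longrightarrow> g x \<ge> ennreal c"
  shows "(\<integral>\<^sup>+x. g x \<partial>lborel) = \<infinity>"
proof -
  have inf: "emeasure lborel {..0::real} = \<infinity>"
  proof (rule ccontr)
    assume "emeasure lborel {..0::real} \<noteq> \<infinity>"
    (* the interval from - n to 0 is already too long *)
    then obtain n where n: "emeasure lborel {..0::real} < of_nat n"
      using ennreal_Ex_less_of_nat by (auto simp: less_top)
    have "emeasure lborel {- real n..0} \<le> emeasure lborel {..0::real}" by (rule emeasure_mono) auto
    then show False using n by (simp add: ennreal_of_nat_eq_real_of_nat)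
  qed
  have "ennreal c * emeasure lborel {..0::real} = (\<integral>\<^sup>+x. ennreal c * indicator {..0} (x::real) \<partial>lborel)"
    by (subst nn_integral_cmult_indicator) simp_all
  also have "\<dots> \<le> (\<integral>\<^sup>+x. g x \<partial>lborel)"
    using g by (intro nn_integral_mono) (auto split: split_indicator)
  finally have "ennreal c * \<infinity> \<le> (\<integral>\<^sup>+x. g x \<partial>lborel)" unfolding inf .
  moreover have "ennreal c * \<infinity> = \<infinity>" using c by (simp add: ennreal_mult_top)
  ultimately show ?thesis by (simp add: top_unique)
qed

text \<open>
  For \<open>f > 0\<close> the substitution \<open>b = (f / t) e\<^sup>w\<close>, \<open>w = - a\<close>, matches the two integrals. For \<open>f = 0\<close> both
  are infinite: one behaves like the integral of \<open>1 / b\<close> at \<open>0\<close>, the other has an integrand bounded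
  below on a half-line.
\<close>

lemma pair_integrals_eq_zero:
  assumes p: "p \<ge> 0" and s: "s > 0" and t: "t > 0" and e: "e \<ge> 0" and f: "f \<ge> 0"
  shows "sym_pair_integral p 0 (s * t) e f = asym_pair_integral p 0 s t e f"
proof (cases "f = 0")
  case False
  then have f: "f > 0" using f by simp
  have "sym_pair_integral p 0 (s * t) e f = (\<integral>\<^sup>+b. ennreal (exp (- b * (s * t) - (b * e * f + p * f\<^sup>2 / 2) / b\<^sup>2) / b) * indicator {0<..} b \<partial>lborel)"
    unfolding sym_pair_integral_def by (auto intro!: nn_integral_cong split: split_indicator)
  also have "\<dots> = (\<integral>\<^sup>+w. ennreal (exp (- (f / t * exp (1 * w)) * (s * t) - ((f / t * exp (1 * w)) * e * f + p * f\<^sup>2 / 2) / (f / t * exp (1 * w))\<^sup>2) / (f / t * exp (1 * w)))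
      * ennreal (f / t * 1 * exp (1 * w)) \<partial>lborel)"
    using f t by (intro nn_integral_exp_substitution) auto
  also have "\<dots> = (\<integral>\<^sup>+w. ennreal (exp (- p * (exp (- w) * t)\<^sup>2 / 2 - f * (exp w * s) - e * (exp (- w) * t))) \<partial>lborel)"
  proof (rule nn_integral_cong)
    fix w :: real
    define b where "b = f / t * exp w"
    have b: "b > 0" using f t by (simp add: b_def)
    have fb: "f / b = exp (- w) * t" using f t by (simp add: b_def exp_minus field_simps)
    have bs: "b * (s * t) = f * (exp w * s)" using t by (simp add: b_def)
    have "(b * e * f + p * f\<^sup>2 / 2) / b\<^sup>2 = e * (f / b) + p * (f / b)\<^sup>2 / 2"
      using b by (simp add: power2_eq_square add_divide_distrib)
    then have "- b * (s * t) - (b * e * f + p * f\<^sup>2 / 2) / b\<^sup>2 = - p * (exp (- w) * t)\<^sup>2 / 2 - f * (exp w * s) - e * (exp (- w) * t)"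
      using bs unfolding fb by simp
    then show "ennreal (exp (- (f / t * exp (1 * w)) * (s * t) - ((f / t * exp (1 * w)) * e * f + p * f\<^sup>2 / 2) / (f / t * exp (1 * w))\<^sup>2) / (f / t * exp (1 * w)))
      * ennreal (f / t * 1 * exp (1 * w)) = ennreal (exp (- p * (exp (- w) * t)\<^sup>2 / 2 - f * (exp w * s) - e * (exp (- w) * t)))"
      using b unfolding mult_1 mult_1_right b_def[symmetric] by (subst ennreal_mult'[symmetric]) simp_all
  qed
  also have "\<dots> = asym_pair_integral p 0 s t e f"
    unfolding asym_pair_integral_def by (subst nn_integral_real_affine[of _ "-1" 0]) simp_all
  finally show ?thesis .
next
  case True
  have "sym_pair_integral p 0 (s * t) e f = (\<integral>\<^sup>+b. ennreal (exp (- b * (s * t)) / b) * indicator {0<..} b \<partial>lborel)"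
    unfolding sym_pair_integral_def True by (auto intro!: nn_integral_cong split: split_indicator)
  also have "\<dots> = (\<integral>\<^sup>+w. ennreal (exp (- (1 * exp (1 * w)) * (s * t)) / (1 * exp (1 * w))) * ennreal (1 * 1 * exp (1 * w)) \<partial>lborel)"
    by (rule nn_integral_exp_substitution) auto
  also have "\<dots> = \<infinity>"
  proof (rule nn_integral_top_if_bounded_below)
    show "ennreal (exp (- (1 * exp (1 * x)) * (s * t)) / (1 * exp (1 * x))) * ennreal (1 * 1 * exp (1 * x)) \<ge> ennreal (exp (- (s * t)))" if "x \<le> 0" for x
    proof -
      have "exp x \<le> 1" using that by simp
      then have "exp x * (s * t) \<le> s * t" using s t by (simp add: mult_le_cancel_right1)
      then show ?thesis by (subst ennreal_mult'[symmetric]) simp_all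
    qed
  qed simp
  also have "\<infinity> = asym_pair_integral p 0 s t e f"
    unfolding asym_pair_integral_def True
  proof (rule nn_integral_top_if_bounded_below[symmetric])
    show "ennreal (exp (- p * (exp x * t)\<^sup>2 / 2 - 0 * (exp (- x) * s)\<^sup>2 / 2 - 0 * (exp (- x) * s) - e * (exp x * t)))
      \<ge> ennreal (exp (- p * t\<^sup>2 / 2 - e * t))" if "x \<le> 0" for x
    proof -
      have 1: "exp x * t \<le> t" using that t by simp
      then have 2: "(exp x * t)\<^sup>2 \<le> t\<^sup>2" using t by (intro power_mono) auto
      have "p * (exp x * t)\<^sup>2 \<le> p * t\<^sup>2" "e * (exp x * t) \<le> e * t"
        using 1 2 p e by (auto intro!: mult_left_mono)
      then show ?thesis by (intro ennreal_leI) simp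
    qed
  qed simp
  finally show ?thesis .
qed

lemma asym_pair_integral_swap: "asym_pair_integral p q s t e f = asym_pair_integral q p t s f e"
proof -
  have "asym_pair_integral q p t s f e = (\<integral>\<^sup>+a. ennreal (exp (- q * (exp (- a) * s)\<^sup>2 / 2 - p * (exp a * t)\<^sup>2 / 2 - e * (exp a * t) - f * (exp (- a) * s))) \<partial>lborel)"
    unfolding asym_pair_integral_def by (subst nn_integral_real_affine[of _ "-1" 0]) simp_all
  also have "\<dots> = asym_pair_integral p q s t e f"
    unfolding asym_pair_integral_def by (intro nn_integral_cong arg_cong[where f = ennreal] arg_cong[where f = exp]) simp
  finally show ?thesis ..
qed

lemma sym_pair_integral_swap: "sym_pair_integral p q c e f = sym_pair_integral q p c f e"
  unfolding sym_pair_integral_def by (simp add: algebra_simps)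

lemma pair_integrals_eq:
  assumes p: "p \<ge> 0" and q: "q \<ge> 0" and s: "s > 0" and t: "t > 0" and e: "e \<ge> 0" and f: "f \<ge> 0"
  shows "sym_pair_integral p q (s * t) e f = asym_pair_integral p q s t e f"
proof -
  consider "p > 0" "q > 0" | "q = 0" | "p = 0" using p q by linarith
  then show ?thesis
  proof cases
    case 1 then show ?thesis using pair_integrals_eq_pos s t e f by blast
  next
    case 2 then show ?thesis using pair_integrals_eq_zero[OF p s t e f] by simp
  next
    case 3
    have "sym_pair_integral p q (s * t) e f = sym_pair_integral q p (t * s) f e" by (simp add: sym_pair_integral_swap[of p] mult.commute)
    also have "\<dots> = asym_pair_integral q p t s f e" using 3 pair_integrals_eq_zero[OF q t s f e] by simp
    finally show ?thesis by (simp add: asym_pair_integral_swap[of p])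
  qed
qed

section \<open>Single orbits\<close>

lemma balanced_empty: "balanced star {}"
proof -
  have e: "half_of star {} J1 \<Longrightarrow> J1 = {}" for J1 by (auto simp: half_of_def)
  have f: "fixed_pts star {} = {}" by (simp add: fixed_pts_def)
  show ?thesis unfolding balanced_def sym_integral_def asym_integral_def
    by (auto dest!: e simp: f nu_dens_empty space_PiM)
qed

lemma semipos_singleton: "semipos {i} A \<longleftrightarrow> A i i > 0"
proof
  assume "A i i > 0"
  then show "semipos {i} A" by (auto simp: semipos_def mult_vec_on_def intro!: exI[of _ "\<lambda>_. 1"])
qed (auto simp: semipos_def mult_vec_on_def zero_less_mult_iff)

lemma sym_dens_fixed_point:
  fixes W :: "'v::finite \<Rightarrow> 'v \<Rightarrow> real"
  assumes W: "\<And>i j. W i j \<ge> 0" and fx: "star i = i"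
  shows "nu_S_dens star {i} {} W \<theta> \<eta> \<beta> =
    \<theta> i / sqrt (2 * pi) * exp (\<theta> i * \<eta> i) *
     (exp (- ((\<theta> i)\<^sup>2 / 2) * (\<beta> i - W i i) - ((\<eta> i)\<^sup>2 / 2) / (\<beta> i - W i i)) / sqrt (\<beta> i - W i i)) * indicator {W i i<..} (\<beta> i)"
proof (cases "\<beta> i > W i i")
  case True
  then have pos: "pos_on {i} (H_mat W \<beta>)"
    unfolding pos_on_iff_semipos[of W, OF W] semipos_singleton by (simp add: H_mat_def)
  have G: "G_mat {i} W \<beta> i i = 1 / (\<beta> i - W i i)"
    unfolding G_mat_def
    by (rule inv_on_eq[where B = "\<lambda>_ _. 1 / (\<beta> i - W i i)"]) (use True in \<open>auto simp: is_inv_on_def H_mat_def\<close>)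
  have fp: "fixed_pts star {i} = {i}" using fx by (auto simp: fixed_pts_def)
  have ex: "- (1/2) * pairing star {i} \<theta> (mult_vec_on {i} (H_mat W \<beta>) \<theta>)
     - (1/2) * pairing star {i} \<eta> (mult_vec_on {i} (G_mat {i} W \<beta>) \<eta>) + pairing star {i} \<theta> \<eta>
    = \<theta> i * \<eta> i + (- ((\<theta> i)\<^sup>2 / 2) * (\<beta> i - W i i) - ((\<eta> i)\<^sup>2 / 2) / (\<beta> i - W i i))"
    using fx by (simp add: pairing_def mult_vec_on_def G H_mat_def power2_eq_square)
  show ?thesis
    unfolding nu_S_dens_def ex exp_add using True pos
    by (simp add: fp det_on_singleton H_mat_def)
next
  case False
  then have "\<not> pos_on {i} (H_mat W \<beta>)"
    unfolding pos_on_iff_semipos[of W, OF W] semipos_singleton by (simp add: H_mat_def)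
  then show ?thesis using False by (simp add: nu_S_dens_def)
qed

text \<open>
  On the side of \<open>\<nu>\<^sub>A\<close> the only antisymmetric vector is \<open>0\<close>, so its mass is \<open>1\<close>.
\<close>

lemma balanced_fixed_point:
  fixes star :: "'v::finite \<Rightarrow> 'v"
  assumes fx: "star i = i"
  shows "balanced star {i}"
  unfolding balanced_def
proof (intro allI impI)
  fix W and \<theta> \<eta> :: "'v \<Rightarrow> real" and J1 J1'
  assume sm: "star_matrix star W" and \<theta>: "\<forall>i. \<theta> i > 0" and \<eta>: "\<forall>i. \<eta> i \<ge> 0"
    and h: "half_of star {i} J1" and h': "half_of star {i} J1'"
  interpret star_matrix star W by fact
  interpret product_sigma_finite "\<lambda>_::'v. lborel :: real measure" by standard
  have fp: "fixed_pts star {i} = {i}" using fx by (auto simp: fixed_pts_def)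
  have J1: "J1 = {}" "J1' = {}" using h h' unfolding half_of_def fp by auto
  define t where "t = \<theta> i"
  define e where "e = \<eta> i"
  define m where "m = W i i"
  have te: "t > 0" "e \<ge> 0" using \<theta> \<eta> by (auto simp: t_def e_def)
  let ?d = "\<lambda>s. exp (- (t\<^sup>2 / 2) * s - (e\<^sup>2 / 2) / s) / sqrt s"
  let ?f = "\<lambda>b. t / sqrt (2 * pi) * exp (t * e) * (?d (b - m)) * indicator {m<..} b"
  have "sym_integral star {i} J1 W \<theta> \<eta> = (\<integral>\<^sup>+x. ennreal (?f (x i)) \<partial>(\<Pi>\<^sub>M i\<in>{i}. lborel))"
    unfolding sym_integral_def J1 fp Un_empty_right sym_dens_fixed_point[of W star i, OF W_nonneg fx]
    by (simp add: sym_ext_def fp t_def e_def m_def)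
  also have "\<dots> = (\<integral>\<^sup>+b. ennreal (?f b) \<partial>lborel)"
    by (rule product_nn_integral_singleton) measurable
  also have "\<dots> = (\<integral>\<^sup>+b. ennreal (t / sqrt (2 * pi) * exp (t * e)) * (ennreal (?d (b - m)) * indicator {m<..} b) \<partial>lborel)"
    using te by (intro nn_integral_cong) (auto simp: ennreal_mult'[symmetric] split: split_indicator)
  also have "\<dots> = ennreal (t / sqrt (2 * pi) * exp (t * e)) * (\<integral>\<^sup>+b. ennreal (?d (b - m)) * indicator {m<..} b \<partial>lborel)"
    by (rule nn_integral_cmult) measurable
  also have "(\<integral>\<^sup>+b. ennreal (?d (b - m)) * indicator {m<..} b \<partial>lborel)
     = (\<integral>\<^sup>+s. ennreal (?d (m + s - m)) * indicator {0<..} s \<partial>lborel)"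
    by (rule nn_integral_shift_right) measurable
  also have "\<dots> = (\<integral>\<^sup>+s. ennreal (?d s) * indicator {0<..} s \<partial>lborel)"
    unfolding add_diff_cancel_left' ..
  also have "\<dots> = ennreal (sqrt (pi / (t\<^sup>2 / 2)) * exp (- 2 * sqrt ((e\<^sup>2 / 2) * (t\<^sup>2 / 2))))"
    using te by (intro nn_integral_exp_inverse_sqrt) auto
  also have "sqrt (pi / (t\<^sup>2 / 2)) = sqrt (2 * pi) / t" using te by (simp add: real_sqrt_divide real_sqrt_mult)
  also have "sqrt ((e\<^sup>2 / 2) * (t\<^sup>2 / 2)) = t * e / 2"
  proof -
    have "(e\<^sup>2 / 2) * (t\<^sup>2 / 2) = (t * e / 2)\<^sup>2" by (simp add: power2_eq_square)
    then show ?thesis using te by simp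
  qed
  also have "ennreal (t / sqrt (2 * pi) * exp (t * e)) * ennreal (sqrt (2 * pi) / t * exp (- 2 * (t * e / 2))) = 1"
    using te by (subst ennreal_mult'[symmetric]) (simp_all add: exp_minus field_simps)
  finally have "sym_integral star {i} J1 W \<theta> \<eta> = 1" .
  moreover have "asym_integral star {i} J1' W \<theta> \<eta> = 1"
    unfolding asym_integral_def J1 nu_A_dens_def
    using fx by (simp add: pairing_def mult_vec_on_def exp_star_def asym_ext_def fp space_PiM)
  ultimately show "sym_integral star {i} J1 W \<theta> \<eta> = asym_integral star {i} J1' W \<theta> \<eta>" by simp
qed

text \<open>
  If \<open>b > sqrt (p q)\<close>, the vector \<open>(b + p, b + q)\<close> is a witness, since both entries of its image
  equal \<open>b\<^sup>2 - p q\<close>.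
\<close>

lemma semipos_pair:
  fixes i j :: "'v::finite"
  assumes ij: "i \<noteq> j" and p: "p \<ge> 0" and q: "q \<ge> 0"
    and H: "H i i = b" "H j j = b" "H i j = - p" "H j i = - q"
  shows "semipos {i, j} H \<longleftrightarrow> b > sqrt (p * q)"
proof
  assume "semipos {i, j} H"
  then obtain x where x: "x i > 0" "x j > 0" "b * x i - p * x j > 0" "b * x j - q * x i > 0"
    unfolding semipos_def mult_vec_on_def using ij by (auto simp: H)
  have b: "b > 0"
  proof -
    have "b * x i > 0" using x p by (smt (verit) mult_nonneg_nonneg)
    then show ?thesis using x by (simp add: zero_less_mult_iff)
  qed
  have "p * q * (x i * x j) = (p * x j) * (q * x i)" by simp
  also have "\<dots> \<le> (p * x j) * (b * x j)" using x p by (intro mult_left_mono) auto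
  also have "\<dots> < (b * x i) * (b * x j)" using x b by (intro mult_strict_right_mono) auto
  also have "\<dots> = b\<^sup>2 * (x i * x j)" by (simp add: power2_eq_square)
  finally have "p * q < b\<^sup>2" using x by (simp add: mult_less_cancel_right)
  then have "sqrt (p * q) < sqrt (b\<^sup>2)" by (rule real_sqrt_less_mono)
  then show "b > sqrt (p * q)" using b by simp
next
  assume b: "b > sqrt (p * q)"
  have b0: "b > 0" using b p q by (smt (verit) real_sqrt_ge_zero mult_nonneg_nonneg)
  have "(sqrt (p * q))\<^sup>2 < b\<^sup>2" using b p q by (intro power_strict_mono) auto
  then have b2: "p * q < b * b" using p q by (simp add: power2_eq_square)
  show "semipos {i, j} H"
    unfolding semipos_def mult_vec_on_def using ij b0 p q b2
    by (intro exI[of _ "\<lambda>k. if k = i then b + p else b + q"]) (auto simp: H algebra_simps)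
qed

lemma det_on_pair:
  fixes i j :: "'v::finite"
  assumes ij: "i \<noteq> j"
  shows "det_on {i, j} H = H i i * H j j - H i j * H j i"
proof -
  have perms: "{p. p permutes {i, j}} = {id, Transposition.transpose i j}" 
    by (auto simp: permutes_doubleton_iff)
  have ne: "id \<noteq> Transposition.transpose i j" using ij by (metis id_apply transpose_apply_first)
  show ?thesis unfolding det_on_def perms using ij ne
    by (simp add: sign_swap_id sign_id)
qed

lemma half_of_pair:
  assumes ne: "star i \<noteq> i" and inv: "\<And>i. star (star i) = i" and h: "half_of star {i, star i} J1"
  shows "J1 = {i} \<or> J1 = {star i}" "fixed_pts star {i, star i} = {}"
proof -
  show f: "fixed_pts star {i, star i} = {}" using ne inv by (auto simp: fixed_pts_def)
  have *: "{i, star i} = J1 \<union> star ` J1" "J1 \<inter> star ` J1 = {}" using h unfolding half_of_def f by auto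
  then have "J1 \<subseteq> {i, star i}" by blast
  moreover have "J1 \<noteq> {}" using *(1) by auto
  moreover have "J1 \<noteq> {i, star i}" using *(2) by auto
  ultimately show "J1 = {i} \<or> J1 = {star i}" by blast
qed

lemma sym_dens_pair:
  fixes W :: "'v::finite \<Rightarrow> 'v \<Rightarrow> real" and \<theta> \<eta> :: "'v \<Rightarrow> real"
  assumes sm: "star_matrix star W" and ne: "star i \<noteq> i" and h: "half_of star {i, star i} J1"
    and \<beta>: "\<beta> i = B" "\<beta> (star i) = B"
  defines "j \<equiv> star i" 
  defines "p \<equiv> W i j" and "q \<equiv> W j i" and "b \<equiv> B - W i i" and "e \<equiv> \<eta> i" and "f \<equiv> \<eta> j" and "s \<equiv> \<theta> i" and "t \<equiv> \<theta> j"
  shows "nu_S_dens star {i, star i} J1 W \<theta> \<eta> \<beta> =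
    1 / sqrt (2 * pi) * exp (p * t\<^sup>2 / 2 + q * s\<^sup>2 / 2 + f * s + e * t) *
     (exp (- b * (s * t) - (b * e * f + p * f\<^sup>2 / 2 + q * e\<^sup>2 / 2) / (b\<^sup>2 - p * q)) / sqrt (b\<^sup>2 - p * q)) * indicator {sqrt (p * q)<..} b"
proof -
  interpret star_matrix star W by fact
  have sj: "star j = i" by (simp add: j_def inv)
  have ij: "i \<noteq> j" using ne by (simp add: j_def)
  have pq: "p \<ge> 0" "q \<ge> 0" by (simp_all add: p_def q_def W_nonneg)
  have Wjj: "W j j = W i i" using W_star[of i i] by (simp add: j_def)
  have H: "H_mat W \<beta> i i = b" "H_mat W \<beta> j j = b" "H_mat W \<beta> i j = - p" "H_mat W \<beta> j i = - q"
    using ij \<beta> by (simp_all add: H_mat_def b_def p_def q_def Wjj j_def[symmetric])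
  have pos: "pos_on {i, j} (H_mat W \<beta>) \<longleftrightarrow> b > sqrt (p * q)"
    unfolding pos_on_iff_semipos[of W, OF W_nonneg] by (rule semipos_pair[OF ij pq H])
  have fp: "fixed_pts star {i, j} = {}" and J1: "card J1 = 1"
    using half_of_pair[OF ne inv h] by (auto simp: j_def)
  show ?thesis
  proof (cases "b > sqrt (p * q)")
    case True
    have "(sqrt (p * q))\<^sup>2 < b\<^sup>2" using True pq by (intro power_strict_mono) auto
    then have D: "b\<^sup>2 - p * q > 0" using pq by simp
    define D where "D = b\<^sup>2 - p * q"
    have Dp: "D > 0" and Db: "b * b - p * q = D" using D by (simp_all add: D_def power2_eq_square)
    have inv2: "is_inv_on {i, j} (H_mat W \<beta>) (\<lambda>k l. if k = l then b / D else if k = i then p / D else q / D)"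
      unfolding is_inv_on_def using ij Dp Db H
      by (auto simp: diff_divide_distrib[symmetric] mult.commute)
    have G: "G_mat {i, j} W \<beta> k l = (if k = l then b / D else if k = i then p / D else q / D)" if "k \<in> {i, j}" "l \<in> {i, j}" for k l
      unfolding G_mat_def by (rule inv_on_eq[OF _ inv2 that]) simp
    have det: "det_on {i, j} (H_mat W \<beta>) = D" unfolding det_on_pair[OF ij] H using Db by simp
    have 1: "pairing star {i, j} \<theta> (mult_vec_on {i, j} (H_mat W \<beta>) \<theta>) = 2 * b * (s * t) - p * t\<^sup>2 - q * s\<^sup>2"
      using ij by (simp add: pairing_def mult_vec_on_def H sj j_def[symmetric] s_def t_def power2_eq_square algebra_simps)
    have 2: "pairing star {i, j} \<eta> (mult_vec_on {i, j} (G_mat {i, j} W \<beta>) \<eta>) = (2 * b * e * f + p * f\<^sup>2 + q * e\<^sup>2) / D"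
      using ij by (simp add: pairing_def mult_vec_on_def G sj j_def[symmetric] e_def f_def power2_eq_square algebra_simps add_divide_distrib)
    have 3: "pairing star {i, j} \<theta> \<eta> = f * s + e * t"
      using ij by (simp add: pairing_def sj j_def[symmetric] e_def f_def s_def t_def)
    have ex: "- (1/2) * pairing star {i, j} \<theta> (mult_vec_on {i, j} (H_mat W \<beta>) \<theta>)
       - (1/2) * pairing star {i, j} \<eta> (mult_vec_on {i, j} (G_mat {i, j} W \<beta>) \<eta>) + pairing star {i, j} \<theta> \<eta>
      = (p * t\<^sup>2 / 2 + q * s\<^sup>2 / 2 + f * s + e * t) + (- b * (s * t) - (b * e * f + p * f\<^sup>2 / 2 + q * e\<^sup>2 / 2) / D)"
      unfolding 1 2 3 by (simp add: field_simps)
    show ?thesis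
      unfolding nu_S_dens_def j_def[symmetric] ex exp_add[of "p * t\<^sup>2 / 2 + q * s\<^sup>2 / 2 + f * s + e * t"] det fp D_def[symmetric]
      using True pos J1 by simp
  next
    case False
    then show ?thesis using pos by (simp add: nu_S_dens_def j_def[symmetric])
  qed
qed

lemma asym_dens_pair:
  fixes W :: "'v::finite \<Rightarrow> 'v \<Rightarrow> real" and \<theta> \<eta> :: "'v \<Rightarrow> real"
  assumes sm: "star_matrix star W" and ne: "star i \<noteq> i" and h: "half_of star {i, star i} J1"
    and a: "a i = x" "a (star i) = - x"
  defines "j \<equiv> star i" 
  defines "p \<equiv> W i j" and "q \<equiv> W j i" and "e \<equiv> \<eta> i" and "f \<equiv> \<eta> j" and "s \<equiv> \<theta> i" and "t \<equiv> \<theta> j"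
  shows "nu_A_dens star {i, star i} J1 W \<theta> \<eta> a =
    1 / sqrt (2 * pi) * exp (p * t\<^sup>2 / 2 + q * s\<^sup>2 / 2 + f * s + e * t) *
    exp (- p * (exp x * t)\<^sup>2 / 2 - q * (exp (- x) * s)\<^sup>2 / 2 - f * (exp (- x) * s) - e * (exp x * t))"
proof -
  interpret star_matrix star W by fact
  have sj: "star j = i" by (simp add: j_def inv)
  have ij: "i \<noteq> j" using ne by (simp add: j_def)
  have Wjj: "W j j = W i i" using W_star[of i i] by (simp add: j_def)
  define m where "m = W i i"
  have J1: "card J1 = 1"
    using half_of_pair[OF ne inv h] by auto
  define y where "y = exp_star star a \<theta>"
  have y: "y i = exp (- x) * s" "y j = exp x * t" using a by (simp_all add: y_def exp_star_def sj s_def t_def j_def[symmetric])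
  have xx: "exp x * exp (- x) = 1" by (simp flip: exp_add)
  have yy: "y i * y j = s * t" unfolding y using xx by (simp add: mult_ac)
  have quad: "pairing star {i, j} z (mult_vec_on {i, j} W z) = 2 * m * (z i * z j) + p * (z j)\<^sup>2 + q * (z i)\<^sup>2" for z
    using ij by (simp add: pairing_def mult_vec_on_def sj j_def[symmetric] Wjj m_def p_def q_def power2_eq_square algebra_simps)
  have lin: "pairing star {i, j} \<eta> (\<lambda>k. y k - \<theta> k) = f * (y i - s) + e * (y j - t)"
    using ij by (simp add: pairing_def sj j_def[symmetric] e_def f_def s_def t_def)
  have "- (1/2) * pairing star {i, j} y (mult_vec_on {i, j} W y) + (1/2) * pairing star {i, j} \<theta> (mult_vec_on {i, j} W \<theta>)
      - pairing star {i, j} \<eta> (\<lambda>k. y k - \<theta> k)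
    = (p * t\<^sup>2 / 2 + q * s\<^sup>2 / 2 + f * s + e * t) + (- p * (y j)\<^sup>2 / 2 - q * (y i)\<^sup>2 / 2 - f * y i - e * y j)"
    unfolding quad lin yy by (simp add: s_def t_def field_simps)
  then show ?thesis
    unfolding nu_A_dens_def j_def[symmetric] y_def[symmetric] y[symmetric] mult.assoc exp_add[symmetric]
    using J1 by simp
qed

text \<open>
  The free coordinate may sit at either point of the orbit. For \<open>\<nu>\<^sub>S\<close> this changes nothing; for \<open>\<nu>\<^sub>A\<close> it
  changes the sign of \<open>a\<close>, which is undone by reflecting the real line.
\<close>

lemma balanced_pair:
  fixes star :: "'v::finite \<Rightarrow> 'v"
  assumes inv: "\<And>i. star (star i) = i" and ne: "star i \<noteq> i"
  shows "balanced star {i, star i}"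
  unfolding balanced_def
proof (intro allI impI)
  fix W and \<theta> \<eta> :: "'v \<Rightarrow> real" and J1 J1'
  assume sm: "star_matrix star W" and \<theta>: "\<forall>i. \<theta> i > 0" and \<eta>: "\<forall>i. \<eta> i \<ge> 0"
    and h: "half_of star {i, star i} J1" and h': "half_of star {i, star i} J1'"
  interpret star_matrix star W by fact
  interpret product_sigma_finite "\<lambda>_::'v. lborel :: real measure" by standard
  define j where "j = star i"
  have sj: "star j = i" by (simp add: j_def inv)
  have ij: "i \<noteq> j" using ne by (simp add: j_def)
  have fp: "fixed_pts star {i, star i} = {}" using half_of_pair[OF ne inv h] by simp
  define p q m where "p = W i j" and "q = W j i" and "m = W i i"
  define e f s t where "e = \<eta> i" and "f = \<eta> j" and "s = \<theta> i" and "t = \<theta> j"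
  have nn: "p \<ge> 0" "q \<ge> 0" "s > 0" "t > 0" "e \<ge> 0" "f \<ge> 0"
    using \<theta> \<eta> W_nonneg by (auto simp: p_def q_def e_def f_def s_def t_def)
  define C where "C = 1 / sqrt (2 * pi) * exp (p * t\<^sup>2 / 2 + q * s\<^sup>2 / 2 + f * s + e * t)"
  have C: "C \<ge> 0" by (simp add: C_def)
  let ?F = "\<lambda>b. exp (- b * (s * t) - (b * e * f + p * f\<^sup>2 / 2 + q * e\<^sup>2 / 2) / (b\<^sup>2 - p * q)) / sqrt (b\<^sup>2 - p * q)"
  let ?R = "\<lambda>x. exp (- p * (exp x * t)\<^sup>2 / 2 - q * (exp (- x) * s)\<^sup>2 / 2 - f * (exp (- x) * s) - e * (exp x * t))"
  obtain k where k: "J1 = {k}" "k \<in> {i, j}" using half_of_pair(1)[OF ne inv h] by (auto simp: j_def)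
  have S: "sym_integral star {i, star i} J1 W \<theta> \<eta> = ennreal C * sym_pair_integral p q (s * t) e f"
  proof -
    have "sym_integral star {i, star i} J1 W \<theta> \<eta> = (\<integral>\<^sup>+x. ennreal (C * ?F (x k - m) * indicator {sqrt (p * q)<..} (x k - m)) \<partial>(\<Pi>\<^sub>M i\<in>{k}. lborel))"
    proof -
      have "sym_ext star {i, star i} {k} x i = x k" "sym_ext star {i, star i} {k} x (star i) = x k" for x
        using k(2) ij sj fp[folded j_def] by (auto simp: sym_ext_def j_def[symmetric])
      note ext = this
      have "nu_S_dens star {i, star i} {k} W \<theta> \<eta> (sym_ext star {i, star i} {k} x) =
          C * ?F (x k - m) * indicator {sqrt (p * q)<..} (x k - m)" for x
        unfolding C_def p_def q_def m_def e_def f_def s_def t_def j_def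
        by (rule sym_dens_pair[OF sm ne h[unfolded k] ext(1)[of x] ext(2)[of x]])
      then show ?thesis unfolding sym_integral_def fp k Un_empty_left by simp
    qed
    also have "\<dots> = (\<integral>\<^sup>+x. ennreal (C * ?F (x - m) * indicator {sqrt (p * q)<..} (x - m)) \<partial>lborel)"
      by (rule product_nn_integral_singleton) measurable
    also have "\<dots> = (\<integral>\<^sup>+b. ennreal (C * ?F b * indicator {sqrt (p * q)<..} b) \<partial>lborel)"
      by (subst nn_integral_real_affine[of _ 1 m]) simp_all
    also have "\<dots> = (\<integral>\<^sup>+b. ennreal C * (ennreal (?F b) * indicator {sqrt (p * q)<..} b) \<partial>lborel)"
      using C by (intro nn_integral_cong) (auto simp: ennreal_mult'[symmetric] split: split_indicator)
    also have "\<dots> = ennreal C * sym_pair_integral p q (s * t) e f"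
      unfolding sym_pair_integral_def by (rule nn_integral_cmult) measurable
    finally show ?thesis .
  qed
  obtain k' where k': "J1' = {k'}" "k' \<in> {i, j}" using half_of_pair(1)[OF ne inv h'] by (auto simp: j_def)
  have A: "asym_integral star {i, star i} J1' W \<theta> \<eta> = ennreal C * asym_pair_integral p q s t e f"
  proof -
    define \<epsilon> :: real where "\<epsilon> = (if k' = i then 1 else - 1)"
    have "asym_integral star {i, star i} J1' W \<theta> \<eta> = (\<integral>\<^sup>+x. ennreal (C * ?R (\<epsilon> * x k')) \<partial>(\<Pi>\<^sub>M i\<in>{k'}. lborel))"
    proof -
      have "asym_ext star {i, star i} {k'} x i = \<epsilon> * x k'" "asym_ext star {i, star i} {k'} x (star i) = - (\<epsilon> * x k')" for x
        using k'(2) ij sj fp[folded j_def] by (auto simp: asym_ext_def j_def[symmetric] \<epsilon>_def)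
      note ext = this
      have "nu_A_dens star {i, star i} {k'} W \<theta> \<eta> (asym_ext star {i, star i} {k'} x) = C * ?R (\<epsilon> * x k')" for x
        unfolding C_def p_def q_def e_def f_def s_def t_def j_def
        by (rule asym_dens_pair[OF sm ne h'[unfolded k'] ext(1)[of x] ext(2)[of x]])
      then show ?thesis unfolding asym_integral_def k' by simp
    qed
    also have "\<dots> = (\<integral>\<^sup>+x. ennreal (C * ?R (\<epsilon> * x)) \<partial>lborel)"
      by (rule product_nn_integral_singleton) measurable
    also have "\<dots> = (\<integral>\<^sup>+x. ennreal (C * ?R x) \<partial>lborel)"
      by (subst nn_integral_real_affine[of "\<lambda>x. ennreal (C * ?R x)" \<epsilon> 0]) (simp_all add: \<epsilon>_def)
    also have "\<dots> = ennreal C * asym_pair_integral p q s t e f"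
      unfolding asym_pair_integral_def ennreal_mult'[OF C] by (rule nn_integral_cmult) measurable
    finally show ?thesis .
  qed
  show "sym_integral star {i, star i} J1 W \<theta> \<eta> = asym_integral star {i, star i} J1' W \<theta> \<eta>"
    unfolding S A pair_integrals_eq[OF nn(1,2,3,4,5,6)] ..
qed

text \<open>
  Split off one orbit at a time.
\<close>

lemma balanced_all:
  fixes star :: "'v::finite \<Rightarrow> 'v"
  assumes inv: "\<And>i. star (star i) = i" and J: "star ` J = J"
  shows "balanced star J"
  using J
proof (induction "card J" arbitrary: J rule: less_induct)
  case less
  show ?case
  proof (cases "J = {}")
    case True
    then show ?thesis by (simp add: balanced_empty)
  next
    case False
    then obtain i where i: "i \<in> J" by blast
    have si: "star i \<in> J" using less.prems i by blast
    define orb where "orb = {i, star i}"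
    have orb: "star ` orb = orb" using inv by (auto simp: orb_def)
    have D: "star ` (J - orb) = J - orb"
    proof -
      have "inj star" by (metis injI inv)
      then show ?thesis using orb less.prems by (simp add: image_set_diff)
    qed
    have b_orb: "balanced star orb"
      using balanced_fixed_point[of star i] balanced_pair[of star i, OF inv] by (cases "star i = i") (auto simp: orb_def)
    have "card (J - orb) < card J" by (rule psubset_card_mono) (use i in \<open>auto simp: orb_def\<close>)
    then have "balanced star (J - orb)" by (rule less.hyps[OF _ D])
    then have "balanced star (orb \<union> (J - orb))" by (intro balanced_union[OF inv b_orb _ _ orb D]) auto
    moreover have "orb \<union> (J - orb) = J" using i si by (auto simp: orb_def)
    ultimately show ?thesis by simp
  qed
qed

section \<open>Total masses of the measures\<close>

text \<open>
  The left inverse \<open>g\<close> allows a countable cover of \<open>M\<close> by sets of finite measure to be pulled back to \<open>N\<close>.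
\<close>

lemma sigma_finite_distr:
  assumes f: "f \<in> M \<rightarrow>\<^sub>M N" and g: "g \<in> N \<rightarrow>\<^sub>M M" and gf: "\<And>x. x \<in> space M \<Longrightarrow> g (f x) = x"
    and M: "sigma_finite_measure M"
  shows "sigma_finite_measure (distr M N f)"
proof -
  interpret sigma_finite_measure M by fact
  obtain A where A: "countable A" "A \<subseteq> sets M" "\<Union> A = space M" "\<forall>a\<in>A. emeasure M a \<noteq> \<infinity>"
    using sigma_finite_countable by blast
  show ?thesis
  proof
    let ?B = "(\<lambda>a. g -` a \<inter> space N) ` A"
    have "emeasure (distr M N f) (g -` a \<inter> space N) \<noteq> \<infinity>" if a: "a \<in> A" for a
    proof -
      have "f -` (g -` a \<inter> space N) \<inter> space M = a"
      proof (intro equalityI subsetI)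
        fix x assume "x \<in> f -` (g -` a \<inter> space N) \<inter> space M"
        then show "x \<in> a" using gf[of x] by simp
      next
        fix x assume x: "x \<in> a"
        then have "x \<in> space M" using A(2) a sets.sets_into_space by blast
        then show "x \<in> f -` (g -` a \<inter> space N) \<inter> space M"
          using x gf[of x] measurable_space[OF f, of x] by simp
      qed
      moreover have "g -` a \<inter> space N \<in> sets N" using A(2) a g by (intro measurable_sets) blast+
      ultimately show ?thesis using A(4) a by (simp add: emeasure_distr[OF f])
    qed
    then have "\<forall>b\<in>?B. emeasure (distr M N f) b \<noteq> \<infinity>" by (simp only: ball_simps) blast
    moreover have "?B \<subseteq> sets (distr M N f)" using A(2) measurable_sets[OF g] by auto
    moreover have "\<Union> ?B = space (distr M N f)"
    proof -
      have "\<Union> ?B = g -` (\<Union> A) \<inter> space N" by auto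
      then show ?thesis unfolding A(3) using measurable_space[OF g] by auto
    qed
    moreover have "countable ?B" using A(1) by (rule countable_image)
    ultimately show "\<exists>A. countable A \<and> A \<subseteq> sets (distr M N f) \<and> \<Union> A = space (distr M N f) \<and> (\<forall>a\<in>A. emeasure (distr M N f) a \<noteq> \<infinity>)"
      by (intro exI[of _ ?B] conjI)
  qed
qed

lemma sigma_finite_PiM_lborel:
  "sigma_finite_measure (\<Pi>\<^sub>M i\<in>J. lborel :: real measure)" if "finite J"
proof -
  interpret finite_product_sigma_finite "\<lambda>_. lborel :: real measure" J by standard fact
  show ?thesis by (rule sigma_finite_measure_axioms)
qed

lemma sigma_finite_leb_A:
  fixes J :: "'v::finite set"
  assumes inv: "\<And>i. star (star i) = i" and half: "half_of star J J1"
  shows "sigma_finite_measure (leb_A star J J1)"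
  unfolding leb_A_def
proof (rule sigma_finite_distr[OF asym_ext_measurable[OF inv half], where g = "\<lambda>a. restrict a J1"])
  have sub: "J1 \<subseteq> J" using half unfolding half_of_def by blast
  have "(\<lambda>a. restrict a J1) \<in> (\<Pi>\<^sub>M i\<in>J. borel) \<rightarrow>\<^sub>M (\<Pi>\<^sub>M i\<in>J1. lborel :: real measure)"
  proof (rule measurable_restrict)
    fix i assume "i \<in> J1"
    then have "i \<in> J" using sub by blast
    from measurable_component_singleton[OF this, of "\<lambda>_. borel :: real measure"]
    show "(\<lambda>a. a i) \<in> (\<Pi>\<^sub>M i\<in>J. borel) \<rightarrow>\<^sub>M (lborel :: real measure)" by simp
  qed
  then show "(\<lambda>a. restrict a J1) \<in> restrict_space (\<Pi>\<^sub>M i\<in>J. borel) (asym_space star J) \<rightarrow>\<^sub>M (\<Pi>\<^sub>M i\<in>J1. lborel)"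
    by (rule measurable_restrict_space1)
  show "restrict (asym_ext star J J1 x) J1 = x" if "x \<in> space (\<Pi>\<^sub>M i\<in>J1. lborel)" for x
    using that sub by (auto simp: asym_ext_def space_PiM PiE_def extensional_def fun_eq_iff)
qed (rule sigma_finite_PiM_lborel, simp)

lemma component_measurable_leb_S: "i \<in> J \<Longrightarrow> (\<lambda>\<beta>. \<beta> i) \<in> borel_measurable (leb_S star J J1)"
  unfolding leb_S_def
  using measurable_restrict_space1[OF measurable_component_singleton[of i J "\<lambda>_. borel :: real measure"]] by simp

lemma component_measurable_leb_A: "i \<in> J \<Longrightarrow> (\<lambda>\<beta>. \<beta> i) \<in> borel_measurable (leb_A star J J1)"
  unfolding leb_A_def
  using measurable_restrict_space1[OF measurable_component_singleton[of i J "\<lambda>_. borel :: real measure"]] by simp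

context star_matrix begin

lemma nn_integral_nu_S:
  assumes half: "half_of star J J1"
  shows "(\<integral>\<^sup>+\<beta>. 1 \<partial>nu_S star J J1 W \<theta> \<eta>) = sym_integral star J J1 W \<theta> \<eta>"
proof -
  have m: "(\<lambda>\<beta>. ennreal (nu_S_dens star J J1 W \<theta> \<eta> \<beta>)) \<in> borel_measurable (leb_S star J J1)"
    by (intro measurable_compose[OF _ measurable_ennreal] nu_S_dens_measurable[OF W_nonneg half_star[OF inv half]]
        component_measurable_leb_S) auto
  have "(\<integral>\<^sup>+\<beta>. 1 \<partial>nu_S star J J1 W \<theta> \<eta>) = (\<integral>\<^sup>+\<beta>. ennreal (nu_S_dens star J J1 W \<theta> \<eta> \<beta>) \<partial>leb_S star J J1)"
    unfolding nu_S_def by (subst nn_integral_density[OF m]) simp_all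
  also have "\<dots> = sym_integral star J J1 W \<theta> \<eta>"
    unfolding sym_integral_def using m unfolding leb_S_def
    by (intro nn_integral_distr sym_ext_measurable[OF inv half]) simp
  finally show ?thesis .
qed

lemma nn_integral_nu_A:
  assumes half: "half_of star J J1"
  shows "(\<integral>\<^sup>+a. 1 \<partial>nu_A star J J1 W \<theta> \<eta>) = asym_integral star J J1 W \<theta> \<eta>"
proof -
  have m: "(\<lambda>a. ennreal (nu_A_dens star J J1 W \<theta> \<eta> a)) \<in> borel_measurable (leb_A star J J1)"
    by (intro measurable_compose[OF _ measurable_ennreal] nu_A_dens_measurable[OF half_star[OF inv half]]
        component_measurable_leb_A)
  have "(\<integral>\<^sup>+a. 1 \<partial>nu_A star J J1 W \<theta> \<eta>) = (\<integral>\<^sup>+a. ennreal (nu_A_dens star J J1 W \<theta> \<eta> a) \<partial>leb_A star J J1)"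
    unfolding nu_A_def by (subst nn_integral_density[OF m]) simp_all
  also have "\<dots> = asym_integral star J J1 W \<theta> \<eta>"
    unfolding asym_integral_def using m unfolding leb_A_def
    by (intro nn_integral_distr asym_ext_measurable[OF inv half]) simp
  finally show ?thesis .
qed

text \<open>
  The density of the mixed measure involves the chosen inverse through \<open>check_W\<close>; on symmetric \<open>\<beta>\<close> it
  coincides with the expression in \<open>mixed_dens\<close>, which is jointly measurable by \<open>nu_S_dens_measurable\<close>.
\<close>

lemma nn_integral_Q_meas:
  assumes I1: "half_of star I I1" and K1: "half_of star (- I) K1" and \<theta>: "\<And>i. \<theta> i > 0"
  shows "(\<integral>\<^sup>+x. 1 \<partial>Q_meas star I I1 K1 W \<theta> \<eta>) = mixed_integral I I1 (- I) K1 \<theta> \<eta>"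
proof -
  let ?K = "- I" and ?b = "sym_ext star I I1"
  let ?dA = "\<lambda>\<beta>. nu_A_dens star (- I) K1 (check_W I W \<beta>) \<theta> (check_eta I W \<eta> \<beta>)"
  let ?AK = "\<lambda>\<beta>. asym_integral star (- I) K1 (check_W I W \<beta>) \<theta> (check_eta I W \<eta> \<beta>)"
  let ?LS = "leb_S star I I1" and ?LA = "leb_A star (- I) K1"
  interpret A: sigma_finite_measure ?LA by (rule sigma_finite_leb_A[OF inv K1])
  note I = half_star[OF inv I1] and K = half_star[OF inv K1]
  have hat: "hat_eta I W \<theta> \<eta> = (shift_eta ?K \<theta> \<eta>)" by (simp add: hat_eta_def)
  let ?d = "\<lambda>\<beta> a. ennreal (nu_S_dens star I I1 W \<theta> (hat_eta I W \<theta> \<eta>) \<beta>) *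
         ennreal (?dA \<beta> a)"
  let ?g = "\<lambda>\<beta> a. ennreal (split_factor I ?K K1 \<theta> \<eta> a) *
       ennreal (nu_S_dens star I I1 W \<theta> (shift_eta ?K (exp_star star a \<theta>) \<eta>) \<beta>)"
  have sp: "\<beta> (star i) = \<beta> i" if "\<beta> \<in> space ?LS" "i \<in> I" for \<beta> i
    using that by (auto simp: leb_S_def space_restrict_space sym_space_def)
  have eq: "?d \<beta> a = ?g \<beta> a" if "\<beta> \<in> space ?LS" for \<beta> a
    unfolding ennreal_mult'[OF nu_S_dens_nonneg[OF W_nonneg \<theta>], symmetric] ennreal_mult'[OF split_factor_nonneg, symmetric] hat
    using sp[OF that] by (subst mixed_dens[OF _ I K]) auto
  have mg: "(\<lambda>z. ?g (fst z) (snd z)) \<in> borel_measurable (?LS \<Otimes>\<^sub>M ?LA)"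
  proof (rule borel_measurable_times_ennreal)
    show "(\<lambda>z. ennreal (split_factor I ?K K1 \<theta> \<eta> (snd z))) \<in> borel_measurable (?LS \<Otimes>\<^sub>M ?LA)"
      by (intro measurable_compose[OF _ measurable_ennreal] split_factor_measurable[OF K]
          measurable_compose[OF measurable_snd component_measurable_leb_A])
    have "(\<lambda>z. exp_star star (snd z) \<theta> j) \<in> borel_measurable (?LS \<Otimes>\<^sub>M ?LA)" if "j \<in> ?K" for j
      by (rule exp_star_measurable[OF K _ that])
        (rule measurable_compose[OF measurable_snd component_measurable_leb_A])
    then show "(\<lambda>z. ennreal (nu_S_dens star I I1 W \<theta> (shift_eta ?K (exp_star star (snd z) \<theta>) \<eta>) (fst z))) \<in> borel_measurable (?LS \<Otimes>\<^sub>M ?LA)"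
      unfolding mult_vec_on_def
      by (intro measurable_compose[OF _ measurable_ennreal] nu_S_dens_measurable[OF W_nonneg I]
          measurable_compose[OF measurable_fst component_measurable_leb_S]
          borel_measurable_add borel_measurable_const borel_measurable_sum borel_measurable_times)
  qed
  have md: "(\<lambda>(\<beta>, a). ?d \<beta> a) \<in> borel_measurable (?LS \<Otimes>\<^sub>M ?LA)"
  proof (subst measurable_cong)
    show "(\<lambda>(\<beta>, a). ?d \<beta> a) z = ?g (fst z) (snd z)" if "z \<in> space (?LS \<Otimes>\<^sub>M ?LA)" for z
      using that eq[of "fst z" "snd z"] by (auto simp: space_pair_measure)
  qed (rule mg)
  have "(\<integral>\<^sup>+x. 1 \<partial>Q_meas star I I1 K1 W \<theta> \<eta>) = (\<integral>\<^sup>+z. (\<lambda>(\<beta>, a). ?d \<beta> a) z \<partial>(?LS \<Otimes>\<^sub>M ?LA))"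
    unfolding Q_meas_def by (subst nn_integral_density[OF md]) simp_all
  also have "\<dots> = (\<integral>\<^sup>+\<beta>. \<integral>\<^sup>+a. ?d \<beta> a \<partial>?LA \<partial>?LS)"
    by (subst A.nn_integral_fst[OF md, symmetric]) simp
  also have "\<dots> = (\<integral>\<^sup>+x. \<integral>\<^sup>+a. ?d (?b x) a \<partial>?LA \<partial>(\<Pi>\<^sub>M i\<in>fixed_pts star I \<union> I1. lborel))"
  proof -
    have "(\<lambda>\<beta>. \<integral>\<^sup>+a. ?d \<beta> a \<partial>?LA) \<in> borel_measurable ?LS"
      using A.borel_measurable_nn_integral_fst[OF md] by simp
    then show ?thesis unfolding leb_S_def
      by (intro nn_integral_distr sym_ext_measurable[OF inv I1]) simp
  qed
  also have "\<dots> = mixed_integral I I1 ?K K1 \<theta> \<eta>"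
    unfolding mixed_integral_def hat
  proof (rule nn_integral_cong)
    fix x
    define \<beta> where "\<beta> = ?b x"
    let ?c = "ennreal (nu_S_dens star I I1 W \<theta> (shift_eta ?K \<theta> \<eta>) \<beta>)"
    have m: "(\<lambda>a. ennreal (?dA \<beta> a)) \<in> borel_measurable ?LA"
      by (intro measurable_compose[OF _ measurable_ennreal] nu_A_dens_measurable[OF K] component_measurable_leb_A)
    have "(\<integral>\<^sup>+a. ?c * ennreal (?dA \<beta> a) \<partial>?LA)
      = ?c * (\<integral>\<^sup>+a. ennreal (?dA \<beta> a) \<partial>?LA)"
      by (rule nn_integral_cmult[OF m])
    also have "(\<integral>\<^sup>+a. ennreal (?dA \<beta> a) \<partial>?LA)
      = ?AK \<beta>"
      unfolding asym_integral_def using m unfolding leb_A_def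
      by (intro nn_integral_distr asym_ext_measurable[OF inv K1]) simp
    finally show "(\<integral>\<^sup>+a. ennreal (nu_S_dens star I I1 W \<theta> (shift_eta ?K \<theta> \<eta>) (?b x)) *
        ennreal (?dA (?b x) a) \<partial>?LA)
      = ennreal (nu_S_dens star I I1 W \<theta> (shift_eta ?K \<theta> \<eta>) (?b x)) *
        ?AK (?b x)"
      unfolding \<beta>_def .
  qed
  finally show ?thesis .
qed

end


section \<open>The theorem\<close>

theorem theorem6p6:
  fixes E :: "('v::finite \<times> 'v) set"
    and star :: "'v \<Rightarrow> 'v"
    and W :: "'v \<Rightarrow> 'v \<Rightarrow> real"
    and \<theta> \<eta> :: "'v \<Rightarrow> real"
    and V1 I I1 K1 :: "'v set"
  assumes star_invol: "\<And>i. star (star i) = i"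
    and star_edges: "\<And>i j. (i, j) \<in> E \<Longrightarrow> (star j, star i) \<in> E"
    and W_pos: "\<And>i j. (i, j) \<in> E \<Longrightarrow> W i j > 0"
    and W_star: "\<And>i j. (i, j) \<in> E \<Longrightarrow> W i j = W (star j) (star i)"
    and W_zero: "\<And>i j. (i, j) \<notin> E \<Longrightarrow> W i j = 0"
    and I_star: "star ` I = I"
    and V1: "half_of star UNIV V1"
    and I1: "half_of star I I1"
    and K1: "half_of star (- I) K1"
    and theta_pos: "\<And>i. \<theta> i > 0"
    and eta_nonneg: "\<And>i. \<eta> i \<ge> 0"
  shows "(\<integral>\<^sup>+ \<beta>. 1 \<partial>nu_S star UNIV V1 W \<theta> \<eta>) = (\<integral>\<^sup>+ x. 1 \<partial>Q_meas star I I1 K1 W \<theta> \<eta>) \<and>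
         (\<integral>\<^sup>+ x. 1 \<partial>Q_meas star I I1 K1 W \<theta> \<eta>) = (\<integral>\<^sup>+ a. 1 \<partial>nu_A star UNIV V1 W \<theta> \<eta>)"
proof -
  interpret star_matrix star W
  proof
    show "star (star i) = i" for i by (rule star_invol)
    show "W i j \<ge> 0" for i j using W_pos[of i j] W_zero[of i j] by (cases "(i, j) \<in> E") auto
    show "W i j = W (star j) (star i)" for i j
    proof (cases "(i, j) \<in> E")
      case False
      then have "(star j, star i) \<notin> E" using star_edges[of "star j" "star i"] by (auto simp: star_invol)
      then show ?thesis using False W_zero by simp
    qed (rule W_star)
  qed
  note K_star = half_star[OF star_invol K1]
  have bI: "balanced star I" and bK: "balanced star (- I)"
    using balanced_all[OF star_invol] I_star K_star by blast+
  have UN: "I \<union> - I = UNIV" "- I \<union> I = UNIV" by auto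
  have V: "half_of star (I \<union> - I) V1" "half_of star (- I \<union> I) V1" unfolding UN by (rule V1)+
  have VI: "half_of star I (V1 \<inter> I)" and VK: "half_of star (- I) (V1 \<inter> - I)"
    by (rule half_of_inter[OF star_invol V(1) I_star], rule half_of_inter[OF star_invol V(2) K_star])
  have "sym_integral star UNIV V1 W \<theta> \<eta> = mixed_integral I (V1 \<inter> I) (- I) K1 \<theta> \<eta>"
    using sym_eq_mixed_integral[OF bK _ I_star K_star V(1) K1 theta_pos eta_nonneg] unfolding UN by simp
  also have "\<dots> = mixed_integral I I1 (- I) K1 \<theta> \<eta>"
    using mixed_integral_half_indep_left[OF bI _ VI I1 K1 theta_pos eta_nonneg] by simp
  finally have SQ: "sym_integral star UNIV V1 W \<theta> \<eta> = mixed_integral I I1 (- I) K1 \<theta> \<eta>" .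
  have "mixed_integral I I1 (- I) K1 \<theta> \<eta> = mixed_integral I I1 (- I) (V1 \<inter> - I) \<theta> \<eta>"
    by (rule mixed_integral_half_indep_right[OF bK I1 K1 VK theta_pos eta_nonneg])
  also have "\<dots> = asym_integral star UNIV V1 W \<theta> \<eta>"
    using mixed_eq_asym_integral[OF bI _ I_star K_star I1 V(1) theta_pos eta_nonneg] unfolding UN by simp
  finally have QA: "mixed_integral I I1 (- I) K1 \<theta> \<eta> = asym_integral star UNIV V1 W \<theta> \<eta>" .
  show ?thesis
    unfolding nn_integral_nu_S[OF V1] nn_integral_nu_A[OF V1] nn_integral_Q_meas[OF I1 K1 theta_pos] SQ QA by simp
qed

end
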